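(* Let $H$ be a co-Frobenius Hopf algebra over a field $\Bbbk$. Let $S$ be a simple right $H$-comodule and let $d$ be the largest dimension of a composition factor of $E(\Bbbk)$. Then $$\ell(E(S))\le d\,\dim E(\Bbbk).$$
   Context: A Hopf algebra is co-Frobenius if it has a nonzero integral, i.e. a nonzero linear map $\int:H\to\Bbbk$ with $\int(h_{(2)})h_{(1)}=\int(h)1_H$ for all $h\in H$. For a right $H$-comodule $M$, $E(M)$ denotes its injective hull in the category of right $H$-comodules and $\ell(M)$ its composition length. $\Bbbk$ denotes the trivial comodule. It is known that for $H$ co-Frobenius the injective hull of every simple comodule is finite dimensional. *)

theory Defs
  imports Complex_Main "HOL-Library.Function_Algebras" "HOL-Library.Extended_Nat"
begin

section \<open>Tensor products of vector spaces over a field\<close>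

text \<open>
  Vector spaces are the ones of the library, i.e. an additive group with a scalar multiplication
  (locale \<^locale>\<open>vector_space\<close>), and linear maps are \<^const>\<open>Vector_Spaces.linear\<close>.

  The algebraic tensor product of M and N is realised inside the dual of the space of bilinear
  forms on M and N: the pure tensor of m and n is the functional sending B to B m n, and the tensor
  product is the set of finite sums of pure tensors. Over a field this is the usual tensor
  product, because bilinear forms separate the elements of the latter. Consequently, for a tensor
  t, the value t B is the image of t under the linear form induced by B; in Sweedler notation,
  if t is the coaction of m, then t B is the sum of the B (m_(0)) (m_(1)).
\<close>

type_synonym ('k, 'm, 'n) tensor = "('m \<Rightarrow> 'n \<Rightarrow> 'k) \<Rightarrow> 'k"

definition fun_scale :: "'k::field \<Rightarrow> ('x \<Rightarrow> 'k) \<Rightarrow> 'x \<Rightarrow> 'k" where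
  "fun_scale c f = (\<lambda>x. c * f x)"

definition bilinear_map ::
  "('k::field \<Rightarrow> 'm::ab_group_add \<Rightarrow> 'm) \<Rightarrow> ('k \<Rightarrow> 'n::ab_group_add \<Rightarrow> 'n)
    \<Rightarrow> ('k \<Rightarrow> 'p::ab_group_add \<Rightarrow> 'p) \<Rightarrow> ('m \<Rightarrow> 'n \<Rightarrow> 'p) \<Rightarrow> bool" where
  "bilinear_map sM sN sP B \<longleftrightarrow>
     (\<forall>n. Vector_Spaces.linear sM sP (\<lambda>m. B m n)) \<and> (\<forall>m. Vector_Spaces.linear sN sP (B m))"

definition trilinear_form ::
  "('k::field \<Rightarrow> 'm::ab_group_add \<Rightarrow> 'm) \<Rightarrow> ('k \<Rightarrow> 'n::ab_group_add \<Rightarrow> 'n)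
    \<Rightarrow> ('k \<Rightarrow> 'p::ab_group_add \<Rightarrow> 'p) \<Rightarrow> ('m \<Rightarrow> 'n \<Rightarrow> 'p \<Rightarrow> 'k) \<Rightarrow> bool" where
  "trilinear_form sM sN sP T \<longleftrightarrow>
     (\<forall>n p. Vector_Spaces.linear sM (*) (\<lambda>m. T m n p)) \<and>
     (\<forall>m p. Vector_Spaces.linear sN (*) (\<lambda>n. T m n p)) \<and>
     (\<forall>m n. Vector_Spaces.linear sP (*) (\<lambda>p. T m n p))"

definition pure_tensor ::
  "('k::field \<Rightarrow> 'm::ab_group_add \<Rightarrow> 'm) \<Rightarrow> ('k \<Rightarrow> 'n::ab_group_add \<Rightarrow> 'n)
    \<Rightarrow> 'm \<Rightarrow> 'n \<Rightarrow> ('k, 'm, 'n) tensor" where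
  "pure_tensor sM sN m n = (\<lambda>B. if bilinear_map sM sN (*) B then B m n else 0)"

text \<open>
  For a subspace V of M, this is the tensor product of V and N, as a subspace of that of M and N.
\<close>

definition tensors ::
  "('k::field \<Rightarrow> 'm::ab_group_add \<Rightarrow> 'm) \<Rightarrow> ('k \<Rightarrow> 'n::ab_group_add \<Rightarrow> 'n)
    \<Rightarrow> 'm set \<Rightarrow> ('k, 'm, 'n) tensor set" where
  "tensors sM sN V =
     {t. \<exists>(l::nat) x y. (\<forall>i<l. x i \<in> V) \<and> t = (\<Sum>i<l. pure_tensor sM sN (x i) (y i))}"

text \<open>
  The linear map induced by a bilinear map \<open>\<beta>\<close> with values in an arbitrary vector space;
  see the lemma \<open>tensor_lift_sum\<close> below for its well-definedness.
\<close>

definition tensor_lift ::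
  "('k::field \<Rightarrow> 'm::ab_group_add \<Rightarrow> 'm) \<Rightarrow> ('k \<Rightarrow> 'n::ab_group_add \<Rightarrow> 'n)
    \<Rightarrow> ('m \<Rightarrow> 'n \<Rightarrow> 'p::ab_group_add) \<Rightarrow> ('k, 'm, 'n) tensor \<Rightarrow> 'p" where
  "tensor_lift sM sN \<beta> t =
     (THE p. \<exists>(l::nat) x y. t = (\<Sum>i<l. pure_tensor sM sN (x i) (y i)) \<and> p = (\<Sum>i<l. \<beta> (x i) (y i)))"

lemma sum_fun_apply: "(\<Sum>i\<in>A. f i) x = (\<Sum>i\<in>A. f i x)"
  by (induction A rule: infinite_finite_induct) auto

lemma vector_space_fun_scale: "vector_space (fun_scale :: 'k::field \<Rightarrow> ('x \<Rightarrow> 'k) \<Rightarrow> _)"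
  by unfold_locales (auto simp: fun_scale_def fun_eq_iff algebra_simps)

lemma linear_form_separates:
  fixes s :: "'k::field \<Rightarrow> 'p::ab_group_add \<Rightarrow> 'p"
  assumes "vector_space s" and "\<And>\<phi>. Vector_Spaces.linear s (*) \<phi> \<Longrightarrow> \<phi> p = \<phi> q"
  shows "p = q"
proof (rule ccontr)
  assume "p \<noteq> q"
  interpret vector_space s by fact
  interpret K: vector_space "(*) :: 'k \<Rightarrow> 'k \<Rightarrow> 'k"
    by unfold_locales (auto simp: algebra_simps)
  interpret P: vector_space_pair s "(*) :: 'k \<Rightarrow> 'k \<Rightarrow> 'k" ..
  have "independent {p - q}"
    using \<open>p \<noteq> q\<close> by simp
  from P.linear_independent_extend[OF this, of "\<lambda>_. 1"]
  obtain \<phi> where \<phi>: "Vector_Spaces.linear s (*) \<phi>" "\<phi> (p - q) = 1"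
    by auto
  interpret \<phi>: Vector_Spaces.linear s "(*)" \<phi> by fact
  show False
    using assms(2)[OF \<phi>(1)] \<phi>(2) by (simp add: \<phi>.diff)
qed

lemma bilinear_map_compose:
  assumes "bilinear_map sM sN sP \<beta>" "Vector_Spaces.linear sP sQ \<phi>"
  shows "bilinear_map sM sN sQ (\<lambda>m n. \<phi> (\<beta> m n))"
  using assms unfolding bilinear_map_def
  by (auto dest!: Vector_Spaces.linear_compose[OF _ assms(2)] simp: o_def dest: spec)

lemma tensor_lift_sum:
  fixes l :: nat
  assumes \<beta>: "bilinear_map sM sN sP \<beta>"
  shows "tensor_lift sM sN \<beta> (\<Sum>i<l. pure_tensor sM sN (x i) (y i)) = (\<Sum>i<l. \<beta> (x i) (y i))"
  unfolding tensor_lift_def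
proof (rule the_equality)
  show "\<exists>l' x' y'. (\<Sum>i<l. pure_tensor sM sN (x i) (y i)) = (\<Sum>i<(l'::nat). pure_tensor sM sN (x' i) (y' i))
      \<and> (\<Sum>i<l. \<beta> (x i) (y i)) = (\<Sum>i<l'. \<beta> (x' i) (y' i))"
    by blast
next
  fix p
  assume "\<exists>l' x' y'. (\<Sum>i<l. pure_tensor sM sN (x i) (y i)) = (\<Sum>i<(l'::nat). pure_tensor sM sN (x' i) (y' i))
      \<and> p = (\<Sum>i<l'. \<beta> (x' i) (y' i))"
  then obtain l' :: nat and x' y' where
    eq: "(\<Sum>i<l. pure_tensor sM sN (x i) (y i)) = (\<Sum>i<l'. pure_tensor sM sN (x' i) (y' i))"
    and p: "p = (\<Sum>i<l'. \<beta> (x' i) (y' i))"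
    by blast
  have "vector_space sP"
    using \<beta> by (auto simp: bilinear_map_def Vector_Spaces.linear_def)
  then show "p = (\<Sum>i<l. \<beta> (x i) (y i))"
  proof (rule linear_form_separates)
    fix \<phi> assume \<phi>: "Vector_Spaces.linear sP (*) \<phi>"
    interpret \<phi>: Vector_Spaces.linear sP "(*)" \<phi> by fact
    have B: "bilinear_map sM sN (*) (\<lambda>m n. \<phi> (\<beta> m n))"
      using \<beta> \<phi> by (rule bilinear_map_compose)
    show "\<phi> p = \<phi> (\<Sum>i<l. \<beta> (x i) (y i))"
      using fun_cong[OF eq, of "\<lambda>m n. \<phi> (\<beta> m n)"] B
      by (simp add: p \<phi>.sum sum_fun_apply pure_tensor_def)
  qed
qed


section \<open>Hopf algebras\<close>

text \<open>
  The underlying ring of the Hopf algebra is given by the type class \<^class>\<open>ring_1\<close>;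
  the remaining structure is collected in a record.
\<close>

record ('k, 'h) hopf =
  hscale :: "'k \<Rightarrow> 'h \<Rightarrow> 'h"
  comult :: "'h \<Rightarrow> ('k, 'h, 'h) tensor"
  counit :: "'h \<Rightarrow> 'k"
  antipode :: "'h \<Rightarrow> 'h"

definition coalgebra :: "('k::field, 'h::ring_1) hopf \<Rightarrow> bool" where
  "coalgebra H \<longleftrightarrow>
     Vector_Spaces.linear (hscale H) fun_scale (comult H) \<and>
     Vector_Spaces.linear (hscale H) (*) (counit H) \<and>
     (\<forall>h. comult H h \<in> tensors (hscale H) (hscale H) UNIV) \<and>
     (\<forall>h T. trilinear_form (hscale H) (hscale H) (hscale H) T \<longrightarrow>
        comult H h (\<lambda>a b. comult H a (\<lambda>a1 a2. T a1 a2 b)) =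
        comult H h (\<lambda>a b. comult H b (\<lambda>b1 b2. T a b1 b2))) \<and>
     (\<forall>h. tensor_lift (hscale H) (hscale H) (\<lambda>a b. hscale H (counit H a) b) (comult H h) = h) \<and>
     (\<forall>h. tensor_lift (hscale H) (hscale H) (\<lambda>a b. hscale H (counit H b) a) (comult H h) = h)"

definition bialgebra :: "('k::field, 'h::ring_1) hopf \<Rightarrow> bool" where
  "bialgebra H \<longleftrightarrow>
     coalgebra H \<and>
     bilinear_map (hscale H) (hscale H) (hscale H) (*) \<and>
     (\<forall>g h B. bilinear_map (hscale H) (hscale H) (*) B \<longrightarrow>
        comult H (g * h) B = comult H g (\<lambda>a b. comult H h (\<lambda>c d. B (a * c) (b * d)))) \<and>
     comult H 1 = pure_tensor (hscale H) (hscale H) 1 1 \<and>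
     (\<forall>g h. counit H (g * h) = counit H g * counit H h) \<and>
     counit H 1 = 1"

definition hopf_algebra :: "('k::field, 'h::ring_1) hopf \<Rightarrow> bool" where
  "hopf_algebra H \<longleftrightarrow>
     bialgebra H \<and>
     Vector_Spaces.linear (hscale H) (hscale H) (antipode H) \<and>
     (\<forall>h. tensor_lift (hscale H) (hscale H) (\<lambda>a b. antipode H a * b) (comult H h)
            = hscale H (counit H h) 1) \<and>
     (\<forall>h. tensor_lift (hscale H) (hscale H) (\<lambda>a b. a * antipode H b) (comult H h)
            = hscale H (counit H h) 1)"

definition integral_on :: "('k::field, 'h::ring_1) hopf \<Rightarrow> ('h \<Rightarrow> 'k) \<Rightarrow> bool" where
  "integral_on H \<psi> \<longleftrightarrow>
     Vector_Spaces.linear (hscale H) (*) \<psi> \<and>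
     (\<forall>h. tensor_lift (hscale H) (hscale H) (\<lambda>a b. hscale H (\<psi> b) a) (comult H h)
            = hscale H (\<psi> h) 1)"

definition co_Frobenius :: "('k::field, 'h::ring_1) hopf \<Rightarrow> bool" where
  "co_Frobenius H \<longleftrightarrow> (\<exists>\<psi>. integral_on H \<psi> \<and> (\<exists>h. \<psi> h \<noteq> 0))"


section \<open>Right comodules\<close>

text \<open>
  A comodule has as carrier a subspace of a vector space whose elements form a whole type. Linear
  maps between carriers (coactions, morphisms) are represented by linear maps of
  the surrounding vector spaces; over a field every linear map defined on a subspace is the
  restriction of such a map, and only its values on the carrier matter. In particular, the
  condition that the coaction takes values in tensors outside of the carrier is no restriction:
  extend it by zero on a complement.
\<close>

record ('k, 'm, 'h) comod =
  car :: "'m set"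
  scal :: "'k \<Rightarrow> 'm \<Rightarrow> 'm"
  coact :: "'m \<Rightarrow> ('k, 'm, 'h) tensor"

definition comodule ::
  "('k::field, 'h::ring_1) hopf \<Rightarrow> ('k, 'm::ab_group_add, 'h) comod \<Rightarrow> bool" where
  "comodule H M \<longleftrightarrow>
     Vector_Spaces.linear (scal M) fun_scale (coact M) \<and>
     (\<forall>m. coact M m \<in> tensors (scal M) (hscale H) UNIV) \<and>
     module.subspace (scal M) (car M) \<and>
     (\<forall>m\<in>car M. coact M m \<in> tensors (scal M) (hscale H) (car M)) \<and>
     (\<forall>m\<in>car M. \<forall>T. trilinear_form (scal M) (hscale H) (hscale H) T \<longrightarrow>
        coact M m (\<lambda>n h. coact M n (\<lambda>n' h'. T n' h' h)) =
        coact M m (\<lambda>n h. comult H h (\<lambda>h1 h2. T n h1 h2))) \<and>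
     (\<forall>m\<in>car M. tensor_lift (scal M) (hscale H) (\<lambda>n h. scal M (counit H h) n) (coact M m) = m)"

definition comodule_hom ::
  "('k::field, 'h::ring_1) hopf \<Rightarrow> ('k, 'm::ab_group_add, 'h) comod
    \<Rightarrow> ('k, 'n::ab_group_add, 'h) comod \<Rightarrow> ('m \<Rightarrow> 'n) \<Rightarrow> bool" where
  "comodule_hom H M N f \<longleftrightarrow>
     Vector_Spaces.linear (scal M) (scal N) f \<and> f ` car M \<subseteq> car N \<and>
     (\<forall>m\<in>car M. \<forall>B. bilinear_map (scal N) (hscale H) (*) B \<longrightarrow>
        coact N (f m) B = coact M m (\<lambda>m' h. B (f m') h))"

definition subcomodule ::
  "('k::field, 'h::ring_1) hopf \<Rightarrow> ('k, 'm::ab_group_add, 'h) comod \<Rightarrow> 'm set \<Rightarrow> bool" where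
  "subcomodule H M W \<longleftrightarrow> W \<subseteq> car M \<and> comodule H (M\<lparr>car := W\<rparr>)"

definition simple_comodule ::
  "('k::field, 'h::ring_1) hopf \<Rightarrow> ('k, 'm::ab_group_add, 'h) comod \<Rightarrow> bool" where
  "simple_comodule H M \<longleftrightarrow>
     comodule H M \<and> car M \<noteq> {0} \<and> (\<forall>W. subcomodule H M W \<longrightarrow> W = {0} \<or> W = car M)"

definition trivial_comodule :: "('k::field, 'h::ring_1) hopf \<Rightarrow> ('k, 'k, 'h) comod" where
  "trivial_comodule H = \<lparr>car = UNIV, scal = (*), coact = (\<lambda>a. pure_tensor (*) (hscale H) a 1)\<rparr>"

text \<open>
  T is isomorphic to the quotient M/W: it is the image of M under a comodule map with kernel W.
  A complement of W shows that a quotient of M can always be realised on the type of M.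
\<close>

definition is_quotient ::
  "('k::field, 'h::ring_1) hopf \<Rightarrow> ('k, 'm::ab_group_add, 'h) comod \<Rightarrow> 'm set
    \<Rightarrow> ('k, 'm, 'h) comod \<Rightarrow> bool" where
  "is_quotient H M W T \<longleftrightarrow>
     comodule H T \<and>
     (\<exists>\<pi>. comodule_hom H M T \<pi> \<and> \<pi> ` car M = car T \<and> {m \<in> car M. \<pi> m = 0} = W)"

definition composition_series ::
  "('k::field, 'h::ring_1) hopf \<Rightarrow> ('k, 'm::ab_group_add, 'h) comod \<Rightarrow> nat
    \<Rightarrow> (nat \<Rightarrow> 'm set) \<Rightarrow> bool" where
  "composition_series H M n W \<longleftrightarrow>
     W 0 = {0} \<and> W n = car M \<and>
     (\<forall>i\<le>n. subcomodule H M (W i)) \<and>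
     (\<forall>i<n. W i \<subseteq> W (Suc i) \<and>
        (\<exists>T. simple_comodule H T \<and> is_quotient H (M\<lparr>car := W (Suc i)\<rparr>) (W i) T))"

definition composition_factor ::
  "('k::field, 'h::ring_1) hopf \<Rightarrow> ('k, 'm::ab_group_add, 'h) comod
    \<Rightarrow> ('k, 'm, 'h) comod \<Rightarrow> bool" where
  "composition_factor H M T \<longleftrightarrow>
     (\<exists>n W i. composition_series H M n W \<and> i < n \<and>
        is_quotient H (M\<lparr>car := W (Suc i)\<rparr>) (W i) T)"

text \<open>
  All composition series have the same length, by Jordan-Hoelder; the infimum of the empty set,
  i.e. the length of a comodule without composition series, is \<open>\<infinity>\<close>.
\<close>

definition comp_length ::
  "('k::field, 'h::ring_1) hopf \<Rightarrow> ('k, 'm::ab_group_add, 'h) comod \<Rightarrow> enat" where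
  "comp_length H M = Inf {enat n |n. \<exists>W. composition_series H M n W}"

definition comod_dim :: "('k::field, 'm::ab_group_add, 'h) comod \<Rightarrow> nat" where
  "comod_dim M = vector_space.dim (scal M) (car M)"

text \<open>
  A quantifier inside a definition ranges over one type, so the test comodules for injectivity are
  taken inside the space of all scalar functions on an infinite set that is at least as large as
  the Hopf algebra and the comodule itself. This space contains a copy of every comodule whose
  dimension is at most the cardinality of that set, in particular of every finite dimensional
  comodule and of its subcomodules, and the latter suffice: comodules are locally finite, so
  by Zorn's lemma a map that extends along inclusions of finite dimensional comodules extends
  along all inclusions.
\<close>

definition injective_comodule ::
  "('k::field, 'h::ring_1) hopf \<Rightarrow> ('k, 'm::ab_group_add, 'h) comod \<Rightarrow> bool" where
  "injective_comodule H E \<longleftrightarrow>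
     comodule H E \<and>
     (\<forall>(X :: ('k, 'm \<times> 'h \<times> nat \<Rightarrow> 'k, 'h) comod) (Y :: ('k, 'm \<times> 'h \<times> nat \<Rightarrow> 'k, 'h) comod) j f.
        comodule H X \<and> comodule H Y \<and> comodule_hom H X Y j \<and> inj_on j (car X) \<and>
        comodule_hom H X E f \<longrightarrow>
        (\<exists>g. comodule_hom H Y E g \<and> (\<forall>x\<in>car X. g (j x) = f x)))"

definition injective_hull ::
  "('k::field, 'h::ring_1) hopf \<Rightarrow> ('k, 'm::ab_group_add, 'h) comod
    \<Rightarrow> ('k, 'n::ab_group_add, 'h) comod \<Rightarrow> bool" where
  "injective_hull H M E \<longleftrightarrow>
     injective_comodule H E \<and>
     (\<exists>\<iota>. comodule_hom H M E \<iota> \<and> inj_on \<iota> (car M) \<and>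
        (\<forall>W. subcomodule H E W \<and> W \<inter> \<iota> ` car M = {0} \<longrightarrow> W = {0}))"

end

theory Submission
  imports Defs
begin

text \<open>
  Write \<open>E\<close> for the injective hull of the trivial comodule, \<open>u\<close> for the image of 1 in it, and \<open>E(S)\<close> for
  the injective hull of \<open>S\<close>. The theorem compares dimensions. If every simple subquotient of \<open>E(S)\<close> has dimension
  at least \<open>dim S / d\<close>, then a composition series of length \<open>m\<close> gives \<open>m * dim S \<le> d * dim E(S)\<close>; and if
  \<open>dim E(S) \<le> dim S * dim E\<close>, then \<open>m \<le> d * dim E\<close>. Both estimates come from one construction.
  The dual \<open>X'\<close> of a finite dimensional comodule \<open>X\<close> carries the coaction twisted by the antipode, so
  that evaluation is a comodule map from \<open>X' \<otimes> X\<close> to the trivial comodule and hence to \<open>E\<close>. If \<open>X'\<close> or \<open>X\<close>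
  is enlarged to a comodule \<open>Y'\<close> or \<open>Y\<close>, then injectivity extends this map (\<open>extend_evaluation\<close>).

  For a finite dimensional \<open>V\<close> with \<open>S \<subseteq> V \<subseteq> E(S)\<close>, extend the evaluation of \<open>S\<close> to \<open>S' \<otimes> V\<close>. The vectors of \<open>V\<close>
  that pair to zero with all of \<open>S'\<close> form a subcomodule that meets \<open>S\<close> in 0. It is 0 because \<open>S\<close> is
  essential, so \<open>V\<close> embeds into the linear maps from \<open>S'\<close> to \<open>E\<close>, which is the first estimate
  (\<open>essential_extension_bound\<close>).

  For subcomodules \<open>N \<subset> V\<close> of \<open>E(S)\<close> with quotient \<open>T = V / N\<close>, extend the evaluation of \<open>T\<close> from \<open>T' \<otimes> T\<close> to
  \<open>V' \<otimes> T\<close>. The result is a vector \<open>y\<close> in \<open>V \<otimes> T' \<otimes> E\<close>. For a subcomodule \<open>W\<close> of \<open>E\<close>, contracting \<open>y\<close> with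
  all elements of \<open>T\<close> and all linear forms on \<open>E\<close> that vanish on \<open>W\<close> gives a subspace \<open>Q W\<close> of \<open>V\<close>. It is a
  subcomodule, it is not 0 for \<open>W = 0\<close>, and it is 0 for \<open>W = E\<close>. Along a composition series of \<open>E\<close> there is
  therefore a step from \<open>W\<close> to \<open>W1\<close> at which \<open>Q\<close> becomes 0, and there \<open>Q W\<close> is spanned by at most
  \<open>dim T * dim (W1 / W) \<le> dim T * d\<close> vectors. As \<open>Q W\<close> contains \<open>S\<close>, this is the second estimate
  (\<open>socle_bound\<close>). It is the elementary form of the remark that \<open>T \<otimes> E'\<close> is projective and covers \<open>T\<close>, so
  that \<open>S\<close> is a composition factor of \<open>T \<otimes> E'\<close>.

  The integral \<open>\<psi>\<close> enters twice, each time through the identity \<open>integral_antipode\<close>. It shows that \<open>E\<close> is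
  finite dimensional (\<open>finite_dimensional\<close>), and that the antipode is injective (\<open>antipode_injective\<close>),
  which is what makes \<open>Q W\<close> a subcomodule.

  Finite dimensional comodules are handled through bases: the coefficients of the coaction form a
  comatrix, i.e. a square matrix \<open>a\<close> over \<open>H\<close> with \<open>\<Delta> a_ij = \<Sum>k. a_ik \<otimes> a_kj\<close> and \<open>\<epsilon> a_ij = \<delta>_ij\<close>. Subcomodules
  and quotients correspond to blocks of zeros, the antipode of a comatrix is its inverse, and a test
  comodule for injectivity can be written down from its comatrix.
\<close>

section \<open>Linear algebra\<close>

lemma vector_space_field: "vector_space ((*) :: 'k::field \<Rightarrow> 'k \<Rightarrow> 'k)"
  by unfold_locales (auto simp: algebra_simps)

lemma linear_map_add: "Vector_Spaces.linear s1 s2 f \<Longrightarrow> f (x + y) = f x + f y"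
  and linear_map_scale: "Vector_Spaces.linear s1 s2 f \<Longrightarrow> f (s1 c x) = s2 c (f x)"
  by (auto simp: Vector_Spaces.linear_iff)

lemma linear_map_zero: "Vector_Spaces.linear s1 s2 f \<Longrightarrow> f 0 = 0"
  and linear_map_diff: "Vector_Spaces.linear s1 s2 f \<Longrightarrow> f (x - y) = f x - f y"
  and linear_map_sum: "Vector_Spaces.linear s1 s2 f \<Longrightarrow> f (sum g A) = (\<Sum>a\<in>A. f (g a))"
  by (simp_all add: linear_iff_module_hom module_hom.zero module_hom.diff module_hom.sum)

lemma linear_vector_spaces:
  assumes "Vector_Spaces.linear s1 s2 f"
  shows "vector_space s1" "vector_space s2"
  using assms by (auto simp: Vector_Spaces.linear_iff)

lemma linear_injective_bound:
  assumes f: "Vector_Spaces.linear s1 s2 f"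
    and P: "\<not> module.dependent s1 P" "f ` P \<subseteq> module.span s2 F" "finite F"
    and inj: "\<And>x. x \<in> module.span s1 P \<Longrightarrow> f x = 0 \<Longrightarrow> x = 0"
  shows "finite P \<and> card P \<le> card F"
proof -
  interpret f: Vector_Spaces.linear s1 s2 f by fact
  have inj': "inj_on f (f.vs1.span P)"
    using inj by (subst f.inj_on_iff_eq_0) auto
  then have "inj_on f P"
    by (rule inj_on_subset) (rule f.vs1.span_superset)
  moreover have "f.vs2.independent (f ` P)"
    using P(1) inj' by (rule f.independent_injective_image)
  with f.vs2.independent_span_bound[OF P(3) _ P(2)]
  have "finite (f ` P) \<and> card (f ` P) \<le> card F"
    by simp
  ultimately show ?thesis
    by (metis finite_image_iff card_image)
qed

context vector_space
begin

lemma linear_form_dual: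
  assumes "independent B" "b \<in> B"
  obtains f where "Vector_Spaces.linear scale (*) f" "f b = 1" "\<forall>c\<in>B. c \<noteq> b \<longrightarrow> f c = 0"
proof -
  interpret K: vector_space "(*) :: 'a \<Rightarrow> 'a \<Rightarrow> 'a"
    by (rule vector_space_field)
  interpret P: vector_space_pair scale "(*) :: 'a \<Rightarrow> 'a \<Rightarrow> 'a" ..
  show thesis
    using P.linear_independent_extend[OF assms(1), of "\<lambda>c. if c = b then 1 else 0"] assms(2) that
    by auto
qed

lemma linear_form_eq_0:
  assumes "\<And>\<phi>. Vector_Spaces.linear scale (*) \<phi> \<Longrightarrow> \<phi> x = 0"
  shows "x = 0"
proof (rule linear_form_separates)
  show "vector_space scale" ..
  show "\<phi> x = \<phi> 0" if "Vector_Spaces.linear scale (*) \<phi>" for \<phi>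
    using assms[OF that] linear_map_zero[OF that] by simp
qed

lemma dual_basis:
  assumes "finite B" "independent B"
  obtains \<phi> where "\<forall>b\<in>B. Vector_Spaces.linear scale (*) (\<phi> b)" "\<forall>x\<in>span B. x = (\<Sum>b\<in>B. scale (\<phi> b x) b)"
proof -
  have "\<exists>f. Vector_Spaces.linear scale (*) f \<and> f b = 1 \<and> (\<forall>c\<in>B. c \<noteq> b \<longrightarrow> f c = 0)" if "b \<in> B" for b
    using linear_form_dual[OF assms(2) that] by metis
  then obtain \<phi> where \<phi>: "\<And>b. b \<in> B \<Longrightarrow> Vector_Spaces.linear scale (*) (\<phi> b)" "\<And>b. b \<in> B \<Longrightarrow> \<phi> b b = 1"
    "\<And>b c. b \<in> B \<Longrightarrow> c \<in> B \<Longrightarrow> c \<noteq> b \<Longrightarrow> \<phi> b c = 0"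
    by metis
  have "x = (\<Sum>b\<in>B. scale (\<phi> b x) b)" if x: "x \<in> span B" for x
  proof -
    obtain r where r: "x = (\<Sum>c\<in>B. scale (r c) c)"
      using x assms(1) by (auto simp: span_finite)
    have "\<phi> b x = r b" if b: "b \<in> B" for b
    proof -
      have "\<phi> b x = (\<Sum>c\<in>B. r c * \<phi> b c)"
        by (simp add: r linear_map_sum[OF \<phi>(1)[OF b]] linear_map_scale[OF \<phi>(1)[OF b]])
      also have "\<dots> = (\<Sum>c\<in>B. if c = b then r b else 0)"
        using b \<phi> by (intro sum.cong) auto
      finally show ?thesis
        using b assms(1) by simp
    qed
    then show ?thesis
      using r by simp
  qed
  then show thesis
    using that \<phi>(1) by blast
qed

text \<open>
  Extending a basis of \<open>W\<close> to one of the whole space gives a complement; \<open>\<pi>\<close> is the projection onto it.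
  It realises the quotient by \<open>W\<close> on the type of the space itself, which is how quotient comodules
  are obtained below.
\<close>

lemma projection_along:
  assumes W: "subspace W"
  obtains \<pi> where "Vector_Spaces.linear scale scale \<pi>" "\<And>x. \<pi> x = 0 \<longleftrightarrow> x \<in> W"
    "\<And>x. x - \<pi> x \<in> W"
proof -
  interpret P: vector_space_pair scale scale ..
  obtain B where B: "B \<subseteq> W" "independent B" "W \<subseteq> span B"
    using maximal_independent_subset[of W] by blast
  obtain C where C: "B \<subseteq> C" "independent C" "UNIV \<subseteq> span C"
    by (rule maximal_independent_subset_extend[OF subset_UNIV B(2)])
  obtain \<pi> where \<pi>: "Vector_Spaces.linear scale scale \<pi>" "\<And>x. x \<in> C \<Longrightarrow> \<pi> x = (if x \<in> B then 0 else x)"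
    using P.linear_independent_extend[OF C(2), of "\<lambda>x. if x \<in> B then 0 else x"] by auto
  have sub: "x - \<pi> x \<in> W" for x
  proof -
    have "x \<in> span C"
      using C(3) by blast
    then show ?thesis
    proof (induction rule: span_induct)
      case base
      show ?case
        by (rule subspaceI) (simp_all add: linear_map_zero[OF \<pi>(1)] linear_map_add[OF \<pi>(1)] linear_map_scale[OF \<pi>(1)]
            subspace_0[OF W] scale_right_diff_distrib[symmetric] subspace_scale[OF W] add_diff_add subspace_add[OF W])
    next
      case (step x)
      then show ?case
        using W B(1) by (auto simp: \<pi>(2) subspace_0)
    qed
  qed
  have "\<pi> x = 0" if "x \<in> W" for x
  proof -
    have "x \<in> span B" using that B by blast
    moreover have "\<pi> b = 0" if "b \<in> B" for b
      using \<pi>(2)[of b] C(1) that by auto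
    ultimately show ?thesis
      using P.linear_eq_0_on_span[OF \<pi>(1), of B x] by blast
  qed
  moreover have "x \<in> W" if "\<pi> x = 0" for x
    using sub[of x] that by simp
  ultimately show thesis
    using that[of \<pi>] \<pi>(1) sub by blast
qed

lemma subspace_basis:
  assumes "subspace V" "V \<subseteq> span F" "finite F" "A \<subseteq> V" "independent A"
  obtains B where "A \<subseteq> B" "finite B" "independent B" "span B = V" "card B = dim V"
proof -
  obtain B where B: "A \<subseteq> B" "B \<subseteq> V" "independent B" "V \<subseteq> span B"
    using maximal_independent_subset_extend[OF assms(4,5)] by blast
  have "finite B"
    using independent_span_bound[OF assms(3) B(3)] B(2) assms(2) by auto
  moreover have "span B = V"
    using B assms(1) span_minimal by blast
  moreover have "card B = dim V"
    using B basis_card_eq_dim by blast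
  ultimately show thesis
    using that B by blast
qed

lemma dim_mono_finite:
  assumes "subspace V" "V \<subseteq> W" "W \<subseteq> span F" "finite F"
  shows "dim V \<le> dim W"
proof -
  obtain B where B: "finite B" "independent B" "span B = V" "card B = dim V"
    using subspace_basis[OF assms(1) _ assms(4), of "{}"] assms(2,3) independent_empty by auto
  obtain C where C: "C \<subseteq> W" "independent C" "W \<subseteq> span C" "card C = dim W"
    using basis_exists by blast
  have "finite C"
    using independent_span_bound[OF assms(4) C(2)] C(1) assms(3) by auto
  have "B \<subseteq> span C"
    using B(3) C(3) assms(2) span_superset by blast
  from independent_span_bound[OF \<open>finite C\<close> B(2) this] show ?thesis
    using B C by simp
qed

lemma dim_strict_mono_finite:
  assumes "subspace V" "subspace W" "V \<subset> W" "W \<subseteq> span F" "finite F"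
  shows "dim V < dim W"
proof -
  obtain B where B: "finite B" "independent B" "span B = V" "card B = dim V"
    using subspace_basis[OF assms(1) _ assms(5), of "{}"] assms(3,4) independent_empty by auto
  have "B \<subseteq> W"
    using B(3) assms(3) span_superset by blast
  then obtain C where C: "B \<subseteq> C" "finite C" "independent C" "span C = W" "card C = dim W"
    using subspace_basis[OF assms(2,4,5) _ B(2)] by metis
  have "B \<noteq> C"
    using B C assms(3) by auto
  then show ?thesis
    using B C psubset_card_mono[of C B] by auto
qed

lemma finite_span_Un:
  assumes "V \<subseteq> span F" "finite F" "W \<subseteq> span G" "finite G"
  shows "V \<union> W \<subseteq> span (F \<union> G)"
  using assms span_mono[of F "F \<union> G"] span_mono[of G "F \<union> G"] by blast

end

lemma dim_image_kernel:
  assumes f: "Vector_Spaces.linear s1 s2 f"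
    and V: "module.subspace s1 V" "V \<subseteq> module.span s1 F" "finite F"
  shows "vector_space.dim s2 (f ` V) + vector_space.dim s1 {v \<in> V. f v = 0} = vector_space.dim s1 V"
proof -
  interpret f: Vector_Spaces.linear s1 s2 f by fact
  let ?N = "{v \<in> V. f v = 0}"
  have N: "f.vs1.subspace ?N"
    using f.vs1.subspace_inter[OF V(1) f.subspace_kernel] by (simp add: Int_def)
  have "?N \<subseteq> f.vs1.span F"
    using V(2) by auto
  then obtain A where A: "finite A" "f.vs1.independent A" "f.vs1.span A = ?N" "card A = f.vs1.dim ?N"
    using f.vs1.subspace_basis[OF N _ V(3), of "{}"] f.vs1.independent_empty by auto
  have AN: "A \<subseteq> ?N"
    using A(3) f.vs1.span_superset by blast
  then obtain B where B: "A \<subseteq> B" "finite B" "f.vs1.independent B" "f.vs1.span B = V" "card B = f.vs1.dim V"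
    using f.vs1.subspace_basis[OF V(1,2,3) _ A(2)] by blast
  have inj: "x = 0" if x: "x \<in> f.vs1.span (B - A)" "f x = 0" for x
  proof -
    have "f.vs1.span (B - A) \<subseteq> V"
      using B(4) f.vs1.span_mono[of "B - A" B] by auto
    then have "x \<in> f.vs1.span A"
      using x A(3) by auto
    then have "f.vs1.representation B x = f.vs1.representation A x"
      and "f.vs1.representation B x = f.vs1.representation (B - A) x"
      using f.vs1.representation_extend[OF B(3) \<open>x \<in> f.vs1.span A\<close> B(1)]
        f.vs1.representation_extend[OF B(3) x(1) Diff_subset] by simp_all
    then have "f.vs1.representation B x = (\<lambda>_. 0)"
      using f.vs1.representation_ne_zero by (metis DiffD2)
    then show "x = 0"
      using f.vs1.sum_representation_eq[OF B(3), of x B] B(2) x(1) f.vs1.span_mono[of "B - A" B]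
      by (simp add: subset_iff)
  qed
  have inj': "inj_on f (f.vs1.span (B - A))"
    using inj by (subst f.inj_on_iff_eq_0) auto
  have "f.vs2.independent (f ` (B - A))"
    using f.vs1.independent_mono[OF B(3)] inj' by (intro f.independent_injective_image) auto
  moreover have "f.vs2.span (f ` (B - A)) = f ` V"
  proof -
    have "f ` B \<subseteq> insert 0 (f ` (B - A))"
      using AN by auto
    then have "f.vs2.span (f ` B) \<subseteq> f.vs2.span (f ` (B - A))"
      by (metis f.vs2.span_mono f.vs2.span_insert_0)
    moreover have "f.vs2.span (f ` (B - A)) \<subseteq> f.vs2.span (f ` B)"
      by (intro f.vs2.span_mono) auto
    ultimately show ?thesis
      using B(4) by (simp add: f.span_image)
  qed
  ultimately have "f.vs2.dim (f ` V) = card (f ` (B - A))"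
    using f.vs2.dim_span_eq_card_independent by metis
  also have "\<dots> = card (B - A)"
    using inj' f.vs1.span_superset by (intro card_image) (rule inj_on_subset)
  finally show ?thesis
    using A B card_mono[OF B(2,1)] by (simp add: card_Diff_subset)
qed

text \<open>
  The forms are the coordinates of an injective linear map into a space of dimension at most
  \<open>card I\<close>. Finiteness of \<open>P\<close> is part of the conclusion, so this also proves that spaces are finite
  dimensional.
\<close>

lemma independent_bound_forms:
  fixes L :: "'i \<Rightarrow> 'b::ab_group_add \<Rightarrow> 'k::field"
  assumes L: "\<And>i. i \<in> I \<Longrightarrow> Vector_Spaces.linear s (*) (L i)"
    and s: "vector_space s" and "finite I" "\<not> module.dependent s P"
    and inj: "\<And>x. x \<in> module.span s P \<Longrightarrow> (\<And>i. i \<in> I \<Longrightarrow> L i x = 0) \<Longrightarrow> x = 0"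
  shows "finite P \<and> card P \<le> card I"
proof -
  define T where "T = (\<lambda>x i. if i \<in> I then L i x else 0)"
  define \<delta> :: "'i \<Rightarrow> 'i \<Rightarrow> 'k" where "\<delta> = (\<lambda>i j. if j = i then 1 else 0)"
  interpret F: vector_space "fun_scale :: 'k \<Rightarrow> ('i \<Rightarrow> 'k) \<Rightarrow> _"
    by (rule vector_space_fun_scale)
  have T: "Vector_Spaces.linear s fun_scale T"
    by (subst Vector_Spaces.linear_iff) (simp add: T_def s vector_space_fun_scale fun_scale_def fun_eq_iff
        linear_map_add[OF L] linear_map_scale[OF L])
  have "T x \<in> F.span (\<delta> ` I)" for x
  proof -
    have "T x = (\<Sum>i\<in>I. fun_scale (L i x) (\<delta> i))"
      using \<open>finite I\<close> by (auto simp: T_def \<delta>_def fun_eq_iff sum_fun_apply fun_scale_def if_distrib cong: if_cong)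
    then show ?thesis
      by (simp add: F.span_sum F.span_scale F.span_base)
  qed
  then have "T ` P \<subseteq> F.span (\<delta> ` I)"
    by blast
  then have "finite P \<and> card P \<le> card (\<delta> ` I)"
  proof (rule linear_injective_bound[OF T assms(4)])
    show "finite (\<delta> ` I)"
      using \<open>finite I\<close> by simp
    fix x assume x: "x \<in> module.span s P" "T x = 0"
    have "L i x = 0" if "i \<in> I" for i
      using fun_cong[OF x(2), of i] that by (simp add: T_def)
    then show "x = 0"
      using x(1) inj by blast
  qed
  then show ?thesis
    using card_image_le[OF \<open>finite I\<close>, of \<delta>] by linarith
qed

section \<open>Tensors\<close>

lemma bilinear_map_iff:
  "bilinear_map sM sN sP B \<longleftrightarrow> vector_space sM \<and> vector_space sN \<and> vector_space sP \<and>
     (\<forall>m m' n. B (m + m') n = B m n + B m' n) \<and> (\<forall>c m n. B (sM c m) n = sP c (B m n)) \<and>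
     (\<forall>m n n'. B m (n + n') = B m n + B m n') \<and> (\<forall>c m n. B m (sN c n) = sP c (B m n))"
  by (auto simp: bilinear_map_def Vector_Spaces.linear_iff)

lemma bilinear_mapD:
  assumes "bilinear_map sM sN sP B"
  shows "B (m + m') n = B m n + B m' n" "B (sM c m) n = sP c (B m n)"
    "B m (n + n') = B m n + B m n'" "B m (sN c n) = sP c (B m n)"
    "Vector_Spaces.linear sM sP (\<lambda>m. B m n)" "Vector_Spaces.linear sN sP (B m)"
  using assms by (auto simp: bilinear_map_iff Vector_Spaces.linear_iff)

lemma bilinear_map_sum_left: "bilinear_map sM sN sP B \<Longrightarrow> B (\<Sum>i\<in>A. f i) n = (\<Sum>i\<in>A. B (f i) n)"
  and bilinear_map_sum_right: "bilinear_map sM sN sP B \<Longrightarrow> B m (\<Sum>i\<in>A. g i) = (\<Sum>i\<in>A. B m (g i))"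
  and bilinear_map_zero_left: "bilinear_map sM sN sP B \<Longrightarrow> B 0 n = 0"
  and bilinear_map_zero_right: "bilinear_map sM sN sP B \<Longrightarrow> B m 0 = 0"
  using linear_map_sum[OF bilinear_mapD(5)[of sM sN sP B n], of f A] linear_map_sum[OF bilinear_mapD(6)[of sM sN sP B m], of g A]
    linear_map_zero[OF bilinear_mapD(5)[of sM sN sP B n]] linear_map_zero[OF bilinear_mapD(6)[of sM sN sP B m]]
  by simp_all

lemma bilinear_map_comp:
  assumes "bilinear_map sM sN sP B" "Vector_Spaces.linear sM' sM f" "Vector_Spaces.linear sN' sN g"
  shows "bilinear_map sM' sN' sP (\<lambda>m n. B (f m) (g n))"
  using assms by (auto simp: bilinear_map_iff Vector_Spaces.linear_iff)

lemma bilinear_form_prod: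
  assumes "Vector_Spaces.linear sM (*) f" "Vector_Spaces.linear sN (*) g"
  shows "bilinear_map sM sN (*) (\<lambda>m n. g n * f m)"
  using assms by (auto simp: bilinear_map_iff Vector_Spaces.linear_iff algebra_simps)

lemma linear_ident: "vector_space s \<Longrightarrow> Vector_Spaces.linear s s (\<lambda>x. x)"
  by (auto simp: Vector_Spaces.linear_iff)

lemma bilinear_scale_left:
  assumes "vector_space sM" "Vector_Spaces.linear sN (*) f"
  shows "bilinear_map sM sN sM (\<lambda>m n. sM (f n) m)"
proof -
  interpret vector_space sM by fact
  show ?thesis
    using assms by (auto simp: bilinear_map_iff Vector_Spaces.linear_iff algebra_simps)
qed

lemma bilinear_scale_right:
  assumes "vector_space sN" "Vector_Spaces.linear sM (*) f"
  shows "bilinear_map sM sN sN (\<lambda>m n. sN (f m) n)"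
proof -
  interpret vector_space sN by fact
  show ?thesis
    using assms by (auto simp: bilinear_map_iff Vector_Spaces.linear_iff algebra_simps)
qed

lemma sum_pure_tensor_apply:
  "bilinear_map sM sN (*) B \<Longrightarrow> (\<Sum>i\<in>I. pure_tensor sM sN (x i) (y i)) B = (\<Sum>i\<in>I. B (x i) (y i))"
  by (simp add: sum_fun_apply pure_tensor_def)

lemma bij_initial_segment:
  assumes "finite I"
  obtains \<sigma> where "bij_betw \<sigma> {..<card I} I"
  using ex_bij_betw_nat_finite[OF assms] by (auto simp: atLeast0LessThan)

text \<open>
  Tensors are defined by sums over initial segments of the natural numbers. Sums over arbitrary
  finite index sets, such as bases, are reduced to these.
\<close>

lemma sum_pure_tensor_in_tensors:
  assumes "finite I" "\<And>i. i \<in> I \<Longrightarrow> x i \<in> V"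
  shows "(\<Sum>i\<in>I. pure_tensor sM sN (x i) (y i)) \<in> tensors sM sN V"
proof -
  obtain \<sigma> where \<sigma>: "bij_betw \<sigma> {..<card I} I"
    using bij_initial_segment[OF assms(1)] .
  have "(\<Sum>i\<in>I. pure_tensor sM sN (x i) (y i)) = (\<Sum>i<card I. pure_tensor sM sN (x (\<sigma> i)) (y (\<sigma> i)))"
    by (rule sum.reindex_bij_betw[OF \<sigma>, symmetric])
  moreover have "\<forall>i<card I. x (\<sigma> i) \<in> V"
    using assms(2) bij_betwE[OF \<sigma>] by auto
  ultimately show ?thesis
    unfolding tensors_def mem_Collect_eq
    by (intro exI[of _ "card I"] exI[of _ "\<lambda>i. x (\<sigma> i)"] exI[of _ "\<lambda>i. y (\<sigma> i)"]) simp
qed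

lemma tensor_lift_sum_finite:
  assumes "bilinear_map sM sN sP \<beta>" "finite I"
  shows "tensor_lift sM sN \<beta> (\<Sum>i\<in>I. pure_tensor sM sN (x i) (y i)) = (\<Sum>i\<in>I. \<beta> (x i) (y i))"
proof -
  obtain \<sigma> where \<sigma>: "bij_betw \<sigma> {..<card I} I"
    using bij_initial_segment[OF assms(2)] .
  show ?thesis
    unfolding sum.reindex_bij_betw[OF \<sigma>, symmetric] by (rule tensor_lift_sum[OF assms(1)])
qed

lemma tensorsE:
  assumes "t \<in> tensors sM sN V"
  obtains I :: "nat set" and x y where "finite I" "\<forall>i\<in>I. x i \<in> V"
    "t = (\<Sum>i\<in>I. pure_tensor sM sN (x i) (y i))"
proof -
  obtain l :: nat and x y where "\<forall>i<l. x i \<in> V" "t = (\<Sum>i<l. pure_tensor sM sN (x i) (y i))"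
    using assms unfolding tensors_def by blast
  then show thesis
    using that[of "{..<l}" x y] by simp
qed

lemma tensors_eqI:
  assumes "t \<in> tensors sM sN V" "t' \<in> tensors sM sN V'"
    and "\<And>B. bilinear_map sM sN (*) B \<Longrightarrow> t B = t' B"
  shows "t = t'"
proof
  fix B
  obtain I :: "nat set" and x y where t: "t = (\<Sum>i\<in>I. pure_tensor sM sN (x i) (y i))"
    using tensorsE[OF assms(1)] by metis
  obtain I' :: "nat set" and x' y' where t': "t' = (\<Sum>i\<in>I'. pure_tensor sM sN (x' i) (y' i))"
    using tensorsE[OF assms(2)] by metis
  show "t B = t' B"
  proof (cases "bilinear_map sM sN (*) B")
    case False
    then show ?thesis
      by (simp add: t t' sum_fun_apply pure_tensor_def)
  qed (rule assms(3))
qed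

lemma tensor_apply_bilinear:
  assumes t: "t \<in> tensors sM sN V"
  shows "\<lbrakk>bilinear_map sM sN (*) B; bilinear_map sM sN (*) C\<rbrakk> \<Longrightarrow> t (\<lambda>m n. B m n + C m n) = t B + t C"
    and "bilinear_map sM sN (*) B \<Longrightarrow> t (\<lambda>m n. c * B m n) = c * t B"
proof -
  obtain I :: "nat set" and x y where t: "t = (\<Sum>i\<in>I. pure_tensor sM sN (x i) (y i))"
    using tensorsE[OF t] by metis
  show "t (\<lambda>m n. B m n + C m n) = t B + t C"
    if B: "bilinear_map sM sN (*) B" and C: "bilinear_map sM sN (*) C"
  proof -
    have "bilinear_map sM sN (*) (\<lambda>m n. B m n + C m n)"
      using B C by (auto simp: bilinear_map_iff algebra_simps)
    then show ?thesis
      using B C by (simp add: t sum_pure_tensor_apply sum.distrib)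
  qed
  show "t (\<lambda>m n. c * B m n) = c * t B" if B: "bilinear_map sM sN (*) B"
  proof -
    have "bilinear_map sM sN (*) (\<lambda>m n. c * B m n)"
      using B by (auto simp: bilinear_map_iff algebra_simps)
    then show ?thesis
      using B by (simp add: t sum_pure_tensor_apply sum_distrib_left)
  qed
qed

lemma tensor_lift_apply_form:
  assumes "t \<in> tensors sM sN V" "bilinear_map sM sN sP \<beta>" "Vector_Spaces.linear sP (*) \<phi>"
  shows "\<phi> (tensor_lift sM sN \<beta> t) = t (\<lambda>m n. \<phi> (\<beta> m n))"
proof -
  obtain I :: "nat set" and x y where t: "finite I" "t = (\<Sum>i\<in>I. pure_tensor sM sN (x i) (y i))"
    using tensorsE[OF assms(1)] by metis
  show ?thesis
    using bilinear_map_compose[OF assms(2,3)] t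
    by (simp add: tensor_lift_sum_finite[OF assms(2)] sum_pure_tensor_apply linear_map_sum[OF assms(3)])
qed

text \<open>
  Expanding the right legs in a basis of their span makes them independent. A linear form dual to
  that basis can then single out each left leg.
\<close>

lemma tensors_independent_right:
  assumes t: "t \<in> tensors sM sN V" and V: "module.subspace sM V"
    and vs: "vector_space sM" "vector_space sN"
  obtains I u where "finite I" "\<not> module.dependent sN I" "\<forall>n\<in>I. u n \<in> V"
    "t = (\<Sum>n\<in>I. pure_tensor sM sN (u n) n)"
proof -
  interpret M: vector_space sM by fact
  interpret N: vector_space sN by fact
  obtain I0 :: "nat set" and x y where I0: "finite I0" "\<forall>i\<in>I0. x i \<in> V"
    "t = (\<Sum>i\<in>I0. pure_tensor sM sN (x i) (y i))"
    by (rule tensorsE[OF t])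
  obtain I where I: "finite I" "N.independent I" "N.span I = N.span (y ` I0)"
    using N.subspace_basis[OF N.subspace_span order_refl, of "y ` I0" "{}"] I0(1) N.independent_empty
    by auto
  define r where "r = (\<lambda>i. N.representation I (y i))"
  have y: "y i = (\<Sum>n\<in>I. sN (r i n) n)" if "i \<in> I0" for i
    unfolding r_def using I that N.span_superset[of "y ` I0"]
    by (intro N.sum_representation_eq[symmetric]) auto
  define u where "u = (\<lambda>n. \<Sum>i\<in>I0. sM (r i n) (x i))"
  have u: "u n \<in> V" for n
    unfolding u_def using I0(2) V by (intro M.subspace_sum M.subspace_scale) auto
  have "t = (\<Sum>n\<in>I. pure_tensor sM sN (u n) n)"
  proof (rule tensors_eqI[OF t])
    show "(\<Sum>n\<in>I. pure_tensor sM sN (u n) n) \<in> tensors sM sN V"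
      using I(1) u by (rule sum_pure_tensor_in_tensors)
    fix B assume B: "bilinear_map sM sN (*) B"
    have "t B = (\<Sum>i\<in>I0. B (x i) (\<Sum>n\<in>I. sN (r i n) n))"
      by (simp add: I0(3) sum_pure_tensor_apply[OF B] y)
    also have "\<dots> = (\<Sum>i\<in>I0. \<Sum>n\<in>I. r i n * B (x i) n)"
      by (simp add: bilinear_map_sum_right[OF B] bilinear_mapD(4)[OF B])
    also have "\<dots> = (\<Sum>n\<in>I. \<Sum>i\<in>I0. r i n * B (x i) n)"
      by (rule sum.swap)
    also have "\<dots> = (\<Sum>n\<in>I. pure_tensor sM sN (u n) n) B"
      by (simp add: sum_pure_tensor_apply[OF B] u_def bilinear_map_sum_left[OF B] bilinear_mapD(2)[OF B])
    finally show "t B = (\<Sum>n\<in>I. pure_tensor sM sN (u n) n) B" .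
  qed
  then show thesis
    using that[of I u] I(1,2) u by blast
qed

section \<open>Comodules\<close>

text \<open>
  Both sides of the coassociativity axiom apply a coaction inside of another one. The inner expression
  must be bilinear before the outer tensor can be expanded.
\<close>

lemma bilinear_nested_left:
  assumes \<rho>: "Vector_Spaces.linear sM fun_scale \<rho>" "\<And>m. \<rho> m \<in> tensors s1 s2 UNIV"
    and T: "trilinear_form s1 s2 sP T" and vs: "vector_space s1" "vector_space s2" "vector_space sP"
  shows "bilinear_map sM sP (*) (\<lambda>m p. \<rho> m (\<lambda>a b. T a b p))"
proof -
  have B: "bilinear_map s1 s2 (*) (\<lambda>a b. T a b p)" for p
    using T by (auto simp: trilinear_form_def bilinear_map_def)
  have p: "Vector_Spaces.linear sP (*) (T a b)" for a b
    using T by (auto simp: trilinear_form_def)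
  show ?thesis
    unfolding bilinear_map_iff
    using linear_vector_spaces(1)[OF \<rho>(1)] vs(3)
    by (auto simp: linear_map_add[OF \<rho>(1)] linear_map_scale[OF \<rho>(1)] fun_scale_def vector_space_field
        linear_map_add[OF p] linear_map_scale[OF p] tensor_apply_bilinear[OF \<rho>(2)] B)
qed

lemma bilinear_nested_right:
  assumes \<rho>: "Vector_Spaces.linear sM fun_scale \<rho>" "\<And>m. \<rho> m \<in> tensors s1 s2 UNIV"
    and T: "trilinear_form sP s1 s2 T" and vs: "vector_space s1" "vector_space s2" "vector_space sP"
  shows "bilinear_map sP sM (*) (\<lambda>p m. \<rho> m (T p))"
proof -
  have B: "bilinear_map s1 s2 (*) (T p)" for p
    using T by (auto simp: trilinear_form_def bilinear_map_def)
  have B': "bilinear_map s1 s2 (*) (\<lambda>a b. T p a b)" for p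
    using B by simp
  have p: "Vector_Spaces.linear sP (*) (\<lambda>p. T p a b)" for a b
    using T by (auto simp: trilinear_form_def)
  have "T (p + p') = (\<lambda>a b. T p a b + T p' a b)" "T (sP c p) = (\<lambda>a b. c * T p a b)" for p p' c
    using linear_map_add[OF p] linear_map_scale[OF p] by (simp_all add: fun_eq_iff)
  then show ?thesis
    unfolding bilinear_map_iff
    using linear_vector_spaces(1)[OF \<rho>(1)] vs(3)
    by (auto simp: linear_map_add[OF \<rho>(1)] linear_map_scale[OF \<rho>(1)] fun_scale_def vector_space_field
         tensor_apply_bilinear[OF \<rho>(2)] B B')
qed

text \<open>
  A comodule over \<open>H\<close> is a module over the algebra dual to the coalgebra \<open>H\<close>: a linear form \<open>f\<close> acts by
  \<open>m \<mapsto> f(m_1) m_0\<close>. Subcomodules are then simply the stable subspaces of the carrier.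
\<close>

definition act ::
  "('k::field, 'h::ring_1) hopf \<Rightarrow> ('k, 'm::ab_group_add, 'h) comod \<Rightarrow> ('h \<Rightarrow> 'k) \<Rightarrow> 'm \<Rightarrow> 'm" where
  "act H M f x = tensor_lift (scal M) (hscale H) (\<lambda>m h. scal M (f h) m) (coact M x)"

text \<open>
  These are the matrices of coefficients of the finite dimensional comodules.
\<close>

definition comatrix :: "('k::field, 'h::ring_1) hopf \<Rightarrow> 'i set \<Rightarrow> ('i \<Rightarrow> 'i \<Rightarrow> 'h) \<Rightarrow> bool" where
  "comatrix H I a \<longleftrightarrow> (\<forall>i\<in>I. \<forall>j\<in>I.
     comult H (a i j) = (\<Sum>k\<in>I. pure_tensor (hscale H) (hscale H) (a i k) (a k j)) \<and>
     counit H (a i j) = (if i = j then 1 else 0))"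

definition coacts_by ::
  "('k::field, 'h::ring_1) hopf \<Rightarrow> ('k, 'm::ab_group_add, 'h) comod \<Rightarrow> 'i set
    \<Rightarrow> ('i \<Rightarrow> 'm) \<Rightarrow> ('i \<Rightarrow> 'i \<Rightarrow> 'h) \<Rightarrow> bool" where
  "coacts_by H M I e a \<longleftrightarrow> (\<forall>j\<in>I. e j \<in> car M \<and>
     coact M (e j) = (\<Sum>i\<in>I. pure_tensor (scal M) (hscale H) (e i) (a i j)))"

locale hopf_alg =
  fixes H :: "('k::field, 'h::ring_1) hopf"
  assumes hopf: "hopf_algebra H"
begin

abbreviation lform :: "('k \<Rightarrow> 'v::ab_group_add \<Rightarrow> 'v) \<Rightarrow> ('v \<Rightarrow> 'k) \<Rightarrow> bool" where
  "lform s f \<equiv> Vector_Spaces.linear s (*) f"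

lemma coalg: "coalgebra H" and bialg: "bialgebra H"
  using hopf by (auto simp: hopf_algebra_def bialgebra_def)

lemma comult_linear: "Vector_Spaces.linear (hscale H) fun_scale (comult H)"
  and counit_linear: "lform (hscale H) (counit H)"
  and comult_tensor: "comult H h \<in> tensors (hscale H) (hscale H) UNIV"
  using coalg by (auto simp: coalgebra_def)

sublocale Hv: vector_space "hscale H"
  using comult_linear by (rule linear_vector_spaces)

lemma mult_linear: "Vector_Spaces.linear (hscale H) (hscale H) (\<lambda>x. x * y)"
  "Vector_Spaces.linear (hscale H) (hscale H) ((*) y)"
  using bialg by (auto simp: bialgebra_def bilinear_map_def)

lemma antipode_linear: "Vector_Spaces.linear (hscale H) (hscale H) (antipode H)"
  using hopf by (auto simp: hopf_algebra_def)

lemma lform_comp: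
  assumes "Vector_Spaces.linear s s' f" "lform s' g"
  shows "lform s (\<lambda>x. g (f x))"
  using Vector_Spaces.linear_compose[OF assms] by (simp add: o_def)

definition regular :: "('k, 'h, 'h) comod" where
  "regular = \<lparr>car = UNIV, scal = hscale H, coact = comult H\<rparr>"

lemma comodule_regular: "comodule H regular"
  using coalg Hv.subspace_UNIV unfolding comodule_def regular_def coalgebra_def by simp

end

locale right_comodule = hopf_alg H
  for H :: "('k::field, 'h::ring_1) hopf" +
  fixes M :: "('k, 'm::ab_group_add, 'h) comod"
  assumes M: "comodule H M"
begin

lemma coact_linear: "Vector_Spaces.linear (scal M) fun_scale (coact M)"
  and coact_tensor: "coact M m \<in> tensors (scal M) (hscale H) UNIV"
  and car_subspace: "module.subspace (scal M) (car M)"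
  and coact_car: "m \<in> car M \<Longrightarrow> coact M m \<in> tensors (scal M) (hscale H) (car M)"
  using M by (auto simp: comodule_def)

sublocale V: vector_space "scal M"
  using coact_linear by (rule linear_vector_spaces)

lemma act_bilinear: "lform (hscale H) f \<Longrightarrow> bilinear_map (scal M) (hscale H) (scal M) (\<lambda>m h. scal M (f h) m)"
  by (rule bilinear_scale_left[OF V.vector_space_axioms])

lemma act_sum:
  assumes "lform (hscale H) f" "finite I" "coact M x = (\<Sum>i\<in>I. pure_tensor (scal M) (hscale H) (u i) (h i))"
  shows "act H M f x = (\<Sum>i\<in>I. scal M (f (h i)) (u i))"
  unfolding act_def assms(3) using act_bilinear[OF assms(1)] assms(2) by (rule tensor_lift_sum_finite)

lemma form_act:
  assumes "lform (hscale H) f" "lform (scal M) \<phi>"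
  shows "\<phi> (act H M f x) = coact M x (\<lambda>m h. f h * \<phi> m)"
  unfolding act_def tensor_lift_apply_form[OF coact_tensor act_bilinear[OF assms(1)] assms(2)]
  by (simp add: linear_map_scale[OF assms(2)])

lemma act_linear:
  assumes f: "lform (hscale H) f"
  shows "Vector_Spaces.linear (scal M) (scal M) (act H M f)"
  unfolding Vector_Spaces.linear_iff
proof (intro conjI allI V.vector_space_axioms; rule linear_form_separates[OF V.vector_space_axioms])
  fix \<phi> x y assume \<phi>: "lform (scal M) \<phi>"
  show "\<phi> (act H M f (x + y)) = \<phi> (act H M f x + act H M f y)"
    by (simp add: linear_map_add[OF \<phi>] form_act[OF f \<phi>] linear_map_add[OF coact_linear])
next
  fix \<phi> x c assume \<phi>: "lform (scal M) \<phi>"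
  show "\<phi> (act H M f (scal M c x)) = \<phi> (scal M c (act H M f x))"
    by (simp add: linear_map_scale[OF \<phi>] form_act[OF f \<phi>] linear_map_scale[OF coact_linear] fun_scale_def)
qed

lemma act_counit: "x \<in> car M \<Longrightarrow> act H M (counit H) x = x"
  using M by (auto simp: comodule_def act_def)

lemma act_in:
  assumes f: "lform (hscale H) f" and W: "module.subspace (scal M) W"
    and x: "coact M x \<in> tensors (scal M) (hscale H) W"
  shows "act H M f x \<in> W"
proof -
  obtain I :: "nat set" and u h where I: "finite I" "\<forall>i\<in>I. u i \<in> W"
    "coact M x = (\<Sum>i\<in>I. pure_tensor (scal M) (hscale H) (u i) (h i))"
    by (rule tensorsE[OF x])
  show ?thesis
    unfolding act_sum[OF f I(1,3)] using I(2) by (intro V.subspace_sum[OF W] V.subspace_scale[OF W]) blast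
qed

text \<open>
  Write the coaction of \<open>x\<close> with independent right legs. Linear forms dual to them act on \<open>x\<close> with the
  left legs as results, so the latter lie in \<open>W\<close>.
\<close>

lemma coact_in_tensorsI:
  assumes x: "x \<in> car M" and W: "\<And>f. lform (hscale H) f \<Longrightarrow> act H M f x \<in> W"
  shows "coact M x \<in> tensors (scal M) (hscale H) W"
proof -
  obtain I u where I: "finite I" "Hv.independent I" "\<forall>n\<in>I. u n \<in> car M"
    "coact M x = (\<Sum>n\<in>I. pure_tensor (scal M) (hscale H) (u n) n)"
    by (rule tensors_independent_right[OF coact_car[OF x] car_subspace V.vector_space_axioms Hv.vector_space_axioms])
  have "u n \<in> W" if n: "n \<in> I" for n
  proof -
    obtain f where f: "lform (hscale H) f" "f n = 1" "\<forall>c\<in>I. c \<noteq> n \<longrightarrow> f c = 0"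
      by (rule Hv.linear_form_dual[OF I(2) n])
    have "act H M f x = (\<Sum>m\<in>I. scal M (f m) (u m))"
      by (rule act_sum[OF f(1) I(1,4)])
    also have "\<dots> = (\<Sum>m\<in>I. if m = n then u n else 0)"
      using f by (intro sum.cong) auto
    also have "\<dots> = u n"
      using I(1) n by simp
    finally show ?thesis
      using W[OF f(1)] by simp
  qed
  then show ?thesis
    unfolding I(4) using I(1) by (intro sum_pure_tensor_in_tensors)
qed

lemma subcomodule_iff:
  "subcomodule H M W \<longleftrightarrow> W \<subseteq> car M \<and> V.subspace W \<and>
     (\<forall>x\<in>W. coact M x \<in> tensors (scal M) (hscale H) W)"
  using M by (auto simp: subcomodule_def comodule_def)

lemma subcomodule_iff_act:
  "subcomodule H M W \<longleftrightarrow> W \<subseteq> car M \<and> V.subspace W \<and>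
     (\<forall>f. lform (hscale H) f \<longrightarrow> (\<forall>x\<in>W. act H M f x \<in> W))"
  using act_in coact_in_tensorsI unfolding subcomodule_iff by blast

lemma subcomoduleD:
  assumes "subcomodule H M W"
  shows "W \<subseteq> car M" "V.subspace W" "\<And>f x. lform (hscale H) f \<Longrightarrow> x \<in> W \<Longrightarrow> act H M f x \<in> W"
    "comodule H (M\<lparr>car := W\<rparr>)"
  using assms unfolding subcomodule_iff_act by (auto simp: subcomodule_def assms[unfolded subcomodule_def])

lemma subcomodule_car: "subcomodule H M (car M)"
  using car_subspace coact_car by (auto simp: subcomodule_iff)

lemma subcomodule_0: "subcomodule H M {0}"
  unfolding subcomodule_iff_act using V.subspace_0[OF car_subspace] linear_map_zero[OF act_linear] by auto

lemma subcomodule_span_Un: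
  assumes "subcomodule H M W" "subcomodule H M W'"
  shows "subcomodule H M (V.span (W \<union> W'))"
  unfolding subcomodule_iff_act
proof (intro conjI allI impI ballI)
  show "V.span (W \<union> W') \<subseteq> car M"
    using subcomoduleD(1)[OF assms(1)] subcomoduleD(1)[OF assms(2)]
    by (intro V.span_minimal car_subspace) auto
next
  fix f x assume f: "lform (hscale H) f" and x: "x \<in> V.span (W \<union> W')"
  interpret A: Vector_Spaces.linear "scal M" "scal M" "act H M f"
    by (rule act_linear[OF f])
  have "act H M f ` (W \<union> W') \<subseteq> W \<union> W'"
    using subcomoduleD(3)[OF assms(1) f] subcomoduleD(3)[OF assms(2) f] by auto
  then have "act H M f ` V.span (W \<union> W') \<subseteq> V.span (W \<union> W')"
    by (metis A.span_image V.span_mono)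
  then show "act H M f x \<in> V.span (W \<union> W')"
    using x by blast
qed simp

lemma coassoc_sum:
  assumes x: "x \<in> car M" and I: "finite I" "coact M x = (\<Sum>i\<in>I. pure_tensor (scal M) (hscale H) (u i) (h i))"
    and T: "trilinear_form (scal M) (hscale H) (hscale H) T"
  shows "(\<Sum>i\<in>I. coact M (u i) (\<lambda>n h'. T n h' (h i))) = (\<Sum>i\<in>I. comult H (h i) (T (u i)))"
proof -
  have "coact M x (\<lambda>n h. coact M n (\<lambda>n' h'. T n' h' h)) = coact M x (\<lambda>n h. comult H h (\<lambda>h1 h2. T n h1 h2))"
    using M x T by (auto simp: comodule_def)
  moreover have "bilinear_map (scal M) (hscale H) (*) (\<lambda>n h. coact M n (\<lambda>n' h'. T n' h' h))"
    by (rule bilinear_nested_left[OF coact_linear coact_tensor T V.vector_space_axioms Hv.vector_space_axioms Hv.vector_space_axioms])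
  moreover have "bilinear_map (scal M) (hscale H) (*) (\<lambda>n h. comult H h (T n))"
    by (rule bilinear_nested_right[OF comult_linear comult_tensor T Hv.vector_space_axioms Hv.vector_space_axioms V.vector_space_axioms])
  ultimately show ?thesis
    by (simp add: I(2) sum_pure_tensor_apply)
qed

text \<open>
  Write the coaction of \<open>x\<close> with independent right legs \<open>n\<close> and left legs \<open>u n\<close>. By coassociativity the
  coaction of each \<open>u n\<close> only involves the vectors \<open>u i\<close> again, so their span is a subcomodule, and it
  contains \<open>x\<close> by the counit axiom.
\<close>

lemma locally_finite:
  assumes x: "x \<in> car M"
  obtains W F where "subcomodule H M W" "x \<in> W" "finite F" "W = V.span F"
proof -
  obtain I u where I: "finite I" "Hv.independent I" "\<forall>n\<in>I. u n \<in> car M"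
    "coact M x = (\<Sum>n\<in>I. pure_tensor (scal M) (hscale H) (u n) n)"
    by (rule tensors_independent_right[OF coact_car[OF x] car_subspace V.vector_space_axioms Hv.vector_space_axioms])
  have coact_u: "coact M (u j) \<in> tensors (scal M) (hscale H) (V.span (u ` I))" if j: "j \<in> I" for j
  proof (rule coact_in_tensorsI[OF bspec[OF I(3) j]])
    fix f assume f: "lform (hscale H) f"
    \<comment> \<open>The form \<open>g\<close> extracts from coassociativity the part whose last leg is \<open>j\<close>, i.e. the coaction of \<open>u j\<close>.\<close>
    obtain g where g: "lform (hscale H) g" "g j = 1" "\<forall>c\<in>I. c \<noteq> j \<longrightarrow> g c = 0"
      by (rule Hv.linear_form_dual[OF I(2) j])
    have "act H M f (u j) = (\<Sum>i\<in>I. scal M (comult H i (\<lambda>h1 h2. f h1 * g h2)) (u i))"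
    proof (rule linear_form_separates[OF V.vector_space_axioms])
      fix \<phi> assume \<phi>: "lform (scal M) \<phi>"
      have T: "trilinear_form (scal M) (hscale H) (hscale H) (\<lambda>n h1 h2. f h1 * \<phi> n * g h2)"
        using f g(1) \<phi> by (auto simp: trilinear_form_def Vector_Spaces.linear_iff algebra_simps)
      have fg: "bilinear_map (hscale H) (hscale H) (*) (\<lambda>h1 h2. f h1 * g h2)"
        using f g(1) by (auto simp: bilinear_map_iff Vector_Spaces.linear_iff algebra_simps)
      have B: "bilinear_map (scal M) (hscale H) (*) (\<lambda>n h'. f h' * \<phi> n)"
        by (rule bilinear_form_prod[OF \<phi> f])
      have "\<phi> (act H M f (u j)) = coact M (u j) (\<lambda>n h. f h * \<phi> n)"
        by (rule form_act[OF f \<phi>])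
      also have "\<dots> = (\<Sum>i\<in>I. if i = j then coact M (u j) (\<lambda>n h'. f h' * \<phi> n) else 0)"
        using j I(1) by simp
      also have "\<dots> = (\<Sum>i\<in>I. g i * coact M (u i) (\<lambda>n h'. f h' * \<phi> n))"
        using g by (intro sum.cong) auto
      also have "\<dots> = (\<Sum>i\<in>I. coact M (u i) (\<lambda>n h'. f h' * \<phi> n * g i))"
      proof (rule sum.cong[OF refl])
        fix i
        show "g i * coact M (u i) (\<lambda>n h'. f h' * \<phi> n) = coact M (u i) (\<lambda>n h'. f h' * \<phi> n * g i)"
          using tensor_apply_bilinear(2)[OF coact_tensor[of "u i"] B, of "g i"]
          by (simp only: mult.commute[of "g i"])
      qed
      also have "\<dots> = (\<Sum>i\<in>I. comult H i (\<lambda>h1 h2. f h1 * \<phi> (u i) * g h2))"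
        by (rule coassoc_sum[OF x I(1,4) T])
      also have "\<dots> = (\<Sum>i\<in>I. comult H i (\<lambda>h1 h2. \<phi> (u i) * (f h1 * g h2)))"
        by (simp add: algebra_simps)
      also have "\<dots> = \<phi> (\<Sum>i\<in>I. scal M (comult H i (\<lambda>h1 h2. f h1 * g h2)) (u i))"
        by (simp add: tensor_apply_bilinear(2)[OF comult_tensor fg] linear_map_sum[OF \<phi>] linear_map_scale[OF \<phi>] mult.commute)
      finally show "\<phi> (act H M f (u j)) = \<phi> (\<Sum>i\<in>I. scal M (comult H i (\<lambda>h1 h2. f h1 * g h2)) (u i))" .
    qed
    also have "\<dots> \<in> V.span (u ` I)"
      by (intro V.span_sum V.span_scale V.span_base) auto
    finally show "act H M f (u j) \<in> V.span (u ` I)" .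
  qed
  have "subcomodule H M (V.span (u ` I))"
    unfolding subcomodule_iff_act
  proof (intro conjI allI impI ballI)
    show "V.span (u ` I) \<subseteq> car M"
      using I(3) by (intro V.span_minimal car_subspace) auto
    fix f y assume f: "lform (hscale H) f" and y: "y \<in> V.span (u ` I)"
    interpret A: Vector_Spaces.linear "scal M" "scal M" "act H M f"
      by (rule act_linear[OF f])
    have "act H M f ` u ` I \<subseteq> V.span (u ` I)"
      using act_in[OF f V.subspace_span coact_u] by auto
    then have "act H M f ` V.span (u ` I) \<subseteq> V.span (u ` I)"
      by (metis A.span_image V.span_minimal V.subspace_span)
    then show "act H M f y \<in> V.span (u ` I)"
      using y by blast
  qed simp
  moreover have "x \<in> V.span (u ` I)"
  proof -
    have "x = (\<Sum>i\<in>I. scal M (counit H i) (u i))"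
      using act_sum[OF counit_linear I(1,4)] act_counit[OF x] by simp
    also have "\<dots> \<in> V.span (u ` I)"
      by (intro V.span_sum V.span_scale V.span_base) auto
    finally show ?thesis .
  qed
  ultimately show thesis
    using that I(1) by blast
qed

text \<open>
  The basis elements themselves serve as indices of the matrix of coefficients. Comparing the
  coefficients of one basis element on both sides of the comodule axioms shows that this matrix is a
  comatrix; a subset of the basis that spans a subcomodule produces a block of zeros.
\<close>

lemma comatrix_of_basis:
  assumes J: "finite J" "V.independent J" and W: "subcomodule H M (V.span J)"
  obtains a where "comatrix H J a" "coacts_by H M J (\<lambda>j. j) a"
    "\<forall>A. subcomodule H M (V.span A) \<longrightarrow> A \<subseteq> J \<longrightarrow> (\<forall>j\<in>A. \<forall>i\<in>J - A. a i j = 0)"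
proof -
  have J_car: "j \<in> car M" "j \<in> V.span J" if "j \<in> J" for j
    using subcomoduleD(1)[OF W] V.span_base[OF that] by auto
  have "\<exists>c. coact M j = (\<Sum>i\<in>J. pure_tensor (scal M) (hscale H) i (c i))" if j: "j \<in> J" for j
  proof -
    have t: "coact M j \<in> tensors (scal M) (hscale H) (V.span J)"
      using W J_car[OF j] by (simp add: subcomodule_iff)
    then obtain I :: "nat set" and u h where I: "finite I" "\<forall>i\<in>I. u i \<in> V.span J"
      "coact M j = (\<Sum>i\<in>I. pure_tensor (scal M) (hscale H) (u i) (h i))"
      by (rule tensorsE) 
    define r where "r = (\<lambda>i. V.representation J (u i))"
    have u: "u i = (\<Sum>n\<in>J. scal M (r i n) n)" if "i \<in> I" for i
      unfolding r_def using I that J by (intro V.sum_representation_eq[symmetric]) auto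
    have "coact M j = (\<Sum>n\<in>J. pure_tensor (scal M) (hscale H) n (\<Sum>i\<in>I. hscale H (r i n) (h i)))"
    proof (rule tensors_eqI[OF t])
      show "(\<Sum>n\<in>J. pure_tensor (scal M) (hscale H) n (\<Sum>i\<in>I. hscale H (r i n) (h i))) \<in> tensors (scal M) (hscale H) J"
        using J(1) by (rule sum_pure_tensor_in_tensors)
      fix B assume B: "bilinear_map (scal M) (hscale H) (*) B"
      have "coact M j B = (\<Sum>i\<in>I. B (\<Sum>n\<in>J. scal M (r i n) n) (h i))"
        by (simp add: I(3) sum_pure_tensor_apply[OF B] u)
      also have "\<dots> = (\<Sum>i\<in>I. \<Sum>n\<in>J. r i n * B n (h i))"
        by (simp add: bilinear_map_sum_left[OF B] bilinear_mapD(2)[OF B])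
      also have "\<dots> = (\<Sum>n\<in>J. \<Sum>i\<in>I. r i n * B n (h i))"
        by (rule sum.swap)
      also have "\<dots> = (\<Sum>n\<in>J. pure_tensor (scal M) (hscale H) n (\<Sum>i\<in>I. hscale H (r i n) (h i))) B"
        by (simp add: sum_pure_tensor_apply[OF B] bilinear_map_sum_right[OF B] bilinear_mapD(4)[OF B])
      finally show "coact M j B = \<dots>" .
    qed
    then show ?thesis
      by (rule exI[of _ "\<lambda>n. \<Sum>i\<in>I. hscale H (r i n) (h i)"])
  qed
  then obtain c where c: "\<And>j. j \<in> J \<Longrightarrow> coact M j = (\<Sum>i\<in>J. pure_tensor (scal M) (hscale H) i (c j i))"
    by metis
  define a where "a = (\<lambda>i j. c j i)"
  have a: "coact M j = (\<Sum>i\<in>J. pure_tensor (scal M) (hscale H) i (a i j))" if "j \<in> J" for j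
    using c[OF that] by (simp add: a_def)
  have "comatrix H J a"
    unfolding comatrix_def
  proof (intro ballI conjI)
    fix i j assume i: "i \<in> J" and j: "j \<in> J"
    obtain \<phi> where \<phi>: "lform (scal M) \<phi>" "\<phi> i = 1" "\<forall>c\<in>J. c \<noteq> i \<longrightarrow> \<phi> c = 0"
      by (rule V.linear_form_dual[OF J(2) i])
    have \<phi>_sum: "(\<Sum>n\<in>J. \<phi> n * X n) = X i" for X
    proof -
      have "(\<Sum>n\<in>J. \<phi> n * X n) = (\<Sum>n\<in>J. if n = i then X i else 0)"
        using \<phi> by (intro sum.cong) auto
      then show ?thesis
        using i J(1) by simp
    qed
    show "comult H (a i j) = (\<Sum>k\<in>J. pure_tensor (hscale H) (hscale H) (a i k) (a k j))"
    proof (rule tensors_eqI[OF comult_tensor])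
      show "(\<Sum>k\<in>J. pure_tensor (hscale H) (hscale H) (a i k) (a k j)) \<in> tensors (hscale H) (hscale H) UNIV"
        using J(1) by (intro sum_pure_tensor_in_tensors) auto
      fix B assume B: "bilinear_map (hscale H) (hscale H) (*) B"
      have T: "trilinear_form (scal M) (hscale H) (hscale H) (\<lambda>n h1 h2. \<phi> n * B h1 h2)"
        using \<phi>(1) B by (auto simp: trilinear_form_def Vector_Spaces.linear_iff bilinear_map_iff algebra_simps)
      have B': "bilinear_map (scal M) (hscale H) (*) (\<lambda>n h. \<phi> n * B h h')" for h'
        using \<phi>(1) B by (auto simp: Vector_Spaces.linear_iff bilinear_map_iff algebra_simps)
      have "(\<Sum>k\<in>J. coact M k (\<lambda>n h'. \<phi> n * B h' (a k j))) = (\<Sum>k\<in>J. comult H (a k j) (\<lambda>h1 h2. \<phi> k * B h1 h2))"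
        by (rule coassoc_sum[OF J_car(1)[OF j] J(1) a[OF j] T])
      moreover have "coact M k (\<lambda>n h'. \<phi> n * B h' (a k j)) = B (a i k) (a k j)" if "k \<in> J" for k
        by (simp add: a[OF that] sum_pure_tensor_apply[OF B'] \<phi>_sum)
      moreover have "(\<Sum>k\<in>J. comult H (a k j) (\<lambda>h1 h2. \<phi> k * B h1 h2)) = comult H (a i j) B"
        by (simp add: tensor_apply_bilinear(2)[OF comult_tensor B] \<phi>_sum)
      ultimately show "comult H (a i j) B = (\<Sum>k\<in>J. pure_tensor (hscale H) (hscale H) (a i k) (a k j)) B"
        by (simp add: sum_pure_tensor_apply[OF B])
    qed
    have "j = (\<Sum>k\<in>J. scal M (counit H (a k j)) k)"
      using act_sum[OF counit_linear J(1) a[OF j]] act_counit[OF J_car(1)[OF j]] by simp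
    then have "\<phi> j = (\<Sum>k\<in>J. counit H (a k j) * \<phi> k)"
      by (metis (no_types, lifting) linear_map_sum[OF \<phi>(1)] linear_map_scale[OF \<phi>(1)] sum.cong)
    then have "\<phi> j = counit H (a i j)"
      using \<phi>_sum[of "\<lambda>k. counit H (a k j)"] by (simp add: mult.commute)
    then show "counit H (a i j) = (if i = j then 1 else 0)"
      using \<phi>(2,3) j by auto
  qed
  moreover have "coacts_by H M J (\<lambda>j. j) a"
    unfolding coacts_by_def using a J_car by blast
  moreover have "a i j = 0" if A: "subcomodule H M (V.span A)" "A \<subseteq> J" "j \<in> A" "i \<in> J - A" for A i j
  proof (rule Hv.linear_form_eq_0)
    fix f assume f: "lform (hscale H) f"
    have ij: "i \<in> J" "j \<in> J" "i \<notin> A" using A by auto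
    obtain \<phi> where \<phi>: "lform (scal M) \<phi>" "\<phi> i = 1" "\<forall>c\<in>J. c \<noteq> i \<longrightarrow> \<phi> c = 0"
      by (rule V.linear_form_dual[OF J(2) ij(1)])
    interpret \<phi>: Vector_Spaces.linear "scal M" "(*)" \<phi> by (rule \<phi>(1))
    have "act H M f j \<in> V.span A"
      using subcomoduleD(3)[OF A(1) f] V.span_base[OF A(3)] by blast
    moreover have "\<phi> c = 0" if "c \<in> A" for c
      using \<phi>(3) subsetD[OF A(2) that] ij(3) that by auto
    ultimately have "\<phi> (act H M f j) = 0"
      using \<phi>.eq_0_on_span[of A "act H M f j"] by blast
    moreover have "act H M f j = (\<Sum>k\<in>J. scal M (f (a k j)) k)"
      by (rule act_sum[OF f J(1) a[OF ij(2)]])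
    moreover have "(\<Sum>k\<in>J. f (a k j) * \<phi> k) = (\<Sum>k\<in>J. if k = i then f (a i j) else 0)"
      using \<phi> by (intro sum.cong) auto
    ultimately show "f (a i j) = 0"
      using J(1) ij(1) by (simp add: linear_map_sum[OF \<phi>(1)] linear_map_scale[OF \<phi>(1)])
  qed
  ultimately show thesis
    using that by blast
qed

end

lemma (in hopf_alg) right_comoduleI: "comodule H M \<Longrightarrow> right_comodule H M"
  by unfold_locales

section \<open>The antipode and the integral\<close>

lemma bilinear_form_sum:
  assumes "vector_space sM" "vector_space sN" "\<And>i. i \<in> A \<Longrightarrow> bilinear_map sM sN (*) (B i)"
  shows "bilinear_map sM sN (*) (\<lambda>m n. \<Sum>i\<in>A. B i m n)"
  using assms by (auto simp: bilinear_map_iff vector_space_field sum.distrib sum_distrib_left)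

lemma tensor_apply_sum:
  assumes t: "t \<in> tensors sM sN V" and "finite A" "\<And>i. i \<in> A \<Longrightarrow> bilinear_map sM sN (*) (B i)"
    and vs: "vector_space sM" "vector_space sN"
  shows "t (\<lambda>m n. \<Sum>i\<in>A. B i m n) = (\<Sum>i\<in>A. t (B i))"
proof -
  obtain I :: "nat set" and x y where I: "finite I" "t = (\<Sum>i\<in>I. pure_tensor sM sN (x i) (y i))"
    using tensorsE[OF t] by metis
  have "bilinear_map sM sN (*) (\<lambda>m n. \<Sum>i\<in>A. B i m n)"
    by (rule bilinear_form_sum[OF vs assms(3)])
  then have "t (\<lambda>m n. \<Sum>i\<in>A. B i m n) = (\<Sum>j\<in>I. \<Sum>i\<in>A. B i (x j) (y j))"
    by (simp add: I(2) sum_pure_tensor_apply)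
  also have "\<dots> = (\<Sum>i\<in>A. \<Sum>j\<in>I. B i (x j) (y j))"
    by (rule sum.swap)
  also have "\<dots> = (\<Sum>i\<in>A. t (B i))"
    using assms(3) by (simp add: I(2) sum_pure_tensor_apply)
  finally show ?thesis .
qed

lemma tensor_apply_linear:
  assumes t: "t \<in> tensors sM sN V" and C: "\<And>p. bilinear_map sM sN (*) (C p)"
    and lin: "\<And>m n. Vector_Spaces.linear sP (*) (\<lambda>p. C p m n)" and P: "vector_space sP"
  shows "Vector_Spaces.linear sP (*) (\<lambda>p. t (C p))"
proof -
  have eta: "C (p + p') = (\<lambda>m n. C p m n + C p' m n)" "C (sP c p) = (\<lambda>m n. c * C p m n)" for p p' c
    using linear_map_add[OF lin] linear_map_scale[OF lin] by (simp_all add: fun_eq_iff)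
  show ?thesis
    unfolding Vector_Spaces.linear_iff using P
    by (simp add: eta vector_space_field tensor_apply_bilinear(1)[OF t C C] tensor_apply_bilinear(2)[OF t C])
qed

context hopf_alg
begin

lemma mult_bilinear: "bilinear_map (hscale H) (hscale H) (hscale H) (*)"
  using bialg by (simp add: bialgebra_def)

lemma comult_mult:
  assumes "bilinear_map (hscale H) (hscale H) (*) B"
  shows "comult H (g * h) B = comult H g (\<lambda>a b. comult H h (\<lambda>c d. B (a * c) (b * d)))"
  using bialg assms by (simp add: bialgebra_def)

lemma comult_one: "comult H 1 = pure_tensor (hscale H) (hscale H) 1 1"
  and counit_mult: "counit H (g * h) = counit H g * counit H h"
  and counit_one: "counit H 1 = 1"
  using bialg by (auto simp: bialgebra_def)

lemma comult_apply_lform: "lform (hscale H) (\<lambda>h. comult H h B)"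
  using comult_linear vector_space_field Hv.vector_space_axioms
  by (auto simp: Vector_Spaces.linear_iff fun_scale_def)

lemma bilinear_mult_mult:
  assumes "bilinear_map (hscale H) (hscale H) (*) B"
  shows "bilinear_map (hscale H) (hscale H) (*) (\<lambda>c d. B (a * c) (b * d))"
    "bilinear_map (hscale H) (hscale H) (*) (\<lambda>a b. B (a * c) (b * d))"
  by (rule bilinear_map_comp[OF assms mult_linear(2) mult_linear(2)],
      rule bilinear_map_comp[OF assms mult_linear(1) mult_linear(1)])

lemma bilinear_comult_mult:
  assumes B: "bilinear_map (hscale H) (hscale H) (*) B"
  shows "bilinear_map (hscale H) (hscale H) (*) (\<lambda>a b. comult H h (\<lambda>c d. B (a * c) (b * d)))"
  unfolding bilinear_map_def
proof (intro conjI allI tensor_apply_linear[OF comult_tensor] bilinear_mult_mult[OF B] Hv.vector_space_axioms)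
  show "lform (hscale H) (\<lambda>p. B (p * m) (b * n))" for m n b
    using bilinear_mapD(5)[OF bilinear_mult_mult(2)[OF B]] .
  show "lform (hscale H) (\<lambda>p. B (a * m) (p * n))" for m n a
    using bilinear_mapD(6)[OF bilinear_mult_mult(2)[OF B]] .
qed

lemma comatrix_comult_apply:
  assumes "comatrix H I a" "i \<in> I" "j \<in> I" "bilinear_map (hscale H) (hscale H) (*) B"
  shows "comult H (a i j) B = (\<Sum>k\<in>I. B (a i k) (a k j))"
  using assms by (simp add: comatrix_def sum_pure_tensor_apply)

text \<open>
  Applied to the regular comodule, local finiteness shows that \<open>H\<close> is spanned by the entries of
  comatrices: if \<open>J\<close> is a basis of a subcomodule of \<open>H\<close> with comatrix \<open>a\<close>, then \<open>x = \<Sum>i. \<epsilon>(i) a_ix\<close> for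
  \<open>x\<close> in \<open>J\<close>. Linear identities in \<open>H\<close> can therefore be checked on comatrices.
\<close>

lemma lform_eq_if_eq_on_comatrices:
  assumes F: "lform (hscale H) F" and G: "lform (hscale H) G"
    and eq: "\<And>(J :: 'h set) a i j. \<lbrakk>finite J; comatrix H J a; i \<in> J; j \<in> J\<rbrakk> \<Longrightarrow> F (a i j) = G (a i j)"
  shows "F t = G t"
proof -
  interpret R: right_comodule H regular
    by unfold_locales (rule comodule_regular)
  have reg: "car regular = UNIV" "scal regular = hscale H" "coact regular = comult H"
    by (simp_all add: regular_def)
  obtain W F0 where W: "subcomodule H regular W" "t \<in> W" "finite F0" "W = R.V.span F0"
    using R.locally_finite[of t] by (auto simp: reg)
  obtain J where J: "finite J" "R.V.independent J" "R.V.span J = W"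
    using R.V.subspace_basis[OF R.V.subspace_span order_refl W(3), of "{}"] W(4) R.V.independent_empty
    by auto
  obtain a where a: "comatrix H J a" "coacts_by H regular J (\<lambda>j. j) a"
    by (rule R.comatrix_of_basis[OF J(1,2)]) (use W(1) J(3) in simp)
  have "F x = G x" if "x \<in> J" for x
  proof -
    have "x = act H regular (counit H) x"
      using R.act_counit[of x] by (simp add: reg)
    also have "\<dots> = tensor_lift (hscale H) (hscale H) (\<lambda>m h. hscale H (counit H h) m) (comult H x)"
      by (simp add: act_def reg)
    also have "\<dots> = tensor_lift (hscale H) (hscale H) (\<lambda>m h. hscale H (counit H m) h) (comult H x)"
      using coalg by (simp add: coalgebra_def)
    also have "\<dots> = (\<Sum>i\<in>J. hscale H (counit H i) (a i x))"
      using a(2) that J(1) unfolding coacts_by_def reg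
      by (simp add: tensor_lift_sum_finite[OF bilinear_scale_right[OF Hv.vector_space_axioms counit_linear]])
    finally have x: "x = (\<Sum>i\<in>J. hscale H (counit H i) (a i x))" .
    have "F (\<Sum>i\<in>J. hscale H (counit H i) (a i x)) = G (\<Sum>i\<in>J. hscale H (counit H i) (a i x))"
      using eq[OF J(1) a(1) _ that] by (simp add: linear_map_sum[OF F] linear_map_sum[OF G] linear_map_scale[OF F] linear_map_scale[OF G])
    then show ?thesis
      using x by simp
  qed
  moreover have "lform (hscale H) (\<lambda>x. F x - G x)"
    using F G by (auto simp: Vector_Spaces.linear_iff algebra_simps)
  then interpret D: Vector_Spaces.linear "hscale H" "(*)" "\<lambda>x. F x - G x" .
  have "t \<in> Hv.span J"
    using W J by (simp add: reg)
  ultimately show ?thesis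
    using D.eq_0_on_span[of J t] by auto
qed

text \<open>
  The antipode axioms say that applying the antipode to all entries inverts a comatrix.
\<close>

lemma antipode_comatrix:
  assumes a: "comatrix H I a" and I: "finite I" "i \<in> I" "j \<in> I"
  shows "(\<Sum>k\<in>I. antipode H (a i k) * a k j) = (if i = j then 1 else 0)"
    and "(\<Sum>k\<in>I. a i k * antipode H (a k j)) = (if i = j then 1 else 0)"
proof -
  have "bilinear_map (hscale H) (hscale H) (hscale H) (\<lambda>x y. antipode H x * y)"
    by (rule bilinear_map_comp[OF mult_bilinear antipode_linear linear_ident[OF Hv.vector_space_axioms]])
  moreover have "tensor_lift (hscale H) (hscale H) (\<lambda>x y. antipode H x * y) (comult H (a i j)) = hscale H (counit H (a i j)) 1"
    using hopf by (simp add: hopf_algebra_def)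
  ultimately show "(\<Sum>k\<in>I. antipode H (a i k) * a k j) = (if i = j then 1 else 0)"
    using a I by (auto simp: comatrix_def tensor_lift_sum_finite)
  have "bilinear_map (hscale H) (hscale H) (hscale H) (\<lambda>x y. x * antipode H y)"
    by (rule bilinear_map_comp[OF mult_bilinear linear_ident[OF Hv.vector_space_axioms] antipode_linear])
  moreover have "tensor_lift (hscale H) (hscale H) (\<lambda>x y. x * antipode H y) (comult H (a i j)) = hscale H (counit H (a i j)) 1"
    using hopf by (simp add: hopf_algebra_def)
  ultimately show "(\<Sum>k\<in>I. a i k * antipode H (a k j)) = (if i = j then 1 else 0)"
    using a I by (auto simp: comatrix_def tensor_lift_sum_finite)
qed

lemma antipode_one: "antipode H 1 = 1"
proof -
  have "bilinear_map (hscale H) (hscale H) (hscale H) (\<lambda>x y. antipode H x * y)"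
    by (rule bilinear_map_comp[OF mult_bilinear antipode_linear linear_ident[OF Hv.vector_space_axioms]])
  from tensor_lift_sum_finite[OF this, of "{0::nat}" "\<lambda>_. 1" "\<lambda>_. 1"]
  have "tensor_lift (hscale H) (hscale H) (\<lambda>x y. antipode H x * y) (comult H 1) = antipode H 1"
    by (simp add: comult_one)
  moreover have "tensor_lift (hscale H) (hscale H) (\<lambda>x y. antipode H x * y) (comult H 1) = hscale H (counit H 1) 1"
    using hopf by (simp add: hopf_algebra_def)
  ultimately show ?thesis
    by (simp add: counit_one)
qed

lemma counit_antipode_comatrix:
  assumes a: "comatrix H I a" and I: "finite I" "i \<in> I" "j \<in> I"
  shows "counit H (antipode H (a i j)) = (if i = j then 1 else 0)"
proof -
  have "(if i = j then 1 else 0) = counit H (\<Sum>k\<in>I. antipode H (a i k) * a k j)"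
    unfolding antipode_comatrix[OF a I] by (simp add: counit_one linear_map_zero[OF counit_linear])
  also have "\<dots> = (\<Sum>k\<in>I. if k = j then counit H (antipode H (a i k)) else 0)"
    using a I unfolding linear_map_sum[OF counit_linear] counit_mult
    by (intro sum.cong) (auto simp: comatrix_def)
  also have "\<dots> = counit H (antipode H (a i j))"
    using I by simp
  finally show ?thesis ..
qed

text \<open>
  Let \<open>b\<close> be the inverse of the comatrix \<open>a\<close>. The matrix \<open>\<Delta> b\<close> is inverse to
  \<open>\<Delta> a = (a \<otimes> 1)(1 \<otimes> a)\<close>, hence equal to \<open>(1 \<otimes> b)(b \<otimes> 1)\<close>, whose entries are the right hand side. The
  proof spells out the uniqueness of inverses: \<open>Q\<close> below is the value at \<open>B\<close> of an entry of
  \<open>(1 \<otimes> b)(b \<otimes> 1) \<Delta>(a) \<Delta>(b)\<close>, computed with both bracketings.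
\<close>

lemma comult_antipode_comatrix:
  assumes a: "comatrix H I a" and I: "finite I" "l \<in> I" "k \<in> I"
    and B: "bilinear_map (hscale H) (hscale H) (*) B"
  shows "comult H (antipode H (a l k)) B = (\<Sum>p\<in>I. B (antipode H (a p k)) (antipode H (a l p)))"
proof -
  define b where "b = (\<lambda>i j. antipode H (a i j))"
  have ab: "(\<Sum>k\<in>I. a i k * b k j) = (if i = j then 1 else 0)"
    and ba: "(\<Sum>k\<in>I. b i k * a k j) = (if i = j then 1 else 0)" if "i \<in> I" "j \<in> I" for i j
    using antipode_comatrix[OF a I(1) that] by (simp_all add: b_def)
  have bil: "bilinear_map (hscale H) (hscale H) (*) (\<lambda>x y. B (u * x) (v * y))" for u v
    by (rule bilinear_mult_mult[OF B])
  \<comment> \<open>Summing over \<open>n\<close> first uses \<open>a b = 1\<close> and produces the right hand side.\<close>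
  define Q where "Q = (\<Sum>p\<in>I. \<Sum>m\<in>I. \<Sum>n\<in>I. comult H (a m n * b n k) (\<lambda>x y. B (b p m * x) (b l p * y)))"
  have "Q = (\<Sum>p\<in>I. \<Sum>m\<in>I. if m = k then B (b p m) (b l p) else 0)"
    unfolding Q_def
  proof (intro sum.cong refl)
    fix p m assume m: "m \<in> I"
    have "(\<Sum>n\<in>I. comult H (a m n * b n k) (\<lambda>x y. B (b p m * x) (b l p * y)))
        = comult H (if m = k then 1 else 0) (\<lambda>x y. B (b p m * x) (b l p * y))"
      unfolding ab[OF m I(3), symmetric] by (rule linear_map_sum[OF comult_apply_lform, symmetric])
    then show "(\<Sum>n\<in>I. comult H (a m n * b n k) (\<lambda>x y. B (b p m * x) (b l p * y))) = (if m = k then B (b p m) (b l p) else 0)"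
      using bil by (simp add: comult_one pure_tensor_def linear_map_zero[OF comult_apply_lform])
  qed
  then have Q1: "Q = (\<Sum>p\<in>I. B (b p k) (b l p))"
    using I by simp
  \<comment> \<open>Multiplicativity of the comultiplication splits off \<open>\<Delta> a\<close>; then the sums over \<open>m\<close> and \<open>p\<close> use \<open>b a = 1\<close>
    twice and leave \<open>\<Delta> b\<close>.\<close>
  have "comult H (a m n * b n k) (\<lambda>x y. B (b p m * x) (b l p * y)) =
      (\<Sum>q\<in>I. comult H (b n k) (\<lambda>c d. B (b p m * a m q * c) (b l p * a q n * d)))" if "m \<in> I" "n \<in> I" for p m n
    unfolding comult_mult[OF bil] comatrix_comult_apply[OF a that bilinear_comult_mult[OF bil]]
    by (simp add: mult.assoc)
  then have "Q = (\<Sum>p\<in>I. \<Sum>m\<in>I. \<Sum>n\<in>I. \<Sum>q\<in>I. comult H (b n k) (\<lambda>c d. B (b p m * a m q * c) (b l p * a q n * d)))"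
    by (simp add: Q_def)
  also have "\<dots> = (\<Sum>p\<in>I. \<Sum>n\<in>I. \<Sum>m\<in>I. \<Sum>q\<in>I. comult H (b n k) (\<lambda>c d. B (b p m * a m q * c) (b l p * a q n * d)))"
    by (intro sum.cong refl sum.swap)
  also have "\<dots> = (\<Sum>p\<in>I. \<Sum>n\<in>I. \<Sum>q\<in>I. \<Sum>m\<in>I. comult H (b n k) (\<lambda>c d. B (b p m * a m q * c) (b l p * a q n * d)))"
    by (intro sum.cong refl sum.swap)
  also have "\<dots> = (\<Sum>p\<in>I. \<Sum>n\<in>I. \<Sum>q\<in>I. if p = q then comult H (b n k) (\<lambda>c d. B c (b l p * a q n * d)) else 0)"
  proof (intro sum.cong refl)
    fix p n q assume "p \<in> I" "q \<in> I"
    have "(\<Sum>m\<in>I. comult H (b n k) (\<lambda>c d. B (b p m * a m q * c) (b l p * a q n * d))) =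
        comult H (b n k) (\<lambda>c d. \<Sum>m\<in>I. B (b p m * a m q * c) (b l p * a q n * d))"
      by (rule tensor_apply_sum[OF comult_tensor I(1) bil Hv.vector_space_axioms Hv.vector_space_axioms, symmetric])
    also have "\<dots> = comult H (b n k) (\<lambda>c d. B ((\<Sum>m\<in>I. b p m * a m q) * c) (b l p * a q n * d))"
      by (simp add: sum_distrib_right bilinear_map_sum_left[OF B])
    finally show "(\<Sum>m\<in>I. comult H (b n k) (\<lambda>c d. B (b p m * a m q * c) (b l p * a q n * d))) =
        (if p = q then comult H (b n k) (\<lambda>c d. B c (b l p * a q n * d)) else 0)"
      using tensor_apply_bilinear(2)[OF comult_tensor B, of "b n k" 0]
      by (simp add: ba[OF \<open>p \<in> I\<close> \<open>q \<in> I\<close>] bilinear_map_zero_left[OF B])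
  qed
  also have "\<dots> = (\<Sum>p\<in>I. \<Sum>n\<in>I. comult H (b n k) (\<lambda>c d. B c (b l p * a p n * d)))"
    using I(1) by simp
  also have "\<dots> = (\<Sum>n\<in>I. \<Sum>p\<in>I. comult H (b n k) (\<lambda>c d. B c (b l p * a p n * d)))"
    by (rule sum.swap)
  also have "\<dots> = (\<Sum>n\<in>I. if l = n then comult H (b n k) B else 0)"
  proof (intro sum.cong refl)
    fix n assume n: "n \<in> I"
    have bil': "bilinear_map (hscale H) (hscale H) (*) (\<lambda>x y. B x (v * y))" for v
      using bil[of 1] by simp
    have "(\<Sum>p\<in>I. comult H (b n k) (\<lambda>c d. B c (b l p * a p n * d))) =
        comult H (b n k) (\<lambda>c d. \<Sum>p\<in>I. B c (b l p * a p n * d))"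
      by (rule tensor_apply_sum[OF comult_tensor I(1) bil' Hv.vector_space_axioms Hv.vector_space_axioms, symmetric])
    also have "\<dots> = comult H (b n k) (\<lambda>c d. B c ((\<Sum>p\<in>I. b l p * a p n) * d))"
      by (simp add: sum_distrib_right bilinear_map_sum_right[OF B])
    finally show "(\<Sum>p\<in>I. comult H (b n k) (\<lambda>c d. B c (b l p * a p n * d))) = (if l = n then comult H (b n k) B else 0)"
      using tensor_apply_bilinear(2)[OF comult_tensor B, of "b n k" 0]
      by (simp add: ba[OF I(2) n] bilinear_map_zero_right[OF B])
  qed
  also have "\<dots> = comult H (b l k) B"
    using I by simp
  finally show ?thesis
    using Q1 by (simp add: b_def)
qed

text \<open>
  This is the comatrix of \<open>X' \<otimes> Y\<close>, where \<open>a\<close> and \<open>b\<close> are the comatrices of \<open>X\<close> and \<open>Y\<close>. The transposition of the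
  indices of \<open>a\<close> compensates for the antipode reversing the comultiplication.
\<close>

lemma comatrix_tensor_dual:
  assumes a: "comatrix H A a" "finite A" and b: "comatrix H C b" "finite C"
  shows "comatrix H (A \<times> C) (\<lambda>(k, i) (l, j). antipode H (a l k) * b i j)"
proof -
  let ?c = "\<lambda>(k, i) (l, j). antipode H (a l k) * b i j"
  have "comult H (?c (k, i) (l, j)) = (\<Sum>p\<in>A \<times> C. pure_tensor (hscale H) (hscale H) (?c (k, i) p) (?c p (l, j)))"
    if *: "k \<in> A" "l \<in> A" "i \<in> C" "j \<in> C" for k i l j
  proof (rule tensors_eqI[OF comult_tensor sum_pure_tensor_in_tensors])
    show "finite (A \<times> C)" using a b by simp
    show "?c (k, i) p \<in> UNIV" for p by simp
    fix B assume B: "bilinear_map (hscale H) (hscale H) (*) B"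
    have "comult H (?c (k, i) (l, j)) B = (\<Sum>m\<in>A. \<Sum>n\<in>C. B (antipode H (a m k) * b i n) (antipode H (a l m) * b n j))"
      unfolding prod.case comult_mult[OF B]
      unfolding comult_antipode_comatrix[OF a *(2,1) bilinear_comult_mult[OF B]]
      unfolding comatrix_comult_apply[OF b(1) *(3,4) bilinear_mult_mult(1)[OF B]] ..
    also have "\<dots> = (\<Sum>p\<in>A \<times> C. B (?c (k, i) p) (?c p (l, j)))"
      by (simp add: sum.cartesian_product case_prod_beta)
    finally show "comult H (?c (k, i) (l, j)) B =
        (\<Sum>p\<in>A \<times> C. pure_tensor (hscale H) (hscale H) (?c (k, i) p) (?c p (l, j))) B"
      by (simp add: sum_pure_tensor_apply[OF B])
  qed
  moreover have "counit H (?c (k, i) (l, j)) = (if (k, i) = (l, j) then 1 else 0)"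
    if *: "k \<in> A" "l \<in> A" "i \<in> C" "j \<in> C" for k i l j
    using * b by (auto simp: counit_mult counit_antipode_comatrix[OF a *(2,1)] comatrix_def)
  ultimately show ?thesis
    unfolding comatrix_def by auto
qed

lemma comult_antipode:
  assumes B: "bilinear_map (hscale H) (hscale H) (*) B"
  shows "comult H (antipode H t) B = comult H t (\<lambda>x y. B (antipode H y) (antipode H x))"
proof (rule lform_eq_if_eq_on_comatrices)
  show "lform (hscale H) (\<lambda>t. comult H (antipode H t) B)"
    by (rule lform_comp[OF antipode_linear comult_apply_lform])
  show "lform (hscale H) (\<lambda>t. comult H t (\<lambda>x y. B (antipode H y) (antipode H x)))"
    by (rule comult_apply_lform)
  have "bilinear_map (hscale H) (hscale H) (*) (\<lambda>x y. B (antipode H x) (antipode H y))"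
    by (rule bilinear_map_comp[OF B antipode_linear antipode_linear])
  then have B': "bilinear_map (hscale H) (hscale H) (*) (\<lambda>x y. B (antipode H y) (antipode H x))"
    by (auto simp: bilinear_map_def)
  fix J :: "'h set" and a i j
  assume "finite J" "comatrix H J a" "i \<in> J" "j \<in> J"
  then show "comult H (antipode H (a i j)) B = comult H (a i j) (\<lambda>x y. B (antipode H y) (antipode H x))"
    by (simp add: comult_antipode_comatrix B comatrix_comult_apply B')
qed

lemma counit_antipode: "counit H (antipode H t) = counit H t"
  by (rule lform_eq_if_eq_on_comatrices[OF lform_comp[OF antipode_linear counit_linear] counit_linear])
     (simp add: counit_antipode_comatrix comatrix_def)

text \<open>
  This is the identity \<open>S(S(t_2)) S(t_1) = \<epsilon>(t)\<close> for the antipode \<open>S\<close>: the antipode axiom for the element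
  \<open>S(t)\<close>.
\<close>

lemma antipode_antipode_mult_antipode:
  assumes \<theta>: "lform (hscale H) \<theta>"
  shows "comult H t (\<lambda>x y. \<theta> (antipode H (antipode H y) * antipode H x)) = counit H t * \<theta> 1"
proof -
  have \<beta>: "bilinear_map (hscale H) (hscale H) (hscale H) (\<lambda>x y. antipode H x * y)"
    by (rule bilinear_map_comp[OF mult_bilinear antipode_linear linear_ident[OF Hv.vector_space_axioms]])
  have "comult H t (\<lambda>x y. \<theta> (antipode H (antipode H y) * antipode H x)) =
      comult H (antipode H t) (\<lambda>x y. \<theta> (antipode H x * y))"
    by (rule comult_antipode[symmetric]) (rule bilinear_map_compose[OF \<beta> \<theta>])
  also have "\<dots> = \<theta> (tensor_lift (hscale H) (hscale H) (\<lambda>x y. antipode H x * y) (comult H (antipode H t)))"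
    by (rule tensor_lift_apply_form[OF comult_tensor \<beta> \<theta>, symmetric])
  also have "\<dots> = counit H t * \<theta> 1"
    using hopf by (simp add: hopf_algebra_def counit_antipode linear_map_scale[OF \<theta>])
  finally show ?thesis .
qed

end

locale hopf_integral = hopf_alg H
  for H :: "('k::field, 'h::ring_1) hopf" +
  fixes \<psi> :: "'h \<Rightarrow> 'k"
  assumes integral: "integral_on H \<psi>"
begin

lemma psi_linear: "lform (hscale H) \<psi>"
  using integral by (simp add: integral_on_def)

lemma integral_apply:
  assumes \<theta>: "lform (hscale H) \<theta>"
  shows "comult H h (\<lambda>x y. \<psi> y * \<theta> x) = \<psi> h * \<theta> 1"
proof -
  have "comult H h (\<lambda>x y. \<theta> (hscale H (\<psi> y) x)) = \<theta> (tensor_lift (hscale H) (hscale H) (\<lambda>a b. hscale H (\<psi> b) a) (comult H h))"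
    by (rule tensor_lift_apply_form[OF comult_tensor bilinear_scale_left[OF Hv.vector_space_axioms psi_linear] \<theta>, symmetric])
  then show ?thesis
    using integral by (simp add: integral_on_def linear_map_scale[OF \<theta>])
qed

lemma psi_mult_linear: "lform (hscale H) (\<lambda>y. \<psi> (y * z))" "lform (hscale H) (\<lambda>y. \<psi> (z * y))"
  "lform (hscale H) (\<lambda>y. \<psi> (z * antipode H y))"
  using lform_comp[OF mult_linear(1) psi_linear] lform_comp[OF mult_linear(2) psi_linear]
    lform_comp[OF antipode_linear lform_comp[OF mult_linear(2) psi_linear]] by simp_all

lemma integral_antipode_comatrix:
  assumes a: "comatrix H I a" and I: "finite I" "i \<in> I" "j \<in> I" and \<theta>: "lform (hscale H) \<theta>"
  shows "comult H h (\<lambda>x y. \<psi> (y * antipode H (a i j)) * \<theta> x) =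
    (\<Sum>m\<in>I. \<psi> (h * antipode H (a i m)) * \<theta> (a m j))"
proof -
  let ?b = "\<lambda>i j. antipode H (a i j)"
  have \<theta>m: "lform (hscale H) (\<lambda>x. \<theta> (x * z))" for z
    by (rule lform_comp[OF mult_linear(1) \<theta>])
  have bil: "bilinear_map (hscale H) (hscale H) (*) (\<lambda>x y. \<psi> (y * w) * \<theta> (x * z))" for w z
    by (rule bilinear_form_prod[OF \<theta>m psi_mult_linear(1)])
  have bil1: "bilinear_map (hscale H) (hscale H) (*) (\<lambda>x y. \<psi> y * \<theta> (x * z))" for z
    using bil[of 1] by simp
  have "(\<Sum>m\<in>I. \<psi> (h * ?b i m) * \<theta> (a m j)) = (\<Sum>m\<in>I. comult H (h * ?b i m) (\<lambda>x y. \<psi> y * \<theta> (x * a m j)))"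
    by (simp add: integral_apply[OF \<theta>m])
  also have "\<dots> = (\<Sum>m\<in>I. comult H h (\<lambda>x y. \<Sum>p\<in>I. \<psi> (y * ?b i p) * \<theta> (x * (?b p m * a m j))))"
  proof (intro sum.cong refl)
    fix m assume m: "m \<in> I"
    show "comult H (h * ?b i m) (\<lambda>x y. \<psi> y * \<theta> (x * a m j)) =
        comult H h (\<lambda>x y. \<Sum>p\<in>I. \<psi> (y * ?b i p) * \<theta> (x * (?b p m * a m j)))"
      unfolding comult_mult[OF bil1]
      unfolding comult_antipode_comatrix[OF a I(1,2) m bilinear_mult_mult(1)[OF bil1]]
      by (simp add: mult.assoc)
  qed
  also have "\<dots> = comult H h (\<lambda>x y. \<Sum>m\<in>I. \<Sum>p\<in>I. \<psi> (y * ?b i p) * \<theta> (x * (?b p m * a m j)))"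
  proof (rule tensor_apply_sum[OF comult_tensor I(1) _ Hv.vector_space_axioms Hv.vector_space_axioms, symmetric])
    fix m
    show "bilinear_map (hscale H) (hscale H) (*) (\<lambda>x y. \<Sum>p\<in>I. \<psi> (y * ?b i p) * \<theta> (x * (?b p m * a m j)))"
      by (rule bilinear_form_sum[OF Hv.vector_space_axioms Hv.vector_space_axioms bil])
  qed
  also have "\<dots> = comult H h (\<lambda>x y. \<psi> (y * ?b i j) * \<theta> x)"
  proof -
    have "(\<Sum>m\<in>I. \<Sum>p\<in>I. \<psi> (y * ?b i p) * \<theta> (x * (?b p m * a m j))) = \<psi> (y * ?b i j) * \<theta> x" for x y
    proof -
      have "(\<Sum>m\<in>I. \<Sum>p\<in>I. \<psi> (y * ?b i p) * \<theta> (x * (?b p m * a m j))) =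
          (\<Sum>p\<in>I. \<Sum>m\<in>I. \<psi> (y * ?b i p) * \<theta> (x * (?b p m * a m j)))"
        by (rule sum.swap)
      also have "\<dots> = (\<Sum>p\<in>I. \<psi> (y * ?b i p) * \<theta> (x * (\<Sum>m\<in>I. ?b p m * a m j)))"
        by (simp add: sum_distrib_left linear_map_sum[OF \<theta>])
      also have "\<dots> = (\<Sum>p\<in>I. if p = j then \<psi> (y * ?b i p) * \<theta> x else 0)"
        using I by (intro sum.cong) (auto simp: antipode_comatrix[OF a] linear_map_zero[OF \<theta>])
      finally show ?thesis
        using I by simp
    qed
    then show ?thesis by simp
  qed
  finally show ?thesis ..
qed

text \<open>
  In Sweedler notation this reads \<open>\<psi>(h_2 S(t)) h_1 = \<psi>(h S(t_1)) t_2\<close>. It follows from the defining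
  property of the integral for the elements \<open>h S(t_1)\<close>, after multiplication by \<open>t_2\<close> from the right.
\<close>

lemma integral_antipode:
  assumes \<theta>: "lform (hscale H) \<theta>"
  shows "comult H h (\<lambda>x y. \<psi> (y * antipode H t) * \<theta> x) = comult H t (\<lambda>x y. \<psi> (h * antipode H x) * \<theta> y)"
proof (rule lform_eq_if_eq_on_comatrices[where t = t and
      F = "\<lambda>t. comult H h (\<lambda>x y. \<psi> (y * antipode H t) * \<theta> x)" and
      G = "\<lambda>t. comult H t (\<lambda>x y. \<psi> (h * antipode H x) * \<theta> y)"])
  have \<psi>t: "lform (hscale H) (\<lambda>t. \<psi> (y * antipode H t) * \<theta> x)" for x y
    using psi_mult_linear(3)[of y] by (auto simp: Vector_Spaces.linear_iff algebra_simps)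
  show "lform (hscale H) (\<lambda>t. comult H h (\<lambda>x y. \<psi> (y * antipode H t) * \<theta> x))"
    by (rule tensor_apply_linear[OF comult_tensor bilinear_form_prod[OF \<theta> psi_mult_linear(1)] \<psi>t Hv.vector_space_axioms])
  show "lform (hscale H) (\<lambda>t. comult H t (\<lambda>x y. \<psi> (h * antipode H x) * \<theta> y))"
    by (rule comult_apply_lform)
  have B: "bilinear_map (hscale H) (hscale H) (*) (\<lambda>x y. \<psi> (h * antipode H x) * \<theta> y)"
    using bilinear_form_prod[OF psi_mult_linear(3) \<theta>, of h] by (simp add: mult.commute)
  fix J :: "'h set" and a i j
  assume "finite J" "comatrix H J a" "i \<in> J" "j \<in> J"
  then show "comult H h (\<lambda>x y. \<psi> (y * antipode H (a i j)) * \<theta> x) = comult H (a i j) (\<lambda>x y. \<psi> (h * antipode H x) * \<theta> y)"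
    by (simp add: integral_antipode_comatrix[OF _ _ _ _ \<theta>] comatrix_comult_apply B)
qed

text \<open>
  If \<open>S(t) = 0\<close>, then \<open>integral_antipode\<close> gives \<open>\<psi>(h' S(t_1)) t_2 = 0\<close> for every \<open>h'\<close>. With independent right
  legs this means that \<open>\<psi>(h' S(p)) = 0\<close> for each left leg \<open>p\<close> of \<open>t\<close> separately, and so \<open>h'\<close> may
  depend on the right leg. The choice \<open>h' = h S(S(t_2))\<close> leaves \<open>\<psi>(h) t = 0\<close>.
\<close>

lemma antipode_injective:
  assumes h: "\<psi> h \<noteq> 0" and t: "antipode H t = 0"
  shows "t = 0"
proof (rule Hv.linear_form_eq_0)
  fix \<theta> assume \<theta>: "lform (hscale H) \<theta>"
  interpret R: right_comodule H regular
    by unfold_locales (rule comodule_regular)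
  have reg: "car regular = UNIV" "scal regular = hscale H" "coact regular = comult H"
    by (simp_all add: regular_def)
  obtain I u where I: "finite I" "Hv.independent I" "\<forall>n\<in>I. u n \<in> UNIV"
    "comult H t = (\<Sum>n\<in>I. pure_tensor (hscale H) (hscale H) (u n) n)"
    by (rule tensors_independent_right[OF comult_tensor Hv.subspace_UNIV Hv.vector_space_axioms Hv.vector_space_axioms])
  have zero: "\<psi> (h' * antipode H (u n)) = 0" if n: "n \<in> I" for n h'
  proof -
    obtain f where f: "lform (hscale H) f" "f n = 1" "\<forall>c\<in>I. c \<noteq> n \<longrightarrow> f c = 0"
      by (rule Hv.linear_form_dual[OF I(2) n])
    have B: "bilinear_map (hscale H) (hscale H) (*) (\<lambda>x y. \<psi> (h' * antipode H x) * f y)"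
      using bilinear_form_prod[OF psi_mult_linear(3) f(1), of h'] by (simp add: mult.commute)
    have Z: "bilinear_map (hscale H) (hscale H) (*) (\<lambda>x y. 0)"
      using Hv.vector_space_axioms by (auto simp: bilinear_map_iff vector_space_field)
    have "0 = comult H h' (\<lambda>x y. \<psi> (y * antipode H t) * f x)"
      using tensor_apply_bilinear(2)[OF comult_tensor[of h'] Z, of 0]
      by (simp add: t linear_map_zero[OF psi_linear])
    also have "\<dots> = (\<Sum>c\<in>I. \<psi> (h' * antipode H (u c)) * f c)"
      unfolding integral_antipode[OF f(1)] I(4) by (rule sum_pure_tensor_apply[OF B])
    also have "\<dots> = (\<Sum>c\<in>I. if c = n then \<psi> (h' * antipode H (u c)) else 0)"
      using f by (intro sum.cong) auto
    finally show ?thesis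
      using I(1) n by simp
  qed
  have T: "trilinear_form (hscale H) (hscale H) (hscale H) (\<lambda>p q r. \<psi> (h * (antipode H (antipode H q) * antipode H p)) * \<theta> r)"
    using psi_linear \<theta> antipode_linear Hv.vector_space_axioms mult_bilinear
    by (auto simp: trilinear_form_def Vector_Spaces.linear_iff bilinear_map_iff algebra_simps)
  have T': "bilinear_map (hscale H) (hscale H) (*) (\<lambda>p q. \<psi> (h * (antipode H (antipode H q) * antipode H p)))"
    using psi_linear antipode_linear Hv.vector_space_axioms mult_bilinear vector_space_field
    by (auto simp: Vector_Spaces.linear_iff bilinear_map_iff algebra_simps)
  have "0 = (\<Sum>n\<in>I. comult H n (\<lambda>q r. \<psi> ((h * antipode H (antipode H q)) * antipode H (u n)) * \<theta> r))"
  proof -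
    have Z: "bilinear_map (hscale H) (hscale H) (*) (\<lambda>x y. 0)"
      using Hv.vector_space_axioms by (auto simp: bilinear_map_iff vector_space_field)
    show ?thesis
      using tensor_apply_bilinear(2)[OF comult_tensor Z, of _ 0] by (simp add: zero)
  qed
  also have "\<dots> = (\<Sum>n\<in>I. comult H (u n) (\<lambda>p q. \<psi> (h * (antipode H (antipode H q) * antipode H p)) * \<theta> n))"
    using R.coassoc_sum[of t I u "\<lambda>n. n", unfolded reg, OF _ I(1,4) T] by (simp add: mult.assoc)
  also have "\<dots> = (\<Sum>n\<in>I. \<theta> n * (counit H (u n) * \<psi> h))"
    using tensor_apply_bilinear(2)[OF comult_tensor T'] antipode_antipode_mult_antipode[OF psi_mult_linear(2)[of h]]
    by (simp add: mult.commute)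
  also have "\<dots> = \<psi> h * \<theta> (\<Sum>n\<in>I. hscale H (counit H (u n)) n)"
    by (simp add: linear_map_sum[OF \<theta>] linear_map_scale[OF \<theta>] sum_distrib_left ac_simps)
  also have "(\<Sum>n\<in>I. hscale H (counit H (u n)) n) = t"
  proof -
    have "tensor_lift (hscale H) (hscale H) (\<lambda>a b. hscale H (counit H a) b) (comult H t) = t"
      using coalg by (simp add: coalgebra_def)
    then show ?thesis
      using I(1) by (simp add: I(4) tensor_lift_sum_finite[OF bilinear_scale_right[OF Hv.vector_space_axioms counit_linear]])
  qed
  finally show "\<theta> t = 0"
    using h by simp
qed

lemma form_factors_through_antipode:
  assumes h: "\<psi> h \<noteq> 0" and f: "lform (hscale H) f"
  obtains g where "lform (hscale H) g" "\<And>t. g (antipode H t) = f t"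
proof -
  interpret P: vector_space_pair "hscale H" "hscale H" ..
  interpret S: Vector_Spaces.linear "hscale H" "hscale H" "antipode H"
    by (rule antipode_linear)
  have "inj (antipode H)"
    using antipode_injective[OF h] by (subst S.inj_iff_eq_0) auto
  then obtain g where g: "Vector_Spaces.linear (hscale H) (hscale H) g" "g \<circ> antipode H = id"
    using P.linear_injective_left_inverse[OF antipode_linear] by blast
  show thesis
    using that[OF lform_comp[OF g(1) f]] g(2) by (simp add: fun_eq_iff)
qed

end

lemma pure_tensor_zero:
  "pure_tensor sM sN m 0 = 0" "pure_tensor sM sN 0 n = 0"
  by (auto simp: pure_tensor_def fun_eq_iff bilinear_map_zero_right bilinear_map_zero_left)

context right_comodule
begin

lemma coact_apply_lform: "lform (scal M) (\<lambda>x. coact M x B)"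
  using coact_linear vector_space_field V.vector_space_axioms
  by (auto simp: Vector_Spaces.linear_iff fun_scale_def)

text \<open>
  The product of linear forms is convolution, so that iterated actions are again actions.
\<close>

lemma act_act:
  assumes x: "x \<in> car M" and f: "lform (hscale H) f" and g: "lform (hscale H) g"
  shows "act H M g (act H M f x) = act H M (\<lambda>h. comult H h (\<lambda>h1 h2. g h1 * f h2)) x"
proof (rule linear_form_separates[OF V.vector_space_axioms])
  fix \<phi> assume \<phi>: "lform (scal M) \<phi>"
  obtain I :: "nat set" and u h where I: "finite I" "\<forall>i\<in>I. u i \<in> UNIV"
    "coact M x = (\<Sum>i\<in>I. pure_tensor (scal M) (hscale H) (u i) (h i))"
    by (rule tensorsE[OF coact_tensor])
  have T: "trilinear_form (scal M) (hscale H) (hscale H) (\<lambda>n h1 h2. g h1 * \<phi> n * f h2)"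
    using f g \<phi> by (auto simp: trilinear_form_def Vector_Spaces.linear_iff algebra_simps)
  have gf: "bilinear_map (hscale H) (hscale H) (*) (\<lambda>h1 h2. g h1 * f h2)"
    using f g by (auto simp: bilinear_map_iff Vector_Spaces.linear_iff algebra_simps)
  have B: "bilinear_map (scal M) (hscale H) (*) (\<lambda>n h'. g h' * \<phi> n)"
    by (rule bilinear_form_prod[OF \<phi> g])
  have "\<phi> (act H M g (act H M f x)) = (\<Sum>i\<in>I. f (h i) * coact M (u i) (\<lambda>n h'. g h' * \<phi> n))"
    unfolding form_act[OF g \<phi>] act_sum[OF f I(1,3)]
    by (simp add: linear_map_sum[OF coact_apply_lform] linear_map_scale[OF coact_apply_lform])
  also have "\<dots> = (\<Sum>i\<in>I. coact M (u i) (\<lambda>n h'. g h' * \<phi> n * f (h i)))"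
  proof (rule sum.cong[OF refl])
    fix i
    show "f (h i) * coact M (u i) (\<lambda>n h'. g h' * \<phi> n) = coact M (u i) (\<lambda>n h'. g h' * \<phi> n * f (h i))"
      using tensor_apply_bilinear(2)[OF coact_tensor[of "u i"] B, of "f (h i)"]
      by (simp only: mult.commute[of "f (h i)"])
  qed
  also have "\<dots> = (\<Sum>i\<in>I. comult H (h i) (\<lambda>h1 h2. g h1 * \<phi> (u i) * f h2))"
    by (rule coassoc_sum[OF x I(1,3) T])
  also have "\<dots> = (\<Sum>i\<in>I. \<phi> (u i) * comult H (h i) (\<lambda>h1 h2. g h1 * f h2))"
  proof (rule sum.cong[OF refl])
    fix i
    show "comult H (h i) (\<lambda>h1 h2. g h1 * \<phi> (u i) * f h2) = \<phi> (u i) * comult H (h i) (\<lambda>h1 h2. g h1 * f h2)"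
      using tensor_apply_bilinear(2)[OF comult_tensor[of "h i"] gf, of "\<phi> (u i)"] by (simp add: ac_simps)
  qed
  also have "\<dots> = \<phi> (act H M (\<lambda>h. comult H h (\<lambda>h1 h2. g h1 * f h2)) x)"
    unfolding act_sum[OF comult_apply_lform I(1,3)]
    by (simp add: linear_map_sum[OF \<phi>] linear_map_scale[OF \<phi>] mult.commute)
  finally show "\<phi> (act H M g (act H M f x)) = \<phi> (act H M (\<lambda>h. comult H h (\<lambda>h1 h2. g h1 * f h2)) x)" .
qed

text \<open>
  This is the kernel of the comodule map \<open>x \<mapsto> \<mu>(x_0) x_1\<close> into the regular comodule.
\<close>

lemma form_kernel_subcomodule:
  assumes \<mu>: "lform (scal M) \<mu>"
  shows "subcomodule H M {x \<in> car M. \<forall>f. lform (hscale H) f \<longrightarrow> \<mu> (act H M f x) = 0}"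
  unfolding subcomodule_iff_act
proof (intro conjI allI impI ballI)
  show "V.subspace {x \<in> car M. \<forall>f. lform (hscale H) f \<longrightarrow> \<mu> (act H M f x) = 0}"
    using V.subspace_0[OF car_subspace] V.subspace_add[OF car_subspace] V.subspace_scale[OF car_subspace]
    by (intro V.subspaceI) (auto simp: linear_map_zero[OF act_linear] linear_map_add[OF act_linear] linear_map_scale[OF act_linear]
        linear_map_zero[OF \<mu>] linear_map_add[OF \<mu>] linear_map_scale[OF \<mu>])
next
  fix f x
  assume "lform (hscale H) f" and "x \<in> {x \<in> car M. \<forall>f. lform (hscale H) f \<longrightarrow> \<mu> (act H M f x) = 0}"
  then show "act H M f x \<in> {x \<in> car M. \<forall>f. lform (hscale H) f \<longrightarrow> \<mu> (act H M f x) = 0}"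
    using subcomoduleD(3)[OF subcomodule_car] by (simp add: act_act comult_apply_lform)
qed auto

end

section \<open>Injectivity in terms of comatrices\<close>

context hopf_alg
begin

text \<open>
  A family of vectors that coacts by \<open>c\<close> is a comodule map out of the comodule with basis \<open>J\<close> and
  comatrix \<open>c\<close>, and the block of zeros makes \<open>I\<close> span a subcomodule of it. The proof realises this
  comodule on the type of functions over which the definition of injectivity quantifies.
\<close>

lemma injective_extend:
  fixes E :: "('k, 'e::ab_group_add, 'h) comod" and c :: "'j \<Rightarrow> 'j \<Rightarrow> 'h"
  assumes E: "injective_comodule H E" and J: "finite J" "I \<subseteq> J" and c: "comatrix H J c"
    and block: "\<And>i j. j \<in> I \<Longrightarrow> i \<in> J - I \<Longrightarrow> c i j = 0"
    and x: "coacts_by H E I x c"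
  obtains y where "coacts_by H E J y c" "\<And>j. j \<in> I \<Longrightarrow> y j = x j"
proof -
  have I: "finite I"
    using J by (rule rev_finite_subset)
  interpret E: right_comodule H E
    using E by unfold_locales (simp add: injective_comodule_def)
  interpret F: vector_space "fun_scale :: 'k \<Rightarrow> ('e \<times> 'h \<times> nat \<Rightarrow> 'k) \<Rightarrow> _"
    by (rule vector_space_fun_scale)
  obtain enc :: "'j \<Rightarrow> nat" where enc: "inj_on enc J"
    using finite_imp_inj_to_nat_seg[OF J(1)] by blast
  \<comment> \<open>The basis vector with index \<open>j\<close> becomes the indicator function \<open>e j\<close> of a point \<open>pos j\<close>. Only the
    \<open>nat\<close> component of the domain is used to keep the points apart.\<close>
  define pos :: "'j \<Rightarrow> 'e \<times> 'h \<times> nat" where "pos = (\<lambda>j. (undefined, undefined, enc j))"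
  have pos: "pos i = pos j \<longleftrightarrow> i = j" if "i \<in> J" "j \<in> J" for i j
    using enc that by (auto simp: pos_def inj_on_def)
  define e :: "'j \<Rightarrow> 'e \<times> 'h \<times> nat \<Rightarrow> 'k" where "e = (\<lambda>j p. if p = pos j then 1 else 0)"
  \<comment> \<open>The right leg of the coaction of \<open>g\<close> that belongs to the left leg \<open>e i\<close>.\<close>
  define d where "d = (\<lambda>(g :: 'e \<times> 'h \<times> nat \<Rightarrow> 'k) i. \<Sum>j\<in>J. hscale H (g (pos j)) (c i j))"
  define \<rho> where "\<rho> = (\<lambda>g. \<Sum>i\<in>J. pure_tensor fun_scale (hscale H) (e i) (d g i))"
  define C where "C = (\<lambda>K. {g :: 'e \<times> 'h \<times> nat \<Rightarrow> 'k. \<forall>p. p \<notin> pos ` K \<longrightarrow> g p = 0})"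
  define Y :: "('k, 'e \<times> 'h \<times> nat \<Rightarrow> 'k, 'h) comod" where "Y = \<lparr>car = C J, scal = fun_scale, coact = \<rho>\<rparr>"
  have Y: "car Y = C J" "scal Y = fun_scale" "coact Y = \<rho>"
    by (simp_all add: Y_def)
  have d_linear: "Vector_Spaces.linear fun_scale (hscale H) (\<lambda>g. d g i)" for i
    using Hv.vector_space_axioms F.vector_space_axioms
    by (auto simp: Vector_Spaces.linear_iff d_def fun_scale_def Hv.scale_left_distrib sum.distrib Hv.scale_sum_right)
  have d_e: "d (e j) i = c i j" if "j \<in> J" for i j
  proof -
    have "d (e j) i = (\<Sum>k\<in>J. if k = j then c i j else 0)"
      unfolding d_def e_def using pos that by (intro sum.cong) auto
    then show ?thesis
      using J(1) that by simp
  qed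
  have d_apply: "\<phi> (d g i) = (\<Sum>j\<in>J. g (pos j) * \<phi> (c i j))" if \<phi>: "lform (hscale H) \<phi>" for \<phi> g i
    by (simp add: d_def linear_map_sum[OF \<phi>] linear_map_scale[OF \<phi>])
  have \<rho>_apply: "\<rho> g B = (\<Sum>i\<in>J. B (e i) (d g i))" if "bilinear_map fun_scale (hscale H) (*) B" for g B
    by (simp add: \<rho>_def sum_pure_tensor_apply[OF that])
  have \<rho>_outside: "\<rho> g B = 0" if "\<not> bilinear_map fun_scale (hscale H) (*) B" for g B
    using that by (simp add: \<rho>_def sum_fun_apply pure_tensor_def)
  have \<rho>_linear: "Vector_Spaces.linear fun_scale fun_scale \<rho>"
    unfolding Vector_Spaces.linear_iff
  proof (intro conjI allI vector_space_fun_scale ext)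
    show "\<rho> (g + g') B = (\<rho> g + \<rho> g') B" for g g' B
      by (cases "bilinear_map fun_scale (hscale H) (*) B")
        (simp_all add: \<rho>_apply \<rho>_outside linear_map_add[OF d_linear] bilinear_mapD(3) sum.distrib)
    show "\<rho> (fun_scale r g) B = fun_scale r (\<rho> g) B" for r g B
      by (cases "bilinear_map fun_scale (hscale H) (*) B")
        (simp_all add: \<rho>_apply \<rho>_outside linear_map_scale[OF d_linear] fun_scale_def[of r "\<rho> g"] bilinear_mapD(4) sum_distrib_left)
  qed
  have C_subspace: "F.subspace (C K)" for K
    by (auto simp: C_def fun_scale_def intro!: F.subspaceI)
  have e_C: "e j \<in> C K" if "j \<in> K" for j K
    using that by (auto simp: C_def e_def)
  have \<rho>_tensor: "\<rho> g \<in> tensors fun_scale (hscale H) (C J)" for g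
    unfolding \<rho>_def using J(1) e_C by (rule sum_pure_tensor_in_tensors)
  have "comodule H Y"
    unfolding comodule_def Y
  proof (intro conjI ballI allI impI \<rho>_linear C_subspace \<rho>_tensor)
    show "\<rho> g \<in> tensors fun_scale (hscale H) UNIV" for g
      unfolding \<rho>_def using J(1) by (intro sum_pure_tensor_in_tensors) auto
  next
    fix g and T :: "('e \<times> 'h \<times> nat \<Rightarrow> 'k) \<Rightarrow> 'h \<Rightarrow> 'h \<Rightarrow> 'k"
    assume T: "trilinear_form fun_scale (hscale H) (hscale H) T"
    have \<rho>_UNIV: "\<rho> g \<in> tensors fun_scale (hscale H) UNIV" for g
      unfolding \<rho>_def using J(1) by (intro sum_pure_tensor_in_tensors) auto
    have T2: "bilinear_map fun_scale (hscale H) (*) (\<lambda>n h'. T n h' h)" for h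
      using T by (auto simp: trilinear_form_def bilinear_map_def)
    have T1: "bilinear_map (hscale H) (hscale H) (*) (T n)" for n
      using T by (auto simp: trilinear_form_def bilinear_map_def)
    have B1: "bilinear_map fun_scale (hscale H) (*) (\<lambda>n h. \<rho> n (\<lambda>n' h'. T n' h' h))"
      by (rule bilinear_nested_left[OF \<rho>_linear \<rho>_UNIV T F.vector_space_axioms Hv.vector_space_axioms Hv.vector_space_axioms])
    have B2: "bilinear_map fun_scale (hscale H) (*) (\<lambda>n h. comult H h (T n))"
      by (rule bilinear_nested_right[OF comult_linear comult_tensor T Hv.vector_space_axioms Hv.vector_space_axioms F.vector_space_axioms])
    have "\<rho> g (\<lambda>n h. \<rho> n (\<lambda>n' h'. T n' h' h)) = (\<Sum>i\<in>J. \<Sum>k\<in>J. T (e k) (c k i) (d g i))"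
      unfolding \<rho>_apply[OF B1] by (simp add: \<rho>_apply[OF T2] d_e)
    also have "\<dots> = (\<Sum>i\<in>J. \<Sum>k\<in>J. \<Sum>j\<in>J. g (pos j) * T (e k) (c k i) (c i j))"
      using d_apply[OF bilinear_mapD(6)[OF T1]] by simp
    also have "\<dots> = (\<Sum>k\<in>J. \<Sum>i\<in>J. \<Sum>j\<in>J. g (pos j) * T (e k) (c k i) (c i j))"
      by (rule sum.swap)
    also have "\<dots> = (\<Sum>k\<in>J. \<Sum>j\<in>J. \<Sum>i\<in>J. g (pos j) * T (e k) (c k i) (c i j))"
      by (intro sum.cong refl sum.swap)
    also have "\<dots> = (\<Sum>k\<in>J. comult H (d g k) (T (e k)))"
      unfolding d_apply[OF comult_apply_lform] by (simp add: comatrix_comult_apply[OF c _ _ T1] sum_distrib_left)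
    also have "\<dots> = \<rho> g (\<lambda>n h. comult H h (T n))"
      by (simp add: \<rho>_apply[OF B2])
    finally show "\<rho> g (\<lambda>n h. \<rho> n (\<lambda>n' h'. T n' h' h)) = \<rho> g (\<lambda>n h. comult H h (\<lambda>h1 h2. T n h1 h2))" .
  next
    fix g assume g: "g \<in> C J"
    have "tensor_lift fun_scale (hscale H) (\<lambda>n h. fun_scale (counit H h) n) (\<rho> g) = (\<Sum>i\<in>J. fun_scale (counit H (d g i)) (e i))"
      unfolding \<rho>_def by (rule tensor_lift_sum_finite[OF bilinear_scale_left[OF F.vector_space_axioms counit_linear] J(1)])
    also have "\<dots> = (\<Sum>i\<in>J. fun_scale (g (pos i)) (e i))"
    proof (intro sum.cong refl)
      fix i assume i: "i \<in> J"
      have "counit H (d g i) = (\<Sum>j\<in>J. if j = i then g (pos j) else 0)"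
        unfolding d_apply[OF counit_linear] using c i by (intro sum.cong) (auto simp: comatrix_def)
      then show "fun_scale (counit H (d g i)) (e i) = fun_scale (g (pos i)) (e i)"
        using i J(1) by simp
    qed
    also have "\<dots> = g"
    proof
      fix p
      have "(\<Sum>i\<in>J. fun_scale (g (pos i)) (e i)) p = (\<Sum>i\<in>J. if p = pos i then g p else 0)"
        by (auto simp: sum_fun_apply fun_scale_def e_def intro!: sum.cong)
      also have "\<dots> = g p"
      proof (cases "p \<in> pos ` J")
        case True
        then obtain j where j: "j \<in> J" "p = pos j" by blast
        then have "(\<Sum>i\<in>J. if p = pos i then g p else 0) = (\<Sum>i\<in>J. if i = j then g p else 0)"
          using pos by (intro sum.cong) auto
        then show ?thesis
          using J(1) j by simp
      next
        case False
        then have "(\<Sum>i\<in>J. if p = pos i then g p else 0) = 0"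
          by (intro sum.neutral) auto
        then show ?thesis
          using False g unfolding C_def mem_Collect_eq by metis
      qed
      finally show "(\<Sum>i\<in>J. fun_scale (g (pos i)) (e i)) p = g p" .
    qed
    finally show "tensor_lift fun_scale (hscale H) (\<lambda>n h. fun_scale (counit H h) n) (\<rho> g) = g" .
  qed
  then interpret Y: right_comodule H Y
    by unfold_locales
  have vanish: "g (pos j) = 0" if "g \<in> C I" "j \<in> J - I" for g j
  proof -
    have "pos j \<notin> pos ` I"
      using that(2) J(2) pos by auto
    then show ?thesis
      using that(1) unfolding C_def mem_Collect_eq by metis
  qed
  have d_I: "d g i = (if i \<in> I then \<Sum>j\<in>I. hscale H (g (pos j)) (c i j) else 0)" if g: "g \<in> C I" "i \<in> J" for g i
  proof -
    have "d g i = (\<Sum>j\<in>I. hscale H (g (pos j)) (c i j))"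
      unfolding d_def using J vanish[OF g(1)] by (intro sum.mono_neutral_right) auto
    then show ?thesis
      using block g(2) by (auto intro: sum.neutral)
  qed
  have \<rho>_I: "\<rho> g = (\<Sum>i\<in>I. pure_tensor fun_scale (hscale H) (e i) (d g i))" if g: "g \<in> C I" for g
    unfolding \<rho>_def using J d_I[OF g] by (intro sum.mono_neutral_right) (auto simp: pure_tensor_zero)
  have "C I \<subseteq> C J"
    using image_mono[OF J(2), of pos] unfolding C_def by blast
  moreover have "\<rho> g \<in> tensors fun_scale (hscale H) (C I)" if "g \<in> C I" for g
    unfolding \<rho>_I[OF that] using I e_C by (rule sum_pure_tensor_in_tensors)
  ultimately have "subcomodule H Y (C I)"
    unfolding Y.subcomodule_iff unfolding Y using C_subspace by blast
  moreover define X where "X = Y\<lparr>car := C I\<rparr>"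
  ultimately have X: "comodule H X" "car X = C I" "scal X = fun_scale" "coact X = \<rho>"
    by (simp_all add: subcomodule_def Y)
  have incl: "comodule_hom H X Y (\<lambda>g. g)"
    using \<open>C I \<subseteq> C J\<close> linear_ident[OF F.vector_space_axioms]
    by (simp add: comodule_hom_def X Y)
  define f where "f = (\<lambda>g. \<Sum>j\<in>I. scal E (g (pos j)) (x j))"
  have f_linear: "Vector_Spaces.linear fun_scale (scal E) f"
    using E.V.vector_space_axioms F.vector_space_axioms
    by (auto simp: Vector_Spaces.linear_iff f_def fun_scale_def E.V.scale_left_distrib sum.distrib E.V.scale_sum_right)
  have f_e: "f (e j) = x j" if "j \<in> I" for j
  proof -
    have "f (e j) = (\<Sum>k\<in>I. if k = j then x j else 0)"
      unfolding f_def e_def using pos that J(2) by (intro sum.cong) auto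
    then show ?thesis
      using I that by simp
  qed
  have "comodule_hom H X E f"
    unfolding comodule_hom_def
  proof (intro conjI ballI allI impI; (unfold X)?)
    show "Vector_Spaces.linear fun_scale (scal E) f"
      by (rule f_linear)
    show "f ` C I \<subseteq> car E"
      using x unfolding f_def coacts_by_def
      by (auto intro!: E.V.subspace_sum[OF E.car_subspace] E.V.subspace_scale[OF E.car_subspace])
    fix g B assume g: "g \<in> C I" and B: "bilinear_map (scal E) (hscale H) (*) B"
    have fB: "bilinear_map fun_scale (hscale H) (*) (\<lambda>m h. B (f m) h)"
      by (rule bilinear_map_comp[OF B f_linear linear_ident[OF Hv.vector_space_axioms]])
    have "coact E (f g) B = (\<Sum>j\<in>I. g (pos j) * (\<Sum>i\<in>I. B (x i) (c i j)))"
      using x by (simp add: f_def linear_map_sum[OF E.coact_apply_lform] linear_map_scale[OF E.coact_apply_lform]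
          coacts_by_def sum_pure_tensor_apply[OF B])
    also have "\<dots> = (\<Sum>j\<in>I. \<Sum>i\<in>I. g (pos j) * B (x i) (c i j))"
      by (simp add: sum_distrib_left)
    also have "\<dots> = (\<Sum>i\<in>I. \<Sum>j\<in>I. g (pos j) * B (x i) (c i j))"
      by (rule sum.swap)
    also have "\<dots> = (\<Sum>i\<in>I. B (x i) (d g i))"
      using d_I[OF g] J(2)
      by (intro sum.cong) (auto simp: bilinear_map_sum_right[OF B] bilinear_mapD(4)[OF B])
    also have "\<dots> = \<rho> g (\<lambda>m h. B (f m) h)"
      by (simp add: \<rho>_I[OF g] sum_pure_tensor_apply[OF fB] f_e)
    finally show "coact E (f g) B = \<rho> g (\<lambda>m h. B (f m) h)" .
  qed
  moreover have "inj_on (\<lambda>g. g) (car X)"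
    by simp
  ultimately obtain G where G: "comodule_hom H Y E G" "\<forall>g\<in>car X. G g = f g"
    using E X(1) Y.M incl unfolding injective_comodule_def by meson
  have G_linear: "Vector_Spaces.linear fun_scale (scal E) G"
    using G(1) by (simp add: comodule_hom_def Y)
  show thesis
  proof (rule that[of "\<lambda>j. G (e j)"])
    show "G (e j) = x j" if "j \<in> I" for j
      using G(2) e_C[OF that] f_e[OF that] by (simp add: X)
    have "coact E (G (e j)) = (\<Sum>i\<in>J. pure_tensor (scal E) (hscale H) (G (e i)) (c i j))" if j: "j \<in> J" for j
    proof (rule tensors_eqI[OF E.coact_tensor])
      show "(\<Sum>i\<in>J. pure_tensor (scal E) (hscale H) (G (e i)) (c i j)) \<in> tensors (scal E) (hscale H) UNIV"
        using J(1) by (intro sum_pure_tensor_in_tensors) auto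
      fix B assume B: "bilinear_map (scal E) (hscale H) (*) B"
      have GB: "bilinear_map fun_scale (hscale H) (*) (\<lambda>m h. B (G m) h)"
        by (rule bilinear_map_comp[OF B G_linear linear_ident[OF Hv.vector_space_axioms]])
      have "coact E (G (e j)) B = \<rho> (e j) (\<lambda>m h. B (G m) h)"
        using G(1) B e_C[OF j] by (simp add: comodule_hom_def Y)
      then show "coact E (G (e j)) B = (\<Sum>i\<in>J. pure_tensor (scal E) (hscale H) (G (e i)) (c i j)) B"
        by (simp add: \<rho>_apply[OF GB] d_e[OF j] sum_pure_tensor_apply[OF B])
    qed
    then show "coacts_by H E J (\<lambda>j. G (e j)) c"
      using G(1) e_C by (auto simp: coacts_by_def comodule_hom_def Y)
  qed
qed

text \<open>
  The diagonal blocks of a block triangular comatrix are comatrices. The disjunction covers both the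
  subcomodule and the quotient.
\<close>

lemma comatrix_restrict:
  assumes "comatrix H A a" "finite A" "I \<subseteq> A"
    and zero: "\<And>i j k. i \<in> I \<Longrightarrow> j \<in> I \<Longrightarrow> k \<in> A - I \<Longrightarrow> a i k = 0 \<or> a k j = 0"
  shows "comatrix H I a"
proof -
  have "(\<Sum>k\<in>A. pure_tensor (hscale H) (hscale H) (a i k) (a k j)) = (\<Sum>k\<in>I. pure_tensor (hscale H) (hscale H) (a i k) (a k j))"
    if "i \<in> I" "j \<in> I" for i j
  proof (rule sum.mono_neutral_right[OF assms(2,3)], intro ballI)
    fix k assume "k \<in> A - I"
    then show "pure_tensor (hscale H) (hscale H) (a i k) (a k j) = 0"
      using zero[OF that] pure_tensor_zero by metis
  qed
  then show ?thesis
    using assms(1,3) by (auto simp: comatrix_def subset_iff)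
qed

end

section \<open>The injective hull of the trivial comodule\<close>

locale unit_hull = hopf_integral H \<psi> + E: right_comodule H E
  for H :: "('k::field, 'h::ring_1) hopf" and \<psi> :: "'h \<Rightarrow> 'k"
    and E :: "('k, 'e::ab_group_add, 'h) comod" +
  fixes u :: 'e and h0 :: 'h
  assumes E_injective: "injective_comodule H E"
    and u_car: "u \<in> car E" and u_nonzero: "u \<noteq> 0"
    and coact_u: "coact E u = pure_tensor (scal E) (hscale H) u 1"
    and u_essential: "\<And>W. subcomodule H E W \<Longrightarrow> u \<notin> W \<Longrightarrow> W = {0}"
    and psi_h0: "\<psi> h0 \<noteq> 0"
begin

lemma form_at_u:
  obtains \<theta> where "lform (scal E) \<theta>" "\<theta> u = 1"
  using E.V.linear_form_dual[of "{u}" u] u_nonzero by auto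

text \<open>
  Choose a linear form \<open>\<theta>\<close> with \<open>\<theta>(u) = 1\<close> and let \<open>k(x) = \<theta>(x_0) x_1\<close>, a comodule map from \<open>E\<close> to \<open>H\<close> with
  \<open>k(u) = 1\<close>. For \<open>\<mu>(x) = \<psi>(h0 S(k(x)))\<close> the identity \<open>integral_antipode\<close> yields
  \<open>\<mu>(x_0) x_1 = \<psi>(h0_2 S(k(x))) h0_1\<close>. Thus the comodule map to \<open>H\<close> given by \<open>\<mu>\<close> takes values in the span
  of the finitely many left legs of \<open>h0\<close>. It is injective because \<open>\<mu>(u) = \<psi>(h0)\<close> is not 0 and \<open>u\<close>
  generates an essential subcomodule.
\<close>

lemma finite_dimensional: "\<exists>F. finite F \<and> car E \<subseteq> E.V.span F"
proof -
  obtain \<theta> where \<theta>: "lform (scal E) \<theta>" "\<theta> u = 1"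
    by (rule form_at_u)
  \<comment> \<open>In the notation above, \<open>L y x\<close> is \<open>\<psi>(y S(k(x)))\<close>, and \<open>\<mu>\<close> is \<open>L h0\<close>.\<close>
  define L where "L = (\<lambda>y x. coact E x (\<lambda>m h. \<psi> (y * antipode H h) * \<theta> m))"
  have L_bilinear: "bilinear_map (scal E) (hscale H) (*) (\<lambda>m h. \<psi> (y * antipode H h) * \<theta> m)" for y
    by (rule bilinear_form_prod[OF \<theta>(1) psi_mult_linear(3)])
  have L_linear: "lform (scal E) (L y)" for y
    unfolding L_def by (rule E.coact_apply_lform)
  obtain S :: "nat set" and p q where S: "finite S" "\<forall>s\<in>S. p s \<in> UNIV"
    "comult H h0 = (\<Sum>s\<in>S. pure_tensor (hscale H) (hscale H) (p s) (q s))"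
    by (rule tensorsE[OF comult_tensor])
  have key: "L h0 (act H E f x) = (\<Sum>s\<in>S. f (p s) * L (q s) x)"
    if x: "x \<in> car E" and f: "lform (hscale H) f" for f x
  proof -
    obtain I :: "nat set" and v h where I: "finite I" "\<forall>i\<in>I. v i \<in> UNIV"
      "coact E x = (\<Sum>i\<in>I. pure_tensor (scal E) (hscale H) (v i) (h i))"
      by (rule tensorsE[OF E.coact_tensor])
    have T: "trilinear_form (scal E) (hscale H) (hscale H) (\<lambda>n h1 h2. \<psi> (h0 * antipode H h1) * \<theta> n * f h2)"
      using psi_mult_linear(3)[of h0] \<theta>(1) f
      by (auto simp: trilinear_form_def Vector_Spaces.linear_iff algebra_simps)
    have B: "bilinear_map (hscale H) (hscale H) (*) (\<lambda>h1 h2. \<psi> (h0 * antipode H h1) * f h2)"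
      using psi_mult_linear(3)[of h0] f
      by (auto simp: bilinear_map_iff Vector_Spaces.linear_iff algebra_simps)
    have B': "bilinear_map (hscale H) (hscale H) (*) (\<lambda>h1 h2. \<psi> (h2 * antipode H t) * f h1)" for t
      by (rule bilinear_form_prod[OF f psi_mult_linear(1)])
    have "L h0 (act H E f x) = (\<Sum>i\<in>I. f (h i) * coact E (v i) (\<lambda>m h'. \<psi> (h0 * antipode H h') * \<theta> m))"
      unfolding E.act_sum[OF f I(1,3)] by (simp add: linear_map_sum[OF L_linear] linear_map_scale[OF L_linear]) (simp add: L_def)
    also have "\<dots> = (\<Sum>i\<in>I. coact E (v i) (\<lambda>m h'. \<psi> (h0 * antipode H h') * \<theta> m * f (h i)))"
    proof (rule sum.cong[OF refl])
      fix i
      show "f (h i) * coact E (v i) (\<lambda>m h'. \<psi> (h0 * antipode H h') * \<theta> m) =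
          coact E (v i) (\<lambda>m h'. \<psi> (h0 * antipode H h') * \<theta> m * f (h i))"
        using tensor_apply_bilinear(2)[OF E.coact_tensor[of "v i"] L_bilinear, of "f (h i)"]
        by (simp only: mult.commute[of "f (h i)"])
    qed
    also have "\<dots> = (\<Sum>i\<in>I. comult H (h i) (\<lambda>h1 h2. \<psi> (h0 * antipode H h1) * \<theta> (v i) * f h2))"
      by (rule E.coassoc_sum[OF x I(1,3) T])
    also have "\<dots> = (\<Sum>i\<in>I. \<theta> (v i) * comult H (h i) (\<lambda>h1 h2. \<psi> (h0 * antipode H h1) * f h2))"
    proof (rule sum.cong[OF refl])
      fix i
      show "comult H (h i) (\<lambda>h1 h2. \<psi> (h0 * antipode H h1) * \<theta> (v i) * f h2) =
          \<theta> (v i) * comult H (h i) (\<lambda>h1 h2. \<psi> (h0 * antipode H h1) * f h2)"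
        using tensor_apply_bilinear(2)[OF comult_tensor[of "h i"] B, of "\<theta> (v i)"] by (simp add: ac_simps)
    qed
    also have "\<dots> = (\<Sum>i\<in>I. \<theta> (v i) * (\<Sum>s\<in>S. \<psi> (q s * antipode H (h i)) * f (p s)))"
      unfolding integral_antipode[OF f, symmetric] S(3) sum_pure_tensor_apply[OF B'] ..
    also have "\<dots> = (\<Sum>i\<in>I. \<Sum>s\<in>S. f (p s) * (\<psi> (q s * antipode H (h i)) * \<theta> (v i)))"
      by (simp add: sum_distrib_left ac_simps)
    also have "\<dots> = (\<Sum>s\<in>S. \<Sum>i\<in>I. f (p s) * (\<psi> (q s * antipode H (h i)) * \<theta> (v i)))"
      by (rule sum.swap)
    also have "\<dots> = (\<Sum>s\<in>S. f (p s) * L (q s) x)"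
      by (simp add: L_def I(3) sum_pure_tensor_apply[OF L_bilinear] sum_distrib_left)
    finally show ?thesis .
  qed
  define K where "K = {x \<in> car E. \<forall>f. lform (hscale H) f \<longrightarrow> L h0 (act H E f x) = 0}"
  have "L h0 u = \<psi> h0"
    using L_bilinear[of h0] by (simp add: L_def coact_u pure_tensor_def antipode_one \<theta>(2))
  then have "u \<notin> K"
    using psi_h0 E.act_counit[OF u_car] counit_linear unfolding K_def by auto
  then have K: "K = {0}"
    using u_essential E.form_kernel_subcomodule[OF L_linear] unfolding K_def by blast
  obtain P where P: "P \<subseteq> car E" "E.V.independent P" "car E \<subseteq> E.V.span P"
    using E.V.maximal_independent_subset[of "car E"] by blast
  have "x = 0" if x: "x \<in> E.V.span P" and zero: "\<And>s. s \<in> S \<Longrightarrow> L (q s) x = 0" for x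
  proof -
    have "x \<in> car E"
      using x P(1) E.V.span_minimal[OF P(1) E.car_subspace] by blast
    then have "x \<in> K"
      unfolding K_def using key zero by simp
    then show ?thesis
      using K by simp
  qed
  then have "finite P"
    using independent_bound_forms[of S "scal E" "\<lambda>s. L (q s)" P] L_linear E.V.vector_space_axioms S(1) P(2) by blast
  then show ?thesis
    using P(3) by blast
qed

text \<open>
  The comatrix \<open>a\<close> restricted to \<open>A\<close>, \<open>C\<close> and \<open>I\<close> describes comodules \<open>X\<close>, \<open>Y\<close> and \<open>Z\<close>, where \<open>Z\<close> is a quotient of
  \<open>X\<close> and a subcomodule of \<open>Y\<close>. Then \<open>Z' \<otimes> Z\<close> is a subcomodule of \<open>X' \<otimes> Y\<close>, and \<open>y\<close> is the extension to
  \<open>X' \<otimes> Y\<close> of the evaluation \<open>Z' \<otimes> Z \<rightarrow> E\<close> with values in the multiples of \<open>u\<close>. Below, either \<open>A = I\<close> or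
  \<open>C = I\<close>.
\<close>

lemma extend_evaluation:
  fixes a :: "'j \<Rightarrow> 'j \<Rightarrow> 'h"
  assumes A: "finite A" "comatrix H A a" and C: "finite C" "comatrix H C a" and I: "I \<subseteq> A" "I \<subseteq> C"
    and blockA: "\<And>l k. l \<in> I \<Longrightarrow> k \<in> A - I \<Longrightarrow> a l k = 0"
    and blockC: "\<And>i j. j \<in> I \<Longrightarrow> i \<in> C - I \<Longrightarrow> a i j = 0"
  obtains y where "\<forall>l\<in>A. \<forall>j\<in>C. y l j \<in> car E"
    "\<forall>l\<in>A. \<forall>j\<in>C. \<forall>B. bilinear_map (scal E) (hscale H) (*) B \<longrightarrow>
        coact E (y l j) B = (\<Sum>k\<in>A. \<Sum>i\<in>C. B (y k i) (antipode H (a l k) * a i j))"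
    "\<forall>l\<in>I. \<forall>j\<in>I. y l j = (if l = j then u else 0)"
proof -
  define c where "c = (\<lambda>(k, i) (l, j). antipode H (a l k) * a i j)"
  \<comment> \<open>The evaluation sends the tensor of a dual basis vector and a basis vector to \<open>u\<close> or to 0.\<close>
  define x :: "'j \<times> 'j \<Rightarrow> 'e" where "x = (\<lambda>(l, j). if l = j then u else 0)"
  have fin: "finite I"
    using A(1) I(1) by (rule rev_finite_subset)
  have c: "comatrix H (A \<times> C) c"
    unfolding c_def by (rule comatrix_tensor_dual[OF A(2,1) C(2,1)])
  have aI: "comatrix H I a"
    using comatrix_restrict[OF A(2,1) I(1)] blockA by blast
  have "coacts_by H E (I \<times> I) x c"
    unfolding coacts_by_def
  proof (intro ballI conjI)
    fix w assume "w \<in> I \<times> I"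
    then obtain l j where w: "w = (l, j)" "l \<in> I" "j \<in> I" by blast
    show "x w \<in> car E"
      using u_car E.V.subspace_0[OF E.car_subspace] by (simp add: w x_def)
    show "coact E (x w) = (\<Sum>i\<in>I \<times> I. pure_tensor (scal E) (hscale H) (x i) (c i w))"
    proof (rule tensors_eqI[OF E.coact_tensor sum_pure_tensor_in_tensors])
      show "finite (I \<times> I)" using fin by simp
      show "x i \<in> UNIV" for i by simp
      fix B assume B: "bilinear_map (scal E) (hscale H) (*) B"
      have "(\<Sum>i\<in>I \<times> I. pure_tensor (scal E) (hscale H) (x i) (c i w)) B =
          (\<Sum>k\<in>I. \<Sum>i\<in>I. B (x (k, i)) (c (k, i) w))"
        by (simp add: sum_pure_tensor_apply[OF B] sum.cartesian_product)
      also have "\<dots> = (\<Sum>k\<in>I. \<Sum>i\<in>I. if i = k then B u (antipode H (a l k) * a k j) else 0)"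
        by (intro sum.cong refl) (auto simp: x_def c_def w bilinear_map_zero_left[OF B])
      also have "\<dots> = B u (\<Sum>k\<in>I. antipode H (a l k) * a k j)"
        using fin by (simp add: bilinear_map_sum_right[OF B])
      also have "\<dots> = coact E (x w) B"
        unfolding antipode_comatrix(1)[OF aI fin w(2,3)]
        using B by (simp add: x_def w coact_u pure_tensor_def bilinear_map_zero_right[OF B] linear_map_zero[OF E.coact_apply_lform])
      finally show "coact E (x w) B = (\<Sum>i\<in>I \<times> I. pure_tensor (scal E) (hscale H) (x i) (c i w)) B" ..
    qed
  qed
  moreover have "c i j = 0" if "j \<in> I \<times> I" "i \<in> A \<times> C - I \<times> I" for i j
  proof -
    obtain k i' l j' where ij: "i = (k, i')" "j = (l, j')"
      by (cases i; cases j) auto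
    then have *: "i = (k, i')" "j = (l, j')" "l \<in> I" "j' \<in> I" "k \<in> A" "i' \<in> C" "k \<notin> I \<or> i' \<notin> I"
      using that by auto
    then have "a l k = 0 \<or> a i' j' = 0"
      using blockA[of l k] blockC[of j' i'] by auto
    then show ?thesis
      using * linear_map_zero[OF antipode_linear] by (auto simp: c_def)
  qed
  moreover have "finite (A \<times> C)" "I \<times> I \<subseteq> A \<times> C"
    using A C I by auto
  ultimately obtain y where y: "coacts_by H E (A \<times> C) y c" "\<And>j. j \<in> I \<times> I \<Longrightarrow> y j = x j"
    using injective_extend[OF E_injective _ _ c, of "I \<times> I" x] by metis
  have "coact E (y (l, j)) B = (\<Sum>k\<in>A. \<Sum>i\<in>C. B (y (k, i)) (antipode H (a l k) * a i j))"
    if "l \<in> A" "j \<in> C" and B: "bilinear_map (scal E) (hscale H) (*) B" for l j B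
  proof -
    have "coact E (y (l, j)) B = (\<Sum>p\<in>A \<times> C. B (y p) (c p (l, j)))"
      using y(1) that(1,2) by (simp add: coacts_by_def sum_pure_tensor_apply[OF B])
    also have "\<dots> = (\<Sum>k\<in>A. \<Sum>i\<in>C. B (y (k, i)) (c (k, i) (l, j)))"
      by (simp add: sum.cartesian_product case_prod_beta)
    finally show ?thesis
      by (simp add: c_def)
  qed
  moreover have "y (l, j) \<in> car E" if "l \<in> A" "j \<in> C" for l j
    using y(1) that by (auto simp: coacts_by_def)
  moreover have "y (l, j) = (if l = j then u else 0)" if "l \<in> I" "j \<in> I" for l j
    using y(2)[of "(l, j)"] that by (simp add: x_def)
  ultimately show thesis
    by (intro that[of "\<lambda>l j. y (l, j)"]) blast+
qed

text \<open>
  With the extension \<open>y\<close> of the evaluation of \<open>span I\<close> to \<open>(span I)' \<otimes> span J\<close>, each \<open>l\<close> in \<open>I\<close> gives a linear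
  map \<open>Y l\<close> from \<open>span J\<close> to \<open>E\<close>. The common kernel of these maps is a subcomodule that meets \<open>span I\<close> in
  0, so it vanishes and the \<open>Y l\<close> are jointly injective.
\<close>

lemma essential_extension_bound:
  fixes M :: "('k, 'm::ab_group_add, 'h) comod"
  assumes M: "comodule H M" and J: "finite J" "\<not> module.dependent (scal M) J"
    and subJ: "subcomodule H M (module.span (scal M) J)"
    and I: "I \<subseteq> J" "subcomodule H M (module.span (scal M) I)"
    and ess: "\<And>K. subcomodule H M K \<Longrightarrow> K \<inter> module.span (scal M) I = {0} \<Longrightarrow> K = {0}"
    and G: "finite G" "E.V.independent G" "car E \<subseteq> E.V.span G"
  shows "card J \<le> card I * card G"
proof -
  interpret M: right_comodule H M
    using M by (rule right_comoduleI)
  interpret ME: vector_space_pair "scal M" "scal E" ..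
  obtain a where a: "comatrix H J a" "coacts_by H M J (\<lambda>j. j) a"
    "\<forall>A. subcomodule H M (M.V.span A) \<longrightarrow> A \<subseteq> J \<longrightarrow> (\<forall>j\<in>A. \<forall>i\<in>J - A. a i j = 0)"
    by (rule M.comatrix_of_basis[OF J subJ])
  have finI: "finite I"
    using J(1) I(1) by (rule rev_finite_subset)
  have block: "a i j = 0" if "j \<in> I" "i \<in> J - I" for i j
    using a(3) I that by blast
  have aI: "comatrix H I a"
    using comatrix_restrict[OF a(1) J(1) I(1)] block by blast
  obtain y where y: "\<forall>l\<in>I. \<forall>j\<in>J. y l j \<in> car E"
    "\<forall>l\<in>I. \<forall>j\<in>J. \<forall>B. bilinear_map (scal E) (hscale H) (*) B \<longrightarrow>
        coact E (y l j) B = (\<Sum>k\<in>I. \<Sum>i\<in>J. B (y k i) (antipode H (a l k) * a i j))"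
    "\<forall>l\<in>I. \<forall>j\<in>I. y l j = (if l = j then u else 0)"
    by (rule extend_evaluation[OF finI aI J(1) a(1) order_refl I(1)]) (use block in auto)
  note y_car = y(1)[rule_format] and coact_y = y(2)[rule_format] and y_I = y(3)[rule_format]
  have "\<exists>f. Vector_Spaces.linear (scal M) (scal E) f \<and> (\<forall>j\<in>J. f j = y l j)" for l
    using ME.linear_independent_extend[OF J(2)] by blast
  then obtain Y where Y: "\<And>l. Vector_Spaces.linear (scal M) (scal E) (Y l)" "\<And>l j. j \<in> J \<Longrightarrow> Y l j = y l j"
    by metis
  have Y_car: "Y l v \<in> car E" if "l \<in> I" "v \<in> M.V.span J" for l v
  proof -
    interpret Y: Vector_Spaces.linear "scal M" "scal E" "Y l" by (rule Y)
    have "Y l ` M.V.span J \<subseteq> car E"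
      unfolding Y.span_image[symmetric] using that(1) Y(2) y_car
      by (intro E.V.span_minimal E.car_subspace) auto
    then show ?thesis
      using that(2) by blast
  qed
  \<comment> \<open>Multiplying the colinearity of the extended evaluation by \<open>a m l\<close> from the left and summing over \<open>l\<close>
    cancels the antipode. This expresses the coaction of \<open>v\<close>, pushed forward by \<open>Y m\<close>, through the vectors
    \<open>Y l v\<close> alone, and makes their common kernel stable.\<close>
  have key: "coact M v (\<lambda>w h. B (Y m w) h) = (\<Sum>l\<in>I. coact E (Y l v) (\<lambda>x h. B x (a m l * h)))"
    if v: "v \<in> M.V.span J" and m: "m \<in> I" and B: "bilinear_map (scal E) (hscale H) (*) B" for v m B
  proof -
    have B1: "bilinear_map (scal M) (hscale H) (*) (\<lambda>w h. B (Y m w) h)"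
      by (rule bilinear_map_comp[OF B Y(1) linear_ident[OF Hv.vector_space_axioms]])
    have B2: "bilinear_map (scal E) (hscale H) (*) (\<lambda>x h. B x (t * h))" for t
      by (rule bilinear_map_comp[OF B linear_ident[OF E.V.vector_space_axioms] mult_linear(2)])
    let ?D = "\<lambda>v. coact M v (\<lambda>w h. B (Y m w) h) - (\<Sum>l\<in>I. coact E (Y l v) (\<lambda>x h. B x (a m l * h)))"
    have "lform (scal M) ?D"
      using M.V.vector_space_axioms vector_space_field
      by (auto simp: Vector_Spaces.linear_iff linear_map_add[OF M.coact_apply_lform] linear_map_scale[OF M.coact_apply_lform]
          linear_map_add[OF Y(1)] linear_map_scale[OF Y(1)] linear_map_add[OF E.coact_apply_lform] linear_map_scale[OF E.coact_apply_lform]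
          sum.distrib sum_distrib_left algebra_simps)
    then interpret D: Vector_Spaces.linear "scal M" "(*)" ?D .
    have "?D j = 0" if j: "j \<in> J" for j
    proof -
      have "(\<Sum>l\<in>I. coact E (Y l j) (\<lambda>x h. B x (a m l * h))) =
          (\<Sum>l\<in>I. \<Sum>k\<in>I. \<Sum>i\<in>J. B (y k i) (a m l * antipode H (a l k) * a i j))"
        using j by (simp add: Y(2) coact_y[OF _ _ B2] mult.assoc)
      also have "\<dots> = (\<Sum>k\<in>I. \<Sum>l\<in>I. \<Sum>i\<in>J. B (y k i) (a m l * antipode H (a l k) * a i j))"
        by (rule sum.swap)
      also have "\<dots> = (\<Sum>k\<in>I. \<Sum>i\<in>J. \<Sum>l\<in>I. B (y k i) (a m l * antipode H (a l k) * a i j))"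
        by (intro sum.cong refl sum.swap)
      also have "\<dots> = (\<Sum>k\<in>I. if k = m then \<Sum>i\<in>J. B (y k i) (a i j) else 0)"
        using antipode_comatrix(2)[OF aI finI m]
        by (intro sum.cong refl)
          (auto simp: bilinear_map_sum_right[OF B, symmetric] sum_distrib_right[symmetric] bilinear_map_zero_right[OF B])
      also have "\<dots> = (\<Sum>i\<in>J. B (y m i) (a i j))"
        using finI m by simp
      also have "\<dots> = coact M j (\<lambda>w h. B (Y m w) h)"
        using a(2) j Y(2) by (simp add: coacts_by_def sum_pure_tensor_apply[OF B1])
      finally show ?thesis by simp
    qed
    then show ?thesis
      using D.eq_0_on_span[of J v] v by simp
  qed
  define K where "K = {v \<in> M.V.span J. \<forall>l\<in>I. Y l v = 0}"
  have "subcomodule H M K"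
    unfolding M.subcomodule_iff_act
  proof (intro conjI allI impI ballI)
    show "K \<subseteq> car M"
      using M.subcomoduleD(1)[OF subJ] by (auto simp: K_def)
    show "M.V.subspace K"
      by (rule M.V.subspaceI) (auto simp: K_def linear_map_zero[OF Y(1)] linear_map_add[OF Y(1)] linear_map_scale[OF Y(1)]
          M.V.span_zero M.V.span_add M.V.span_scale)
    fix f v assume f: "lform (hscale H) f" and v: "v \<in> K"
    have "Y m (act H M f v) = 0" if m: "m \<in> I" for m
    proof (rule E.V.linear_form_eq_0)
      fix \<phi> assume \<phi>: "lform (scal E) \<phi>"
      have "\<phi> (Y m (act H M f v)) = coact M v (\<lambda>w h. f h * \<phi> (Y m w))"
        by (rule M.form_act[OF f lform_comp[OF Y(1) \<phi>]])
      also have "\<dots> = (\<Sum>l\<in>I. coact E (Y l v) (\<lambda>x h. f (a m l * h) * \<phi> x))"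
        using v by (intro key[OF _ m bilinear_form_prod[OF \<phi> f]]) (simp add: K_def)
      also have "\<dots> = 0"
        using v by (simp add: K_def linear_map_zero[OF E.coact_apply_lform])
      finally show "\<phi> (Y m (act H M f v)) = 0" .
    qed
    then show "act H M f v \<in> K"
      using M.subcomoduleD(3)[OF subJ f] v by (simp add: K_def)
  qed
  moreover have "K \<inter> M.V.span I = {0}"
  proof (intro equalityI subsetI)
    fix v assume v: "v \<in> K \<inter> M.V.span I"
    then obtain r where r: "v = (\<Sum>j\<in>I. scal M (r j) j)"
      using finI by (auto simp: M.V.span_finite)
    have "r l = 0" if l: "l \<in> I" for l
    proof -
      have "Y l v = (\<Sum>j\<in>I. if j = l then scal E (r l) u else 0)"
        unfolding r linear_map_sum[OF Y(1)] linear_map_scale[OF Y(1)]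
        using l I(1) Y(2) y_I by (intro sum.cong) auto
      then have "scal E (r l) u = 0"
        using v l finI by (simp add: K_def)
      then show ?thesis
        using u_nonzero by simp
    qed
    then show "v \<in> {0}"
      by (simp add: r)
  qed (auto simp: K_def linear_map_zero[OF Y(1)] M.V.span_zero)
  ultimately have K: "K = {0}"
    by (rule ess)
  obtain \<phi> where \<phi>: "\<forall>g\<in>G. lform (scal E) (\<phi> g)" "\<forall>x\<in>E.V.span G. x = (\<Sum>g\<in>G. scal E (\<phi> g x) g)"
    by (rule E.V.dual_basis[OF G(1,2)])
  have "finite J \<and> card J \<le> card (I \<times> G)"
  proof (rule independent_bound_forms[where L = "\<lambda>(l, g) v. \<phi> g (Y l v)"])
    show "lform (scal M) (case w of (l, g) \<Rightarrow> \<lambda>v. \<phi> g (Y l v))" if "w \<in> I \<times> G" for w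
      using lform_comp[OF Y(1)] \<phi>(1) that by (cases w) auto
    show "finite (I \<times> G)"
      using finI G(1) by simp
    fix v assume v: "v \<in> M.V.span J" and zero: "\<And>w. w \<in> I \<times> G \<Longrightarrow> (case w of (l, g) \<Rightarrow> \<lambda>v. \<phi> g (Y l v)) v = 0"
    have "Y l v = 0" if l: "l \<in> I" for l
    proof -
      have "Y l v \<in> E.V.span G"
        using Y_car[OF l v] G(3) by blast
      then have "Y l v = (\<Sum>g\<in>G. scal E (\<phi> g (Y l v)) g)"
        using \<phi>(2) by blast
      also have "\<dots> = 0"
        using zero[of "(l, _)"] l by (intro sum.neutral) auto
      finally show ?thesis .
    qed
    then have "v \<in> K"
      using v by (simp add: K_def)
    then show "v = 0"
      using K by simp
  qed (use J M.V.vector_space_axioms in auto)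
  then show ?thesis
    by (simp add: card_cartesian_product)
qed

text \<open>
  The evaluation of the quotient \<open>span J / span N\<close> extends to the dual of \<open>span J\<close>. Its contractions with
  the linear forms that vanish on \<open>V\<close> span a subcomodule \<open>Q V\<close> of \<open>span J\<close>, and \<open>Q\<close> reverses inclusions.
  Where \<open>Q\<close> becomes 0 along the chain \<open>W\<close>, the last nonzero value contains \<open>P\<close>, and it is spanned by as
  many vectors as there are pairs of an index in \<open>J - N\<close> and an element of a basis of the step.
\<close>

lemma socle_bound:
  fixes M :: "('k, 'm::ab_group_add, 'h) comod"
  assumes M: "comodule H M" and J: "finite J" "\<not> module.dependent (scal M) J"
    and subJ: "subcomodule H M (module.span (scal M) J)"
    and N: "N \<subset> J" "subcomodule H M (module.span (scal M) N)"
    and P: "finite P" "\<not> module.dependent (scal M) P"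
    and socle: "\<And>K. subcomodule H M K \<Longrightarrow> K \<noteq> {0} \<Longrightarrow> P \<subseteq> K"
    and W: "W 0 = {0}" "W n = car E" "\<And>i. i \<le> n \<Longrightarrow> subcomodule H E (W i)" "\<And>i. i < n \<Longrightarrow> W i \<subseteq> W (Suc i)"
    and d: "\<And>i. i < n \<Longrightarrow> E.V.dim (W (Suc i)) \<le> E.V.dim (W i) + d"
  shows "card P \<le> card (J - N) * d"
proof -
  interpret M: right_comodule H M
    using M by (rule right_comoduleI)
  define I where "I = J - N"
  have I: "I \<subseteq> J" "finite I" "I \<noteq> {}"
    using N(1) J(1) by (auto simp: I_def)
  obtain a where a: "comatrix H J a" "coacts_by H M J (\<lambda>j. j) a"
    "\<forall>A. subcomodule H M (M.V.span A) \<longrightarrow> A \<subseteq> J \<longrightarrow> (\<forall>j\<in>A. \<forall>i\<in>J - A. a i j = 0)"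
    by (rule M.comatrix_of_basis[OF J subJ])
  have block: "a i j = 0" if "i \<in> I" "j \<in> J - I" for i j
    using a(3)[rule_format, OF N(2), of j i] that N(1) by (auto simp: I_def)
  have aI: "comatrix H I a"
    using comatrix_restrict[OF a(1) J(1) I(1)] block by blast
  obtain y where y: "\<forall>l\<in>J. \<forall>j\<in>I. y l j \<in> car E"
    "\<forall>l\<in>J. \<forall>j\<in>I. \<forall>B. bilinear_map (scal E) (hscale H) (*) B \<longrightarrow>
        coact E (y l j) B = (\<Sum>k\<in>J. \<Sum>i\<in>I. B (y k i) (antipode H (a l k) * a i j))"
    "\<forall>l\<in>I. \<forall>j\<in>I. y l j = (if l = j then u else 0)"
    by (rule extend_evaluation[OF J(1) a(1) I(2) aI I(1) order_refl]) (use block in auto)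
  note y_car = y(1)[rule_format] and coact_y = y(2)[rule_format] and y_I = y(3)[rule_format]
  define q where "q = (\<lambda>\<epsilon> j. \<Sum>l\<in>J. scal M (\<epsilon> (y l j)) l)"
  define Q where "Q = (\<lambda>V. M.V.span {q \<epsilon> j |\<epsilon> j. lform (scal E) \<epsilon> \<and> (\<forall>v\<in>V. \<epsilon> v = 0) \<and> j \<in> I})"
  have q_Q: "q \<epsilon> j \<in> Q V" if "lform (scal E) \<epsilon>" "\<forall>v\<in>V. \<epsilon> v = 0" "j \<in> I" for \<epsilon> j V
    unfolding Q_def using that by (intro M.V.span_base) blast
  have act_j: "act H M f j = (\<Sum>k\<in>J. scal M (f (a k j)) k)" if "lform (hscale H) f" "j \<in> J" for f j
    using a(2) that J(1) by (intro M.act_sum) (auto simp: coacts_by_def)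
  have act_q: "act H M f (q \<epsilon> j) \<in> Q V"
    if f: "lform (hscale H) f" and V: "subcomodule H E V" and \<epsilon>: "lform (scal E) \<epsilon>" "\<forall>v\<in>V. \<epsilon> v = 0" and j: "j \<in> I"
    for f \<epsilon> j V
  proof -
    obtain g where g: "lform (hscale H) g" "\<And>t. g (antipode H t) = f t"
      using form_factors_through_antipode[OF psi_h0 f] by metis
    \<comment> \<open>For a form \<open>f\<close> that factors as \<open>g\<close> after the antipode, multiplying the colinearity of the extended
      evaluation by the antipode of \<open>a i j\<close> from the right cancels the other factor. The action of \<open>f\<close> on a
      contraction with \<open>\<epsilon>\<close> becomes a sum of contractions with forms \<open>\<eta> i\<close>, which vanish on \<open>V\<close> if \<open>\<epsilon>\<close> does.\<close>
    define \<eta> where "\<eta> = (\<lambda>i x. coact E x (\<lambda>x h. g (h * antipode H (a i j)) * \<epsilon> x))"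
    have gm: "lform (hscale H) (\<lambda>h. g (h * t))" for t
      by (rule lform_comp[OF mult_linear(1) g(1)])
    have B: "bilinear_map (scal E) (hscale H) (*) (\<lambda>x h. g (h * t) * \<epsilon> x)" for t
      by (rule bilinear_form_prod[OF \<epsilon>(1) gm])
    have \<eta>: "lform (scal E) (\<eta> i)" for i
      unfolding \<eta>_def by (rule E.coact_apply_lform)
    have \<eta>_V: "\<eta> i v = 0" if v: "v \<in> V" for i v
    proof -
      have "coact E v \<in> tensors (scal E) (hscale H) V"
        using V v by (simp add: E.subcomodule_iff)
      then obtain I' :: "nat set" and z h where "finite I'" "\<forall>s\<in>I'. z s \<in> V"
        "coact E v = (\<Sum>s\<in>I'. pure_tensor (scal E) (hscale H) (z s) (h s))"
        by (rule tensorsE)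
      then show ?thesis
        using \<epsilon>(2) by (simp add: \<eta>_def sum_pure_tensor_apply[OF B])
    qed
    have \<eta>_y: "(\<Sum>i\<in>I. \<eta> i (y k i)) = (\<Sum>l\<in>J. \<epsilon> (y l j) * f (a k l))" if k: "k \<in> J" for k
    proof -
      have "(\<Sum>i\<in>I. \<eta> i (y k i)) =
          (\<Sum>i\<in>I. \<Sum>l\<in>J. \<Sum>m\<in>I. g (antipode H (a k l) * (a m i * antipode H (a i j))) * \<epsilon> (y l m))"
        using k by (simp add: \<eta>_def coact_y[OF _ _ B] mult.assoc)
      also have "\<dots> = (\<Sum>l\<in>J. \<Sum>i\<in>I. \<Sum>m\<in>I. g (antipode H (a k l) * (a m i * antipode H (a i j))) * \<epsilon> (y l m))"
        by (rule sum.swap)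
      also have "\<dots> = (\<Sum>l\<in>J. \<Sum>m\<in>I. \<Sum>i\<in>I. g (antipode H (a k l) * (a m i * antipode H (a i j))) * \<epsilon> (y l m))"
        by (intro sum.cong refl sum.swap)
      also have "\<dots> = (\<Sum>l\<in>J. \<Sum>m\<in>I. g (antipode H (a k l) * (\<Sum>i\<in>I. a m i * antipode H (a i j))) * \<epsilon> (y l m))"
        by (simp add: sum_distrib_left linear_map_sum[OF g(1)] sum_distrib_right)
      also have "\<dots> = (\<Sum>l\<in>J. \<Sum>m\<in>I. if m = j then f (a k l) * \<epsilon> (y l j) else 0)"
        using j by (intro sum.cong refl) (simp add: antipode_comatrix(2)[OF aI I(2)] g(2) linear_map_zero[OF g(1)])
      also have "\<dots> = (\<Sum>l\<in>J. \<epsilon> (y l j) * f (a k l))"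
        using I(2) j by (simp add: mult.commute)
      finally show ?thesis .
    qed
    have "act H M f (q \<epsilon> j) = (\<Sum>l\<in>J. \<Sum>k\<in>J. scal M (\<epsilon> (y l j) * f (a k l)) k)"
      using f by (simp add: q_def linear_map_sum[OF M.act_linear[OF f]] linear_map_scale[OF M.act_linear[OF f]] act_j M.V.scale_sum_right)
    also have "\<dots> = (\<Sum>k\<in>J. \<Sum>l\<in>J. scal M (\<epsilon> (y l j) * f (a k l)) k)"
      by (rule sum.swap)
    also have "\<dots> = (\<Sum>k\<in>J. \<Sum>i\<in>I. scal M (\<eta> i (y k i)) k)"
      by (simp add: M.V.scale_sum_left[symmetric] \<eta>_y)
    also have "\<dots> = (\<Sum>i\<in>I. q (\<eta> i) i)"
      unfolding q_def by (rule sum.swap)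
    also have "\<dots> \<in> Q V"
      using q_Q[OF \<eta>] \<eta>_V unfolding Q_def by (intro M.V.span_sum) blast
    finally show ?thesis .
  qed
  have J_car: "j \<in> car M" if "j \<in> J" for j
    using M.subcomoduleD(1)[OF subJ] M.V.span_base[OF that] by blast
  have Q_sub: "subcomodule H M (Q V)" if V: "subcomodule H E V" for V
    unfolding M.subcomodule_iff_act
  proof (intro conjI allI impI ballI)
    show "Q V \<subseteq> car M"
      unfolding Q_def q_def using J_car
      by (intro M.V.span_minimal M.car_subspace) (auto intro!: M.V.subspace_sum[OF M.car_subspace] M.V.subspace_scale[OF M.car_subspace])
    show "M.V.subspace (Q V)"
      by (simp add: Q_def)
    fix f x assume f: "lform (hscale H) f" and x: "x \<in> Q V"
    interpret A: Vector_Spaces.linear "scal M" "scal M" "act H M f"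
      by (rule M.act_linear[OF f])
    have "act H M f ` Q V \<subseteq> Q V"
      unfolding Q_def A.span_image[symmetric]
      by (intro M.V.span_minimal M.V.subspace_span) (use act_q[OF f V] in \<open>auto simp: Q_def\<close>)
    then show "act H M f x \<in> Q V"
      using x by blast
  qed
  have "Q (W 0) \<noteq> {0}"
  proof
    assume zero: "Q (W 0) = {0}"
    obtain j where j: "j \<in> I"
      using I(3) by blast
    obtain \<theta> where \<theta>: "lform (scal E) \<theta>" "\<theta> u = 1"
      by (rule form_at_u)
    have "q \<theta> j \<in> Q (W 0)"
      using W(1) linear_map_zero[OF \<theta>(1)] by (intro q_Q[OF \<theta>(1) _ j]) simp
    then have "(\<Sum>l\<in>J. scal M (\<theta> (y l j)) l) = 0"
      using zero by (simp add: q_def)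
    then have "\<theta> (y j j) = 0"
      using M.V.independentD[OF J(2,1) order_refl, of "\<lambda>l. \<theta> (y l j)" j] j I(1) by blast
    then show False
      using y_I[OF j j] \<theta>(2) by simp
  qed
  moreover have "Q (W n) = {0}"
  proof -
    have "{q \<epsilon> j |\<epsilon> j. lform (scal E) \<epsilon> \<and> (\<forall>v\<in>car E. \<epsilon> v = 0) \<and> j \<in> I} \<subseteq> {0}"
      using y_car by (auto simp: q_def)
    then have "Q (W n) \<subseteq> M.V.span {0}"
      unfolding Q_def W(2) by (rule M.V.span_mono)
    then show ?thesis
      using M.V.span_zero by (auto simp: Q_def)
  qed
  ultimately obtain i where i: "i < n" "Q (W i) \<noteq> {0}" "Q (W (Suc i)) = {0}"
    using ex_least_nat_less[of "\<lambda>i. Q (W i) = {0}" n] by blast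
  have Wi: "E.V.subspace (W i)" "E.V.subspace (W (Suc i))" "W (Suc i) \<subseteq> car E"
    using E.subcomoduleD(1,2)[OF W(3)] i(1) by auto
  obtain F where F: "finite F" "car E \<subseteq> E.V.span F"
    using finite_dimensional by blast
  obtain A where A: "finite A" "E.V.independent A" "E.V.span A = W i" "card A = E.V.dim (W i)"
  proof (rule E.V.subspace_basis[OF Wi(1) _ F(1) empty_subsetI E.V.independent_empty])
    show "W i \<subseteq> E.V.span F"
      using W(4)[OF i(1)] Wi(3) F(2) by blast
  qed
  have AW: "A \<subseteq> W (Suc i)"
    using A(3) E.V.span_superset W(4)[OF i(1)] by blast
  obtain B where B: "A \<subseteq> B" "finite B" "E.V.independent B" "E.V.span B = W (Suc i)" "card B = E.V.dim (W (Suc i))"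
  proof (rule E.V.subspace_basis[OF Wi(2) _ F(1) AW A(2)])
    show "W (Suc i) \<subseteq> E.V.span F"
      using Wi(3) F(2) by blast
  qed
  obtain \<phi> where \<phi>: "\<forall>b\<in>B. lform (scal E) (\<phi> b)" "\<forall>x\<in>E.V.span B. x = (\<Sum>b\<in>B. scal E (\<phi> b x) b)"
    by (rule E.V.dual_basis[OF B(2,3)])
  define G where "G = B - A"
  have G: "finite G" "card G \<le> d"
    using A B d[OF i(1)] by (auto simp: G_def card_Diff_subset)
  have "q \<epsilon> j \<in> M.V.span ((\<lambda>(g, j). q (\<phi> g) j) ` (G \<times> I))"
    if \<epsilon>: "lform (scal E) \<epsilon>" "\<forall>v\<in>W i. \<epsilon> v = 0" and j: "j \<in> I" for \<epsilon> j
  proof -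
    \<comment> \<open>Subtracting multiples of the coordinate forms \<open>\<phi> g\<close> turns \<open>\<epsilon>\<close> into a form that vanishes on \<open>W (Suc i)\<close>,
      and the contraction with it is 0.\<close>
    define \<eta> where "\<eta> = (\<lambda>x. \<epsilon> x - (\<Sum>g\<in>G. \<epsilon> g * \<phi> g x))"
    have "lform (scal E) \<eta>"
      unfolding \<eta>_def using \<phi>(1) \<epsilon>(1) E.V.vector_space_axioms vector_space_field
      by (auto simp: Vector_Spaces.linear_iff G_def algebra_simps sum.distrib sum_distrib_left)
    moreover have "\<eta> v = 0" if v: "v \<in> W (Suc i)" for v
    proof -
      have "\<epsilon> v = \<epsilon> (\<Sum>b\<in>B. scal E (\<phi> b v) b)"
        using \<phi>(2) B(4) v by auto
      also have "\<dots> = (\<Sum>b\<in>B. \<phi> b v * \<epsilon> b)"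
        by (simp add: linear_map_sum[OF \<epsilon>(1)] linear_map_scale[OF \<epsilon>(1)])
      also have "\<dots> = (\<Sum>b\<in>G. \<phi> b v * \<epsilon> b)"
        unfolding G_def using B(1,2) \<epsilon>(2) A(3) E.V.span_base
        by (intro sum.mono_neutral_right) auto
      finally show ?thesis
        by (simp add: \<eta>_def mult.commute)
    qed
    ultimately have "q \<eta> j \<in> Q (W (Suc i))"
      using j by (intro q_Q) auto
    then have "q \<eta> j = 0"
      using i(3) by simp
    moreover have "q \<eta> j = q \<epsilon> j - (\<Sum>g\<in>G. scal M (\<epsilon> g) (q (\<phi> g) j))"
    proof -
      have "(\<Sum>g\<in>G. scal M (\<epsilon> g) (q (\<phi> g) j)) = (\<Sum>g\<in>G. \<Sum>l\<in>J. scal M (\<epsilon> g * \<phi> g (y l j)) l)"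
        by (simp add: q_def M.V.scale_sum_right)
      also have "\<dots> = (\<Sum>l\<in>J. \<Sum>g\<in>G. scal M (\<epsilon> g * \<phi> g (y l j)) l)"
        by (rule sum.swap)
      finally show ?thesis
        by (simp add: q_def \<eta>_def M.V.scale_left_diff_distrib sum_subtractf M.V.scale_sum_left)
    qed
    ultimately have "q \<epsilon> j = (\<Sum>g\<in>G. scal M (\<epsilon> g) (q (\<phi> g) j))"
      by simp
    also have "\<dots> \<in> M.V.span ((\<lambda>(g, j). q (\<phi> g) j) ` (G \<times> I))"
      using j by (intro M.V.span_sum M.V.span_scale M.V.span_base) force
    finally show ?thesis .
  qed
  then have "Q (W i) \<subseteq> M.V.span ((\<lambda>(g, j). q (\<phi> g) j) ` (G \<times> I))"
    unfolding Q_def by (intro M.V.span_minimal) auto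
  moreover have "P \<subseteq> Q (W i)"
    using i(1) by (intro socle[OF Q_sub[OF W(3)] i(2)]) simp
  ultimately have PG: "P \<subseteq> M.V.span ((\<lambda>(g, j). q (\<phi> g) j) ` (G \<times> I))"
    by blast
  have "finite ((\<lambda>(g, j). q (\<phi> g) j) ` (G \<times> I))"
    using G(1) I(2) by simp
  from M.V.independent_span_bound[OF this P(2) PG]
  have "card P \<le> card ((\<lambda>(g, j). q (\<phi> g) j) ` (G \<times> I))"
    by simp
  also have "\<dots> \<le> card G * card I"
    using card_image_le[of "G \<times> I"] G(1) I(2) by (simp add: card_cartesian_product)
  also have "\<dots> \<le> card (J - N) * d"
    using G(2) by (simp add: I_def mult.commute)
  finally show ?thesis .
qed

end

section \<open>Composition series\<close>

lemma (in hopf_alg) hom_act: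
  assumes M: "comodule H M" and N: "comodule H N" and \<pi>: "comodule_hom H M N \<pi>"
    and f: "lform (hscale H) f" and x: "x \<in> car M"
  shows "act H N f (\<pi> x) = \<pi> (act H M f x)"
proof -
  interpret M: right_comodule H M using M by (rule right_comoduleI)
  interpret N: right_comodule H N using N by (rule right_comoduleI)
  have lin: "Vector_Spaces.linear (scal M) (scal N) \<pi>"
    using \<pi> by (simp add: comodule_hom_def)
  show ?thesis
  proof (rule linear_form_separates[OF N.V.vector_space_axioms])
    fix \<phi> assume \<phi>: "lform (scal N) \<phi>"
    have "\<phi> (act H N f (\<pi> x)) = coact M x (\<lambda>m h. f h * \<phi> (\<pi> m))"
      using \<pi> x bilinear_form_prod[OF \<phi> f] by (simp add: N.form_act[OF f \<phi>] comodule_hom_def)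
    then show "\<phi> (act H N f (\<pi> x)) = \<phi> (\<pi> (act H M f x))"
      by (simp add: M.form_act[OF f lform_comp[OF lin \<phi>]])
  qed
qed

context right_comodule
begin

text \<open>
  The quotient lives on the image of a projection \<open>\<pi>\<close> with kernel \<open>W\<close>, with the coaction of \<open>M\<close> followed by
  \<open>\<pi>\<close> on the left legs. It is simple because the preimage of a subcomodule lies between \<open>W\<close> and \<open>V\<close>.
\<close>

lemma simple_quotient_exists:
  assumes W: "subcomodule H M W" and V: "subcomodule H M V" and "W \<subset> V"
    and max: "\<And>U. \<lbrakk>subcomodule H M U; W \<subseteq> U; U \<subseteq> V\<rbrakk> \<Longrightarrow> U = W \<or> U = V"
  obtains T :: "('k, 'm, 'h) comod" where "simple_comodule H T" "is_quotient H (M\<lparr>car := V\<rparr>) W T"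
proof -
  obtain \<pi> where \<pi>: "Vector_Spaces.linear (scal M) (scal M) \<pi>" "\<And>x. \<pi> x = 0 \<longleftrightarrow> x \<in> W" "\<And>x. x - \<pi> x \<in> W"
    using V.projection_along[OF subcomoduleD(2)[OF W]] by metis
  interpret \<pi>: Vector_Spaces.linear "scal M" "scal M" \<pi> by (rule \<pi>(1))
  have \<pi>_idem: "\<pi> (\<pi> x) = \<pi> x" for x
    using \<pi>(2)[of "x - \<pi> x"] \<pi>(3)[of x] by (simp add: \<pi>.diff)
  have \<pi>_V: "\<pi> v \<in> V" if "v \<in> V" for v
  proof -
    have "v - (v - \<pi> v) \<in> V"
      using that \<pi>(3)[of v] \<open>W \<subset> V\<close> V.subspace_diff[OF subcomoduleD(2)[OF V]] by blast
    then show ?thesis by simp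
  qed
  define \<rho> where "\<rho> = (\<lambda>x B. if bilinear_map (scal M) (hscale H) (*) B then coact M x (\<lambda>m h. B (\<pi> m) h) else 0)"
  have B\<pi>: "bilinear_map (scal M) (hscale H) (*) (\<lambda>m h. B (\<pi> m) h)" if "bilinear_map (scal M) (hscale H) (*) B" for B
    by (rule bilinear_map_comp[OF that \<pi>(1) linear_ident[OF Hv.vector_space_axioms]])
  have \<rho>_sum: "\<rho> x = (\<Sum>i\<in>I. pure_tensor (scal M) (hscale H) (\<pi> (u i)) (h i))"
    if "coact M x = (\<Sum>i\<in>I. pure_tensor (scal M) (hscale H) (u i) (h i))" for x u h and I :: "nat set"
  proof
    fix B
    show "\<rho> x B = (\<Sum>i\<in>I. pure_tensor (scal M) (hscale H) (\<pi> (u i)) (h i)) B"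
    proof (cases "bilinear_map (scal M) (hscale H) (*) B")
      case True
      then have "\<rho> x B = coact M x (\<lambda>m h. B (\<pi> m) h)"
        by (simp add: \<rho>_def)
      also have "\<dots> = (\<Sum>i\<in>I. B (\<pi> (u i)) (h i))"
        unfolding that by (rule sum_pure_tensor_apply[OF B\<pi>[OF True]])
      also have "\<dots> = (\<Sum>i\<in>I. pure_tensor (scal M) (hscale H) (\<pi> (u i)) (h i)) B"
        by (rule sum_pure_tensor_apply[OF True, symmetric])
      finally show ?thesis .
    next
      case False
      then show ?thesis
        by (simp add: \<rho>_def sum_fun_apply pure_tensor_def)
    qed
  qed
  have \<rho>_tensor: "\<rho> x \<in> tensors (scal M) (hscale H) (\<pi> ` U)" if U: "coact M x \<in> tensors (scal M) (hscale H) U" for x U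
  proof -
    obtain I :: "nat set" and u h where I: "finite I" "\<forall>i\<in>I. u i \<in> U"
      "coact M x = (\<Sum>i\<in>I. pure_tensor (scal M) (hscale H) (u i) (h i))"
      by (rule tensorsE[OF U])
    show ?thesis
      unfolding \<rho>_sum[OF I(3)] using I(1,2) by (intro sum_pure_tensor_in_tensors) auto
  qed
  have \<rho>_UNIV: "\<rho> x \<in> tensors (scal M) (hscale H) UNIV" for x
  proof -
    obtain I :: "nat set" and u h where I: "finite I" "\<forall>i\<in>I. u i \<in> UNIV"
      "coact M x = (\<Sum>i\<in>I. pure_tensor (scal M) (hscale H) (u i) (h i))"
      by (rule tensorsE[OF coact_tensor])
    show ?thesis
      unfolding \<rho>_sum[OF I(3)] using I(1) by (intro sum_pure_tensor_in_tensors) auto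
  qed
  have \<rho>_linear: "Vector_Spaces.linear (scal M) fun_scale \<rho>"
    unfolding Vector_Spaces.linear_iff using V.vector_space_axioms vector_space_fun_scale
    by (auto simp: \<rho>_def fun_eq_iff fun_scale_def linear_map_add[OF coact_linear] linear_map_scale[OF coact_linear])
  have \<rho>_\<pi>: "\<rho> (\<pi> n) B = coact M n (\<lambda>m h. B (\<pi> m) h)" if B: "bilinear_map (scal M) (hscale H) (*) B" for n B
  proof -
    have "coact M (n - \<pi> n) \<in> tensors (scal M) (hscale H) W"
      using W \<pi>(3)[of n] by (simp add: subcomodule_iff)
    then obtain I :: "nat set" and u h where I: "finite I" "\<forall>i\<in>I. u i \<in> W"
      "coact M (n - \<pi> n) = (\<Sum>i\<in>I. pure_tensor (scal M) (hscale H) (u i) (h i))"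
      by (rule tensorsE)
    have "coact M (n - \<pi> n) (\<lambda>m h. B (\<pi> m) h) = (\<Sum>i\<in>I. B (\<pi> (u i)) (h i))"
      unfolding I(3) by (rule sum_pure_tensor_apply[OF B\<pi>[OF B]])
    also have "\<dots> = 0"
      using I(2) \<pi>(2) bilinear_map_zero_left[OF B] by (intro sum.neutral ballI) metis
    finally show ?thesis
      using B by (simp add: \<rho>_def linear_map_diff[OF coact_apply_lform])
  qed
  define T where "T = \<lparr>car = \<pi> ` V, scal = scal M, coact = \<rho>\<rparr>"
  have T: "car T = \<pi> ` V" "scal T = scal M" "coact T = \<rho>"
    by (simp_all add: T_def)
  have TV: "\<pi> ` V \<subseteq> V"
    using \<pi>_V by blast
  have coactV: "coact M x \<in> tensors (scal M) (hscale H) V" if "x \<in> V" for x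
    using V that by (simp add: subcomodule_iff)
  have comod_T: "comodule H T"
    unfolding comodule_def T
  proof (intro conjI ballI allI impI \<rho>_linear \<rho>_UNIV)
    show "V.subspace (\<pi> ` V)"
      by (rule \<pi>.subspace_image[OF subcomoduleD(2)[OF V]])
    show "\<rho> x \<in> tensors (scal M) (hscale H) (\<pi> ` V)" if "x \<in> \<pi> ` V" for x
      using that TV by (intro \<rho>_tensor coactV) blast
  next
    fix x t
    assume x: "x \<in> \<pi> ` V" and t: "trilinear_form (scal M) (hscale H) (hscale H) t"
    have xV: "x \<in> V"
      using x TV by blast
    obtain I :: "nat set" and u h where I: "finite I" "\<forall>i\<in>I. u i \<in> V"
      "coact M x = (\<Sum>i\<in>I. pure_tensor (scal M) (hscale H) (u i) (h i))"
      by (rule tensorsE[OF coactV[OF xV]])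
    have t\<pi>: "trilinear_form (scal M) (hscale H) (hscale H) (\<lambda>n. t (\<pi> n))"
      using t \<pi>(1) by (auto simp: trilinear_form_def Vector_Spaces.linear_iff)
    have t1: "bilinear_map (scal M) (hscale H) (*) (\<lambda>n h'. t n h' h)" for h
      using t by (auto simp: trilinear_form_def bilinear_map_def)
    have B1: "bilinear_map (scal M) (hscale H) (*) (\<lambda>n h. \<rho> n (\<lambda>n' h'. t n' h' h))"
      by (rule bilinear_nested_left[OF \<rho>_linear \<rho>_UNIV t V.vector_space_axioms Hv.vector_space_axioms Hv.vector_space_axioms])
    have B2: "bilinear_map (scal M) (hscale H) (*) (\<lambda>n h. comult H h (t n))"
      by (rule bilinear_nested_right[OF comult_linear comult_tensor t Hv.vector_space_axioms Hv.vector_space_axioms V.vector_space_axioms])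
    have "\<rho> x (\<lambda>n h. \<rho> n (\<lambda>n' h'. t n' h' h)) = (\<Sum>i\<in>I. coact M (u i) (\<lambda>n' h'. t (\<pi> n') h' (h i)))"
      unfolding \<rho>_sum[OF I(3)] sum_pure_tensor_apply[OF B1] \<rho>_\<pi>[OF t1] ..
    also have "\<dots> = (\<Sum>i\<in>I. comult H (h i) (t (\<pi> (u i))))"
      using coassoc_sum[OF _ I(1,3) t\<pi>] xV subcomoduleD(1)[OF V] by blast
    also have "\<dots> = \<rho> x (\<lambda>n h. comult H h (t n))"
      unfolding \<rho>_sum[OF I(3)] sum_pure_tensor_apply[OF B2] ..
    finally show "\<rho> x (\<lambda>n h. \<rho> n (\<lambda>n' h'. t n' h' h)) = \<rho> x (\<lambda>n h. comult H h (\<lambda>h1 h2. t n h1 h2))" .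
  next
    fix x assume x: "x \<in> \<pi> ` V"
    then have xV: "x \<in> car M"
      using TV subcomoduleD(1)[OF V] by blast
    obtain I :: "nat set" and u h where I: "finite I" "\<forall>i\<in>I. u i \<in> UNIV"
      "coact M x = (\<Sum>i\<in>I. pure_tensor (scal M) (hscale H) (u i) (h i))"
      by (rule tensorsE[OF coact_tensor])
    have "tensor_lift (scal M) (hscale H) (\<lambda>n h. scal M (counit H h) n) (\<rho> x) = (\<Sum>i\<in>I. scal M (counit H (h i)) (\<pi> (u i)))"
      unfolding \<rho>_sum[OF I(3)] by (rule tensor_lift_sum_finite[OF act_bilinear[OF counit_linear] I(1)])
    also have "\<dots> = \<pi> (act H M (counit H) x)"
      unfolding act_sum[OF counit_linear I(1,3)] by (simp add: \<pi>.sum \<pi>.scale)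
    also have "\<dots> = x"
      using x by (auto simp: act_counit[OF xV] \<pi>_idem)
    finally show "tensor_lift (scal M) (hscale H) (\<lambda>n h. scal M (counit H h) n) (\<rho> x) = x" .
  qed
  have hom: "comodule_hom H (M\<lparr>car := V\<rparr>) T \<pi>"
    using \<pi>(1) \<rho>_\<pi> by (simp add: comodule_hom_def T)
  have "{m \<in> V. \<pi> m = 0} = W"
    using \<pi>(2) \<open>W \<subset> V\<close> by auto
  then have quot: "is_quotient H (M\<lparr>car := V\<rparr>) W T"
    unfolding is_quotient_def using comod_T hom by (intro conjI exI[of _ \<pi>]) (simp_all add: T)
  interpret T: right_comodule H T
    using comod_T by (rule right_comoduleI)
  have act_\<pi>: "act H T f (\<pi> v) = \<pi> (act H M f v)" if "lform (hscale H) f" "v \<in> V" for f v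
    using hom_act[OF subcomoduleD(4)[OF V] comod_T hom that(1)] that(2) by (simp add: act_def)
  have "R = {0} \<or> R = car T" if R: "subcomodule H T R" for R
  proof -
    let ?U = "{v \<in> V. \<pi> v \<in> R}"
    have R': "R \<subseteq> \<pi> ` V" "V.subspace R" "\<And>f x. lform (hscale H) f \<Longrightarrow> x \<in> R \<Longrightarrow> act H T f x \<in> R"
      using T.subcomoduleD[OF R] by (simp_all add: T)
    have "subcomodule H M ?U"
      unfolding subcomodule_iff_act
    proof (intro conjI allI impI ballI)
      show "?U \<subseteq> car M"
        using subcomoduleD(1)[OF V] by blast
      show "V.subspace ?U"
        using V.subspace_inter[OF subcomoduleD(2)[OF V] \<pi>.subspace_linear_preimage[OF R'(2)]] by (simp add: Int_def)
      fix f v assume f: "lform (hscale H) f" and "v \<in> ?U"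
      then show "act H M f v \<in> ?U"
        using subcomoduleD(3)[OF V f] R'(3)[OF f, of "\<pi> v"] act_\<pi>[OF f] by simp
    qed
    moreover have "W \<subseteq> ?U"
    proof
      fix w assume "w \<in> W"
      then have "\<pi> w = 0" "w \<in> V"
        using \<pi>(2) \<open>W \<subset> V\<close> by blast+
      then show "w \<in> ?U"
        using V.subspace_0[OF R'(2)] by simp
    qed
    ultimately have "?U = W \<or> ?U = V"
      by (intro max) auto
    then show ?thesis
    proof
      assume "?U = W"
      then have "R \<subseteq> {0}"
        using R'(1) \<pi>(2) by blast
      then show ?thesis
        using V.subspace_0[OF R'(2)] by blast
    next
      assume "?U = V"
      then show ?thesis
        using R'(1) unfolding T(1) by blast
    qed
  qed
  moreover have "car T \<noteq> {0}"
    using \<open>W \<subset> V\<close> \<pi>(2) by (auto simp: T)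
  ultimately have "simple_comodule H T"
    using comod_T by (simp add: simple_comodule_def)
  then show thesis
    using quot by (rule that)
qed

text \<open>
  Below \<open>V\<close>, a proper subcomodule of the largest possible dimension leaves no room in between, so
  induction on the dimension applies.
\<close>

lemma subcomodule_chain_exists:
  assumes F: "finite F" "car M \<subseteq> V.span F" and V: "subcomodule H M V"
  shows "\<exists>n W. W 0 = {0} \<and> W n = V \<and> (\<forall>i\<le>n. subcomodule H M (W i)) \<and>
    (\<forall>i<n. W i \<subset> W (Suc i) \<and> (\<forall>U. subcomodule H M U \<longrightarrow> W i \<subseteq> U \<longrightarrow> U \<subseteq> W (Suc i) \<longrightarrow> U = W i \<or> U = W (Suc i)))"
  using V
proof (induction "V.dim V" arbitrary: V rule: less_induct)
  case less
  have span: "U \<subseteq> V.span F" if "subcomodule H M U" for U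
    using subcomoduleD(1)[OF that] F(2) by blast
  have dim_less: "V.dim U < V.dim U'" if "subcomodule H M U" "subcomodule H M U'" "U \<subset> U'" for U U'
    using V.dim_strict_mono_finite[OF _ _ that(3) span F(1)] subcomoduleD(2) that by blast
  show ?case
  proof (cases "V = {0}")
    case True
    then show ?thesis
      using subcomodule_0 by (intro exI[of _ 0] exI[of _ "\<lambda>_. {0}"]) auto
  next
    case False
    let ?P = "\<lambda>U. subcomodule H M U \<and> U \<subset> V"
    have "?P {0}"
      using False subcomodule_0 V.subspace_0[OF subcomoduleD(2)[OF less.prems]] by blast
    moreover have "\<forall>U. ?P U \<longrightarrow> V.dim U < V.dim V"
      using dim_less less.prems by blast
    ultimately obtain U where U: "?P U" "\<And>U'. ?P U' \<Longrightarrow> V.dim U' \<le> V.dim U"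
      using ex_has_greatest_nat[of ?P "{0}" V.dim "V.dim V"] by blast
    have max: "U' = U \<or> U' = V" if "subcomodule H M U'" "U \<subseteq> U'" "U' \<subseteq> V" for U'
      using U(2)[of U'] dim_less[of U U'] U(1) that by (metis leD psubsetI)
    obtain n W where W: "W 0 = {0}" "W n = U" "\<forall>i\<le>n. subcomodule H M (W i)"
      "\<forall>i<n. W i \<subset> W (Suc i) \<and> (\<forall>U. subcomodule H M U \<longrightarrow> W i \<subseteq> U \<longrightarrow> U \<subseteq> W (Suc i) \<longrightarrow> U = W i \<or> U = W (Suc i))"
      using less.hyps[OF dim_less] U(1) less.prems by metis
    define W' where "W' = (\<lambda>i. if i \<le> n then W i else V)"
    have "W' (Suc n) = V" "W' 0 = {0}"
      using W(1) by (simp_all add: W'_def)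
    moreover have "\<forall>i\<le>Suc n. subcomodule H M (W' i)"
      using W(3) less.prems by (simp add: W'_def)
    moreover have "W' i \<subset> W' (Suc i) \<and> (\<forall>U. subcomodule H M U \<longrightarrow> W' i \<subseteq> U \<longrightarrow> U \<subseteq> W' (Suc i) \<longrightarrow> U = W' i \<or> U = W' (Suc i))"
      if "i < Suc n" for i
    proof (cases "i < n")
      case True
      then show ?thesis
        using W(4) by (simp add: W'_def)
    next
      case False
      then have "i = n" using that by simp
      then show ?thesis
        using U(1) max W(2) by (simp add: W'_def)
    qed
    ultimately show ?thesis
      by blast
  qed
qed

lemma composition_series_exists:
  assumes F: "finite F" "car M \<subseteq> V.span F"
  obtains n W where "composition_series H M n W" "\<forall>i<n. W i \<subset> W (Suc i)"
proof -
  obtain n W where W: "W 0 = {0}" "W n = car M" "\<forall>i\<le>n. subcomodule H M (W i)"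
    "\<forall>i<n. W i \<subset> W (Suc i) \<and> (\<forall>U. subcomodule H M U \<longrightarrow> W i \<subseteq> U \<longrightarrow> U \<subseteq> W (Suc i) \<longrightarrow> U = W i \<or> U = W (Suc i))"
    using subcomodule_chain_exists[OF F subcomodule_car] by metis
  have "\<exists>T. simple_comodule H T \<and> is_quotient H (M\<lparr>car := W (Suc i)\<rparr>) (W i) T" if i: "i < n" for i
  proof -
    have "subcomodule H M (W i)" "subcomodule H M (W (Suc i))"
      using W(3) i by auto
    from simple_quotient_exists[OF this] show ?thesis
      using W(4) i by metis
  qed
  then have "composition_series H M n W"
    unfolding composition_series_def using W by blast
  then show thesis
    using that W(4) by blast
qed

lemma quotient_dim:
  assumes "is_quotient H (M\<lparr>car := V\<rparr>) W T" and V: "subcomodule H M V" and F: "V \<subseteq> V.span F" "finite F"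
  shows "comod_dim T + V.dim W = V.dim V"
proof -
  obtain \<pi> where \<pi>: "Vector_Spaces.linear (scal M) (scal T) \<pi>" "\<pi> ` V = car T" "{m \<in> V. \<pi> m = 0} = W"
    using assms(1) by (auto simp: is_quotient_def comodule_hom_def)
  show ?thesis
    using dim_image_kernel[OF \<pi>(1) subcomoduleD(2)[OF V] F] by (simp add: comod_dim_def \<pi>(2,3))
qed

end

section \<open>The bound\<close>

theorem theorem1p2:
  fixes H :: "('k::field, 'h::ring_1) hopf"
    and S :: "('k, 's::ab_group_add, 'h) comod"
    and ES :: "('k, 'e::ab_group_add, 'h) comod"
    and Ek :: "('k, 'f::ab_group_add, 'h) comod"
  assumes "hopf_algebra H" and "co_Frobenius H"
    and "simple_comodule H S"
    and "injective_hull H S ES"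
    and "injective_hull H (trivial_comodule H) Ek"
    and "d = Max {comod_dim T |T. composition_factor H Ek T}"
  shows "comp_length H ES \<le> enat (d * comod_dim Ek)"
proof -
  interpret hopf_alg H
    by unfold_locales (rule assms(1))
  obtain \<psi> h0 where \<psi>: "integral_on H \<psi>" "\<psi> h0 \<noteq> 0"
    using assms(2) by (auto simp: co_Frobenius_def)
  interpret Ek: right_comodule H Ek
    using assms(5) by (intro right_comoduleI) (simp add: injective_hull_def injective_comodule_def)
  interpret ES: right_comodule H ES
    using assms(4) by (intro right_comoduleI) (simp add: injective_hull_def injective_comodule_def)
  interpret S: right_comodule H S
    using assms(3) by (intro right_comoduleI) (simp add: simple_comodule_def)

  obtain \<kappa> where \<kappa>: "comodule_hom H (trivial_comodule H) Ek \<kappa>" "inj_on \<kappa> (car (trivial_comodule H))"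
    "\<And>W. subcomodule H Ek W \<Longrightarrow> W \<inter> \<kappa> ` car (trivial_comodule H) = {0} \<Longrightarrow> W = {0}"
    using assms(5) unfolding injective_hull_def by blast
  have \<kappa>_linear: "Vector_Spaces.linear (*) (scal Ek) \<kappa>"
    using \<kappa>(1) by (simp add: comodule_hom_def trivial_comodule_def)
  have \<kappa>_scale: "\<kappa> c = scal Ek c (\<kappa> 1)" for c
    using linear_map_scale[OF \<kappa>_linear, of c 1] by simp
  interpret unit_hull H \<psi> Ek "\<kappa> 1" h0
  proof unfold_locales
    show "integral_on H \<psi>" "\<psi> h0 \<noteq> 0"
      by (fact \<psi>)+
    show "injective_comodule H Ek"
      using assms(5) by (simp add: injective_hull_def)
    show "\<kappa> 1 \<in> car Ek"
      using \<kappa>(1) by (auto simp: comodule_hom_def trivial_comodule_def)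
    show "\<kappa> 1 \<noteq> 0"
      using \<kappa>(2) linear_map_zero[OF \<kappa>_linear] inj_onD[OF \<kappa>(2), of 1 0] by (auto simp: trivial_comodule_def)
    show "coact Ek (\<kappa> 1) = pure_tensor (scal Ek) (hscale H) (\<kappa> 1) 1"
    proof (rule tensors_eqI[OF Ek.coact_tensor])
      show "pure_tensor (scal Ek) (hscale H) (\<kappa> 1) 1 \<in> tensors (scal Ek) (hscale H) UNIV"
        using sum_pure_tensor_in_tensors[of "{0::nat}" "\<lambda>_. \<kappa> 1" UNIV "scal Ek" "hscale H" "\<lambda>_. 1"] by simp
      fix B assume B: "bilinear_map (scal Ek) (hscale H) (*) B"
      have "bilinear_map (*) (hscale H) (*) (\<lambda>m h. B (\<kappa> m) h)"
        by (rule bilinear_map_comp[OF B \<kappa>_linear linear_ident[OF Hv.vector_space_axioms]])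
      then show "coact Ek (\<kappa> 1) B = pure_tensor (scal Ek) (hscale H) (\<kappa> 1) 1 B"
        using \<kappa>(1) B by (simp add: comodule_hom_def trivial_comodule_def pure_tensor_def)
    qed
    fix W assume W: "subcomodule H Ek W" "\<kappa> 1 \<notin> W"
    have "c = 0" if "\<kappa> c \<in> W" for c
    proof (rule ccontr)
      assume "c \<noteq> 0"
      then have "\<kappa> 1 = scal Ek (inverse c) (\<kappa> c)"
        using \<kappa>_scale[of c] by simp
      then show False
        using Ek.V.subspace_scale[OF Ek.subcomoduleD(2)[OF W(1)] that] W(2) by metis
    qed
    then have "W \<inter> range \<kappa> = {0}"
      using linear_map_zero[OF \<kappa>_linear] Ek.V.subspace_0[OF Ek.subcomoduleD(2)[OF W(1)]] by force
    then show "W = {0}"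
      using \<kappa>(3)[OF W(1)] by (simp add: trivial_comodule_def)
  qed

  obtain \<iota> where \<iota>: "comodule_hom H S ES \<iota>" "inj_on \<iota> (car S)"
    "\<And>W. subcomodule H ES W \<Longrightarrow> W \<inter> \<iota> ` car S = {0} \<Longrightarrow> W = {0}"
    using assms(4) unfolding injective_hull_def by blast
  have \<iota>_linear: "Vector_Spaces.linear (scal S) (scal ES) \<iota>"
    using \<iota>(1) by (simp add: comodule_hom_def)
  interpret \<iota>: Vector_Spaces.linear "scal S" "scal ES" \<iota> by (rule \<iota>_linear)
  define S0 where "S0 = \<iota> ` car S"
  have S_simple: "car S \<noteq> {0}" "\<And>W. subcomodule H S W \<Longrightarrow> W = {0} \<or> W = car S"
    using assms(3) by (auto simp: simple_comodule_def)
  have zero_S: "0 \<in> car S"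
    by (rule S.V.subspace_0[OF S.car_subspace])
  have S0: "subcomodule H ES S0"
    unfolding ES.subcomodule_iff_act
  proof (intro conjI allI impI ballI)
    show "S0 \<subseteq> car ES"
      using \<iota>(1) by (simp add: S0_def comodule_hom_def)
    show "ES.V.subspace S0"
      unfolding S0_def by (rule \<iota>.subspace_image[OF S.car_subspace])
    show "act H ES f x \<in> S0" if "lform (hscale H) f" "x \<in> S0" for f x
      using that S.subcomoduleD(3)[OF S.subcomodule_car that(1)] hom_act[OF S.M ES.M \<iota>(1) that(1)]
      by (auto simp: S0_def)
  qed
  have "S0 \<noteq> {0}"
  proof
    assume "S0 = {0}"
    then have "\<iota> s = \<iota> 0" if "s \<in> car S" for s
      using that \<iota>.zero by (auto simp: S0_def)
    then have "car S \<subseteq> {0}"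
      using inj_onD[OF \<iota>(2) _ _ zero_S] by blast
    then show False
      using S_simple(1) zero_S by blast
  qed
  \<comment> \<open>The copy \<open>S0\<close> of \<open>S\<close> is simple and essential, so it lies in every nonzero subcomodule.\<close>
  have socle: "S0 \<subseteq> R" if R: "subcomodule H ES R" "R \<noteq> {0}" for R
  proof -
    let ?U = "{s \<in> car S. \<iota> s \<in> R}"
    have "subcomodule H S ?U"
      unfolding S.subcomodule_iff_act
    proof (intro conjI allI impI ballI)
      show "S.V.subspace ?U"
        using S.V.subspace_inter[OF S.car_subspace \<iota>.subspace_linear_preimage[OF ES.subcomoduleD(2)[OF R(1)]]]
        by (simp add: Int_def)
      fix f s assume f: "lform (hscale H) f" and s: "s \<in> ?U"
      then show "act H S f s \<in> ?U"
        using S.subcomoduleD(3)[OF S.subcomodule_car f] ES.subcomoduleD(3)[OF R(1) f]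
        by (simp add: hom_act[OF S.M ES.M \<iota>(1) f, symmetric])
    qed auto
    then have "?U = {0} \<or> ?U = car S"
      by (rule S_simple(2))
    moreover have "?U \<noteq> {0}"
    proof
      assume U: "?U = {0}"
      have "R \<inter> \<iota> ` car S = {0}"
      proof (intro equalityI subsetI)
        fix x assume "x \<in> R \<inter> \<iota> ` car S"
        then obtain s where "s \<in> ?U" "x = \<iota> s" by blast
        then show "x \<in> {0}"
          using U \<iota>.zero by simp
      qed (use zero_S \<iota>.zero ES.V.subspace_0[OF ES.subcomoduleD(2)[OF R(1)]] in force)
      then show False
        using \<iota>(3)[OF R(1)] R(2) by blast
    qed
    ultimately show ?thesis
      by (auto simp: S0_def)
  qed

  obtain s where s: "s \<in> S0" "s \<noteq> 0"
    using \<open>S0 \<noteq> {0}\<close> ES.V.subspace_0[OF ES.subcomoduleD(2)[OF S0]] by blast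
  obtain W0 F0 where W0: "subcomodule H ES W0" "s \<in> W0" "finite F0" "W0 = ES.V.span F0"
    using ES.locally_finite[of s] ES.subcomoduleD(1)[OF S0] s(1) by blast
  have S0_span: "S0 \<subseteq> ES.V.span F0"
    using socle[OF W0(1)] W0(2,4) s(2) by blast
  obtain P where P: "finite P" "ES.V.independent P" "ES.V.span P = S0"
    by (rule ES.V.subspace_basis[OF ES.subcomoduleD(2)[OF S0] S0_span W0(3) empty_subsetI ES.V.independent_empty])
  have PS0: "P \<subseteq> S0"
    using P(3) ES.V.span_superset by blast
  have "P \<noteq> {}"
    using P(3) \<open>S0 \<noteq> {0}\<close> by auto
  then have P_pos: "card P > 0"
    using P(1) by (simp add: card_gt_0_iff)

  obtain F where F: "finite F" "car Ek \<subseteq> Ek.V.span F"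
    using finite_dimensional by blast
  obtain G where G: "finite G" "Ek.V.independent G" "Ek.V.span G = car Ek" "card G = Ek.V.dim (car Ek)"
    by (rule Ek.V.subspace_basis[OF Ek.car_subspace F(2,1) empty_subsetI Ek.V.independent_empty])

  have dim_bound: "ES.V.dim V \<le> card P * card G"
    if V: "subcomodule H ES V" "S0 \<subseteq> V" and X: "V \<subseteq> ES.V.span X" "finite X" for V X
  proof -
    have PV: "P \<subseteq> V"
      using PS0 V(2) by blast
    obtain J where J: "P \<subseteq> J" "finite J" "ES.V.independent J" "ES.V.span J = V" "card J = ES.V.dim V"
      by (rule ES.V.subspace_basis[OF ES.subcomoduleD(2)[OF V(1)] X PV P(2)])
    have "card J \<le> card P * card G"
    proof (rule essential_extension_bound[OF ES.M J(2,3) _ J(1) _ _ G(1,2)])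
      show "subcomodule H ES (ES.V.span J)" "subcomodule H ES (ES.V.span P)"
        using V(1) S0 J(4) P(3) by simp_all
      show "car Ek \<subseteq> Ek.V.span G"
        using G(3) by simp
      fix K assume K: "subcomodule H ES K" "K \<inter> ES.V.span P = {0}"
      then show "K = {0}"
        using socle[OF K(1)] \<open>S0 \<noteq> {0}\<close> P(3) by blast
    qed
    then show ?thesis
      using J(5) by simp
  qed

  \<comment> \<open>The dimensions of the finite dimensional subcomodules are bounded, so a largest one exists; by local
    finiteness it is everything.\<close>
  define fd where "fd = (\<lambda>V. subcomodule H ES V \<and> S0 \<subseteq> V \<and> (\<exists>X. V \<subseteq> ES.V.span X \<and> finite X))"
  have fd_S0: "fd S0"
    using S0 S0_span W0(3) unfolding fd_def by blast
  have "\<forall>V. fd V \<longrightarrow> ES.V.dim V < Suc (card P * card G)"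
    using dim_bound unfolding fd_def less_Suc_eq_le by blast
  from ex_has_greatest_nat[OF fd_S0 this]
  obtain V where fd_V: "fd V" and dim_max: "\<forall>V'. fd V' \<longrightarrow> ES.V.dim V' \<le> ES.V.dim V"
    by blast
  have V: "subcomodule H ES V" "S0 \<subseteq> V"
    using fd_V by (simp_all add: fd_def)
  obtain X where X: "V \<subseteq> ES.V.span X" "finite X"
    using fd_V unfolding fd_def by blast
  have "car ES \<subseteq> V"
  proof
    fix x assume "x \<in> car ES"
    then obtain W Y where W: "subcomodule H ES W" "x \<in> W" "finite Y" "W = ES.V.span Y"
      by (rule ES.locally_finite)
    let ?V' = "ES.V.span (V \<union> W)"
    have V': "?V' \<subseteq> ES.V.span (X \<union> Y)"
      using ES.V.finite_span_Un[OF X, of W Y] W(3,4) by (intro ES.V.span_minimal) auto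
    have sup: "V \<subseteq> ?V'" "x \<in> ?V'"
      using ES.V.span_superset[of "V \<union> W"] W(2) by auto
    have finXY: "finite (X \<union> Y)"
      using W(3) X(2) by simp
    have V'_sub: "subcomodule H ES ?V'"
      by (rule ES.subcomodule_span_Un[OF V(1) W(1)])
    have "fd ?V'"
      unfolding fd_def using V'_sub V(2) sup(1) V' finXY by blast
    then have "\<not> ES.V.dim V < ES.V.dim ?V'"
      using dim_max unfolding not_less by blast
    then have "\<not> V \<subset> ?V'"
      using ES.V.dim_strict_mono_finite[OF ES.subcomoduleD(2)[OF V(1)] ES.subcomoduleD(2)[OF V'_sub] _ V' finXY] by blast
    then show "x \<in> V"
      using sup by blast
  qed
  then have ES_V: "car ES = V"
    using V(1) ES.subcomoduleD(1) by blast
  have dim_ES: "ES.V.dim (car ES) \<le> card P * card G"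
    unfolding ES_V by (rule dim_bound[OF V X])

  obtain n W where W: "composition_series H Ek n W"
    using Ek.composition_series_exists[OF F] by metis
  have factor_dim: "Ek.V.dim (W (Suc i)) \<le> Ek.V.dim (W i) + d" if i: "i < n" for i
  proof -
    have dim_le: "comod_dim T + Ek.V.dim (W' i) = Ek.V.dim (W' (Suc i))" "Ek.V.dim (W' (Suc i)) \<le> Ek.V.dim (car Ek)"
      if "composition_series H Ek n' W'" "i < n'" "is_quotient H (Ek\<lparr>car := W' (Suc i)\<rparr>) (W' i) T" for T n' W' i
    proof -
      have sub: "subcomodule H Ek (W' (Suc i))"
        using that(1,2) by (simp add: composition_series_def)
      show "comod_dim T + Ek.V.dim (W' i) = Ek.V.dim (W' (Suc i))"
        using Ek.quotient_dim[OF that(3) sub _ F(1)] Ek.subcomoduleD(1)[OF sub] F(2) by blast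
      show "Ek.V.dim (W' (Suc i)) \<le> Ek.V.dim (car Ek)"
        by (rule Ek.V.dim_mono_finite[OF Ek.subcomoduleD(2,1)[OF sub] F(2,1)])
    qed
    \<comment> \<open>The maximum that defines \<open>d\<close> is only meaningful once the set of dimensions is known to be finite.\<close>
    let ?D = "{comod_dim T |T. composition_factor H Ek T}"
    have "?D \<subseteq> {..Ek.V.dim (car Ek)}"
      using dim_le unfolding composition_factor_def by fastforce
    then have "finite ?D"
      by (rule finite_subset) simp
    obtain T where T: "is_quotient H (Ek\<lparr>car := W (Suc i)\<rparr>) (W i) T"
      using W i by (auto simp: composition_series_def)
    then have "comod_dim T \<in> ?D"
      using W i unfolding composition_factor_def by blast
    then have "comod_dim T \<le> d"
      using \<open>finite ?D\<close> assms(6) by simp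
    then show ?thesis
      using dim_le(1)[OF W i T] by simp
  qed

  obtain m U where U: "composition_series H ES m U" "\<forall>i<m. U i \<subset> U (Suc i)"
    using ES.composition_series_exists[of X] X ES_V by metis
  have U_sub: "subcomodule H ES (U i)" if "i \<le> m" for i
    using U(1) that by (simp add: composition_series_def)
  have U_span: "U i \<subseteq> ES.V.span X" if "i \<le> m" for i
    using ES.subcomoduleD(1)[OF U_sub[OF that]] X(1) ES_V by blast
  \<comment> \<open>Each step of the composition series accounts for at least \<open>dim S / d\<close> dimensions.\<close>
  have step: "ES.V.dim (U i) * d + card P \<le> ES.V.dim (U (Suc i)) * d" if i: "i < m" for i
  proof -
    have i': "i \<le> m" "Suc i \<le> m"
      using i by auto
    obtain N where N: "finite N" "ES.V.independent N" "ES.V.span N = U i" "card N = ES.V.dim (U i)"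
      by (rule ES.V.subspace_basis[OF ES.subcomoduleD(2)[OF U_sub[OF i'(1)]] U_span[OF i'(1)] X(2) empty_subsetI ES.V.independent_empty])
    have NU: "N \<subseteq> U (Suc i)"
      using N(3) ES.V.span_superset U(2) i by blast
    obtain J where J: "N \<subseteq> J" "finite J" "ES.V.independent J" "ES.V.span J = U (Suc i)" "card J = ES.V.dim (U (Suc i))"
      by (rule ES.V.subspace_basis[OF ES.subcomoduleD(2)[OF U_sub[OF i'(2)]] U_span[OF i'(2)] X(2) NU N(2)])
    have "N \<subset> J"
      using J(1,4) N(3) U(2) i by auto
    have "card P \<le> card (J - N) * d"
    proof (rule socle_bound[OF ES.M J(2,3) _ \<open>N \<subset> J\<close> _ P(1,2)])
      show "subcomodule H ES (ES.V.span J)" "subcomodule H ES (ES.V.span N)"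
        using U_sub i' J(4) N(3) by simp_all
      show "P \<subseteq> K" if "subcomodule H ES K" "K \<noteq> {0}" for K
        using socle[OF that] PS0 by blast
      show "W 0 = {0}" "W n = car Ek" "\<And>i. i \<le> n \<Longrightarrow> subcomodule H Ek (W i)" "\<And>i. i < n \<Longrightarrow> W i \<subseteq> W (Suc i)"
        using W by (simp_all add: composition_series_def)
    qed (rule factor_dim)
    moreover have "ES.V.dim (U (Suc i)) = ES.V.dim (U i) + card (J - N)"
      using J N card_mono[OF J(2,1)] by (simp add: card_Diff_subset)
    ultimately show ?thesis
      by (simp add: add_mult_distrib)
  qed
  have "i * card P \<le> ES.V.dim (U i) * d" if "i \<le> m" for i
    using that
  proof (induction i)
    case (Suc i)
    then show ?case
      using step[of i] by simp
  qed simp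
  from this[OF order_refl] have "m * card P \<le> ES.V.dim (car ES) * d"
    using U(1) by (simp add: composition_series_def)
  also have "\<dots> \<le> card P * card G * d"
    using dim_ES by (rule mult_right_mono) simp
  finally have "card P * m \<le> card P * (d * card G)"
    by (simp add: ac_simps)
  then have "m \<le> d * comod_dim Ek"
    using P_pos G(4) by (simp add: comod_dim_def)
  moreover have "comp_length H ES \<le> enat m"
    unfolding comp_length_def using U(1) by (intro Inf_lower) blast
  ultimately show ?thesis
    by (meson enat_ord_simps(1) order_trans)
qed

end
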